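(* Let $q=\rho/\sigma\in\mathbb{Q}$ with $\rho,\sigma$ nonzero integers and $|q|>1$, and let $\alpha,\lambda\in\mathbb{C}$ satisfy $\alpha\ne 0$, $\lambda\notin q^{\mathbb{Z}_{>0}}$ and $\alpha\notin-\lambda q^{\mathbb{Z}_{>0}}$. Suppose that $$ \gamma=\frac{\log|\rho|}{\log|\sigma|}>\begin{cases} \dfrac{252\pi^2}{173\pi^2-72\sqrt3\,\operatorname{Im}\operatorname{Li}_2(e^{2\pi\sqrt{-1}/3})}=1.53237645\dots & \text{if }\lambda=0,\\[2mm] \dfrac{27\pi^2}{16\pi^2-9\sqrt3\,\operatorname{Im}\operatorname{Li}_2(e^{2\pi\sqrt{-1}/3})}=1.80828115\dots & \text{if }\lambda\ne0. \end{cases} $$ Then the three numbers $\alpha$, $\lambda$ and $\mu=F_q(\alpha;\lambda)$ cannot all be rational.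
   Context: For $|q|>1$ and $\lambda\notin q^{\mathbb{Z}_{>0}}$, $F_q(z;\lambda)$ denotes the entire function $$F_q(z;\lambda)=\sum_{n=0}^\infty\frac{z^n}{\prod_{j=1}^n(q^j-\lambda)}.$$ Here $q^{\mathbb{Z}_{>0}}=\{q^k:k\in\mathbb{Z},\,k>0\}$ and $-\lambda q^{\mathbb{Z}_{>0}}=\{-\lambda q^k: k\in\mathbb{Z},\,k>0\}$. $\operatorname{Li}_2(z)=\sum_{n\ge1}z^n/n^2$ (for $|z|\le1$) is the dilogarithm. Convention: $\gamma=+\infty$ if $q\in\mathbb{Z}$. *)

theory Defs
  imports Complex_Main "HOL-Library.Extended_Real"
begin

text \<open>The series below converge (absolutely) on the domains where they are meant to be used:
  everywhere in \<open>z\<close> for \<open>qF\<close> when \<open>norm q > 1\<close> and \<open>l \<notin> pos_powers q\<close>, and for \<open>norm z \<le> 1\<close>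
  for \<open>Li2\<close>.  Elsewhere the values are junk.\<close>

definition pos_powers :: "complex \<Rightarrow> complex set" where
  "pos_powers q = {q ^ k | k::nat. k > 0}"

definition qF :: "complex \<Rightarrow> complex \<Rightarrow> complex \<Rightarrow> complex" where
  "qF q z l = (\<Sum>n. z ^ n / (\<Prod>j=1..n. (q ^ j - l)))"

text \<open>The index is shifted so that the sum starts at \<open>n = 1\<close>.\<close>

definition Li2 :: "complex \<Rightarrow> complex" where
  "Li2 z = (\<Sum>n. z ^ Suc n / of_nat (Suc n) ^ 2)"

text \<open>The fraction \<open>\<rho> / \<sigma>\<close> need not be in lowest terms; the value is infinite as soon as it is an
  integer.\<close>

definition log_ratio :: "int \<Rightarrow> int \<Rightarrow> ereal" where
  "log_ratio \<rho> \<sigma> =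
     (if real_of_int \<rho> / real_of_int \<sigma> \<in> \<int> then \<infinity>
      else ereal (ln \<bar>real_of_int \<rho>\<bar> / ln \<bar>real_of_int \<sigma>\<bar>))"

text \<open>Numerically, the threshold is 1.53237645... for \<open>l = 0\<close> and 1.80828115... otherwise.\<close>

definition threshold :: "complex \<Rightarrow> real" where
  "threshold l =
     (let c = Im (Li2 (exp (2 * of_real pi * \<i> / 3))) in
      if l = 0 then 252 * pi\<^sup>2 / (173 * pi\<^sup>2 - 72 * sqrt 3 * c)
      else 27 * pi\<^sup>2 / (16 * pi\<^sup>2 - 9 * sqrt 3 * c))"

end

theory Submission
  imports
    Defs
    "Jordan_Normal_Form.Determinant"
    "HOL-Analysis.Gamma_Function"
    "HOL-Computational_Algebra.Fundamental_Theorem_Algebra"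
begin

text \<open>Write \<open>\<mu> = qF q \<alpha> l\<close> and put
  \<open>v\<^sub>n = (\<Prod>j=1..n. q ^ j - l) * (\<mu> - (\<Sum>k\<le>n. \<alpha> ^ k / (\<Prod>j=1..k. q ^ j - l)))\<close>.
  This sequence satisfies \<open>v\<^sub>n\<^sub>+\<^sub>1 = (q ^ (n+1) - l) v\<^sub>n - \<alpha> ^ (n+1)\<close>, so it can be read in two
  ways. If \<alpha>, l and \<mu> are rational, \<open>v\<^sub>n\<close> is a polynomial in q with rational
  coefficients and controlled denominators. As \<mu> is the sum of the series, \<open>v\<^sub>n\<close> is also a tail of
  that series, hence of size at most a constant times \<open>|\<alpha>| ^ n\<close>. The irrationality proof plays these two
  facts against each other in the Hankel determinants \<open>H\<^sub>n = det (v\<^sub>i\<^sub>+\<^sub>j)\<^sub>i\<^sub>,\<^sub>j\<^sub><\<^sub>n\<close>.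

  Let L be the linear functional on polynomials in t with \<open>L(t ^ n) = v\<^sub>n\<close>. Everything rests on
  one identity (\<^emph>\<open>moment_dilate\<close>), a disguise of the recurrence:
  \<open>L((t - \<alpha>)(t + l) P(t)) = q L((q t - \<alpha>) P(q t))\<close>.
  For monic polynomials \<open>p\<^sub>i\<close>, \<open>r\<^sub>i\<close> of degree i one has \<open>H\<^sub>n = det (L(p\<^sub>i r\<^sub>j))\<close>, and
  different choices of these polynomials, fed into the identity, give all the information on \<open>H\<^sub>n\<close>:

  \<^item> For \<open>p\<^sub>k = (\<Prod>m=1..k. t - \<alpha> / q ^ m)\<close> the identity turns \<open>L(p\<^sub>k p\<^sub>j)\<close> into a tiny power of
    q times a moment of moderate size. With \<open>\<kappa> = 3/4\<close> for \<open>l = 0\<close> and \<open>\<kappa> = 1/2\<close> otherwise,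
    \<open>ln |H\<^sub>n| \<le> - 2/3 \<kappa> n\<^sup>3 ln |q| + O(n\<^sup>2)\<close> (\<^emph>\<open>norm_det_hankel_bound\<close>).
  \<^item> With q an indeterminate, products of \<open>t - \<alpha> q ^ m\<close> and \<open>t + l q ^ m\<close> show that \<open>H\<^sub>n\<close> is
    divisible by a power of q with exponent about \<open>\<omega> n\<^sup>3\<close>, where \<open>\<omega> = 5/24\<close> for \<open>l = 0\<close> and
    \<open>\<omega> = 1/6\<close> otherwise (\<^emph>\<open>power_dvd_det_hankel_at_0\<close> and its improvement).
  \<^item> Near a primitive d-th root of unity \<zeta> the d-fold iterate of the identity is almost
    a linear recurrence with constant coefficients, and \<open>H\<^sub>n\<close> vanishes at \<zeta> to order at least the
    sum of \<open>n - \<theta> d\<close> over the \<open>\<theta> < n / d\<close> with \<open>\<theta> = 2, 3, 5, 6, 8, 9, \<dots>\<close>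
    (\<^emph>\<open>power_dvd_det_hankel_at_root_of_unity\<close>).
  \<^item> \<open>H\<^sub>n\<close> is non-zero infinitely often: otherwise, by Kronecker, v would satisfy a linear recurrence
    with constant coefficients, and the identity forces \<open>\<alpha> = - l q ^ k\<close> for some \<open>k > 0\<close>
    (\<^emph>\<open>det_hankel_nonzero_infinitely_often\<close>).

  As a polynomial in q, \<open>H\<^sub>n\<close> has degree \<open>2/3 n\<^sup>3 + O(n\<^sup>2)\<close>. Clear denominators, divide by the known
  factors, which are monic with integer coefficients, and substitute \<open>q = \<rho> / \<sigma>\<close>: multiplied by the power of
  \<sigma> given by the degree, the quotient becomes a non-zero integer. The cyclotomic values involved satisfy
  \<open>(\<Sum>d | d dvd m. h(d)) = m ln |\<rho>| + O(1)\<close> for the logarithms \<open>h(d)\<close> of their homogenised absolute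
  values; from this the total weight of the cyclotomic factor is \<open>S / \<pi>\<^sup>2 n\<^sup>3 ln |\<rho>|\<close> up to \<open>o(n\<^sup>3)\<close>, where
  \<open>S = (\<Sum>\<theta>. 1 / \<theta>\<^sup>2)\<close> runs over the \<theta> above (\<^emph>\<open>gain_weighted_sum_lower_bound\<close>). Comparing
  with the upper bound and dividing by \<open>n\<^sup>3\<close> gives
  \<open>(\<omega> + S / \<pi>\<^sup>2 + 2/3 \<kappa>) ln |\<rho>| \<le> (2/3 + 2/3 \<kappa>) ln |\<sigma>|\<close> (\<^emph>\<open>fundamental_inequality\<close>).
  Since \<open>S = 5/54 \<pi>\<^sup>2 - Im (Li\<^sub>2(exp (2 \<pi> \<i> / 3))) / \<surd>3\<close>, this says exactly that
  \<open>ln |\<rho>| / ln |\<sigma>|\<close> does not exceed the threshold.\<close>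

section \<open>Moments and the dilation identity\<close>

definition moment :: "(nat \<Rightarrow> 'a::comm_ring_1) \<Rightarrow> 'a poly \<Rightarrow> 'a" where
  "moment v P = (\<Sum>i\<le>degree P. coeff P i * v i)"

lemma moment_eq_sum:
  assumes "degree P \<le> n"
  shows "moment v P = (\<Sum>i\<le>n. coeff P i * v i)"
  unfolding moment_def
  by (rule sum.mono_neutral_left) (use assms in \<open>auto simp: coeff_eq_0 not_le\<close>)

lemma moment_add: "moment v (P + Q) = moment v P + moment v Q"
proof -
  let ?n = "max (degree P) (degree Q)"
  have "degree (P + Q) \<le> ?n" by (rule degree_add_le) auto
  then show ?thesis
    by (simp add: moment_eq_sum[of _ ?n] algebra_simps sum.distrib)
qed

lemma moment_smult: "moment v (smult c P) = c * moment v P"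
  using moment_eq_sum[OF degree_smult_le[of c P], of v]
  by (simp add: moment_def sum_distrib_left mult.assoc)

lemma moment_0 [simp]: "moment v 0 = 0"
  by (simp add: moment_def)

lemma moment_minus: "moment v (- P) = - moment v P"
  using moment_smult[of v "-1" P] by simp

lemma moment_diff: "moment v (P - Q) = moment v P - moment v Q"
  using moment_add[of v P "- Q"] by (simp add: moment_minus)

lemma moment_sum: "moment v (\<Sum>i\<in>A. f i) = (\<Sum>i\<in>A. moment v (f i))"
  by (induction A rule: infinite_finite_induct) (auto simp: moment_add)

lemma moment_monom: "moment v (monom c n) = c * v n"
proof -
  have "moment v (monom c n) = (\<Sum>i\<le>n. if i = n then c * v i else 0)"
    unfolding moment_eq_sum[OF degree_monom_le] by (rule sum.cong) auto
  then show ?thesis by simp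
qed

lemma moment_monom_mult: "moment v (monom 1 s * P) = moment (\<lambda>n. v (n + s)) P"
proof -
  have "moment v (monom 1 s * P) = moment v (\<Sum>i\<le>degree P. monom 1 s * monom (coeff P i) i)"
    by (simp add: poly_as_sum_of_monoms flip: sum_distrib_left)
  also have "\<dots> = (\<Sum>i\<le>degree P. coeff P i * v (i + s))"
    by (simp add: sum_distrib_left moment_sum mult_monom moment_monom add.commute)
  also have "\<dots> = moment (\<lambda>n. v (n + s)) P"
    by (simp add: moment_def)
  finally show ?thesis .
qed

definition dilate :: "'a::comm_ring_1 \<Rightarrow> 'a poly \<Rightarrow> 'a poly" where
  "dilate y P = pcompose P [:0, y:]"

lemma coeff_dilate: "coeff (dilate y P) n = y ^ n * coeff P n"
  by (simp add: dilate_def coeff_pcompose_linear)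

lemma dilate_mult: "dilate y (P * Q) = dilate y P * dilate y Q"
  and dilate_add: "dilate y (P + Q) = dilate y P + dilate y Q"
  and dilate_prod: "dilate y (\<Prod>i\<in>A. f i) = (\<Prod>i\<in>A. dilate y (f i))"
  and dilate_1 [simp]: "dilate y 1 = 1"
  and dilate_linear [simp]: "dilate y [:b, c:] = [:b, c * y:]"
  and dilate_const [simp]: "dilate y [:b:] = [:b:]"
  by (auto simp: dilate_def pcompose_mult pcompose_add pcompose_prod pcompose_1
    pcompose_pCons)

lemma dilate_dilate: "dilate y (dilate z P) = dilate (y * z) P"
  by (intro poly_eqI) (simp add: coeff_dilate power_mult_distrib ac_simps)

lemma dilate_monom: "dilate y (monom c n) = monom (y ^ n * c) n"
  by (intro poly_eqI) (simp add: coeff_dilate)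

text \<open>The recurrence is studied over an arbitrary commutative ring, because it is needed both for a complex number
  q in place of x (size and non-vanishing) and for the indeterminate x of a polynomial ring
  (divisibility).\<close>

locale q_sequence =
  fixes x \<alpha> l :: "'a::comm_ring_1" and v :: "nat \<Rightarrow> 'a"
  assumes step: "v (Suc n) = (x ^ Suc n - l) * v n - \<alpha> ^ Suc n"
begin

text \<open>Multiplication by t shifts the sequence. On \<open>P = t ^ n\<close> the factor \<open>t + l\<close> turns the recurrence into
  \<open>x ^ (n+1) v\<^sub>n - \<alpha> ^ (n+1)\<close>, and the factor \<open>t - \<alpha>\<close> then kills the geometric term; what
  remains carries the factor \<open>x ^ n\<close>, which is the effect of \<open>t \<mapsto> x t\<close>.\<close>

lemma moment_dilate:
  "moment v ([:-\<alpha>, 1:] * [:l, 1:] * P) = x * moment v ([:-\<alpha>, x:] * dilate x P)"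
proof -
  have lin: "[:b, c:] = monom b 0 + monom c 1" for b c :: 'a
    by (simp add: monom_0 monom_Suc One_nat_def)
  have *: "moment v ([:-\<alpha>, 1:] * [:l, 1:] * monom c n) = 
      x * moment v ([:-\<alpha>, x:] * dilate x (monom c n))" for c n
  proof -
    have "[:-\<alpha>, 1:] * [:l, 1:] = monom 1 2 + monom (l - \<alpha>) 1 + monom (- (\<alpha> * l)) 0"
      by (simp add: monom_0 monom_Suc One_nat_def numeral_2_eq_2)
    then have "moment v ([:-\<alpha>, 1:] * [:l, 1:] * monom c n) =
        c * v (Suc (Suc n)) + (l - \<alpha>) * c * v (Suc n) - \<alpha> * l * c * v n"
      by (simp add: distrib_right mult_monom moment_add moment_monom numeral_2_eq_2)
    also have "\<dots> = x * (x ^ n * c * (x * v (Suc n) - \<alpha> * v n))"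
      unfolding step[of "Suc n"] step[of n] by (simp add: algebra_simps)
    also have "\<dots> = x * moment v ([:-\<alpha>, x:] * dilate x (monom c n))"
      unfolding lin
      by (simp add: dilate_monom distrib_right mult_monom moment_add moment_monom algebra_simps)
    finally show ?thesis .
  qed
  have P: "P = (\<Sum>i\<le>degree P. monom (coeff P i) i)"
    by (simp add: poly_as_sum_of_monoms)
  have D: "dilate x (\<Sum>i\<in>A. f i) = (\<Sum>i\<in>A. dilate x (f i))" for A and f :: "nat \<Rightarrow> 'a poly"
    by (simp add: dilate_def pcompose_sum)
  show ?thesis
    by (subst (1 2) P) (simp only: D sum_distrib_left moment_sum *)
qed

text \<open>The factors for \<open>m = k\<close> become multiples of \<open>t - \<alpha>\<close> and \<open>t + l\<close> after the dilation by
  \<open>x ^ k\<close>, so the identity applies once more. Each step contributes \<open>x ^ (2 k + 1)\<close>.\<close>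

lemma moment_dilate_iterated:
  "moment v ((\<Prod>m<k. [:-(\<alpha> * x ^ m), 1:] * [:l * x ^ m, 1:]) * P) =
     x ^ (k * k) * moment v ((\<Prod>m=1..k. [:-\<alpha>, x ^ m:]) * dilate (x ^ k) P)"
proof (induction k arbitrary: P)
  case 0
  show ?case by (simp add: dilate_def)
next
  case (Suc k)
  let ?R = "\<Prod>m=1..k. [:-\<alpha>, x ^ m:]"
  have shift: "(\<Prod>m=1..Suc k. [:-\<alpha>, x ^ m:]) = [:-\<alpha>, x:] * dilate x ?R"
  proof -
    have "(\<Prod>m=1..Suc k. [:-\<alpha>, x ^ m:]) = [:-\<alpha>, x ^ 1:] * (\<Prod>m=Suc 1..Suc k. [:-\<alpha>, x ^ m:])"
      by (rule prod.atLeast_Suc_atMost) simp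
    also have "(\<Prod>m=Suc 1..Suc k. [:-\<alpha>, x ^ m:]) = dilate x ?R"
      by (simp only: prod.shift_bounds_cl_Suc_ivl dilate_prod dilate_linear power_Suc2)
    finally show ?thesis by simp
  qed
  have "moment v ((\<Prod>m<Suc k. [:-(\<alpha> * x ^ m), 1:] * [:l * x ^ m, 1:]) * P) =
      x ^ (k * k) * moment v (?R * dilate (x ^ k) ([:-(\<alpha> * x ^ k), 1:] * [:l * x ^ k, 1:] * P))"
    using Suc.IH[of "[:-(\<alpha> * x ^ k), 1:] * [:l * x ^ k, 1:] * P"] by (simp only: prod.lessThan_Suc mult.assoc)
  also have "?R * dilate (x ^ k) ([:-(\<alpha> * x ^ k), 1:] * [:l * x ^ k, 1:] * P) =
      smult (x ^ (2 * k)) ([:-\<alpha>, 1:] * [:l, 1:] * (?R * dilate (x ^ k) P))"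
  proof -
    have "[:-(\<alpha> * x ^ k), 1 * x ^ k:] = smult (x ^ k) [:-\<alpha>, 1:]" 
      "[:l * x ^ k, 1 * x ^ k:] = smult (x ^ k) [:l, 1:]" by simp_all
    then have "?R * dilate (x ^ k) ([:-(\<alpha> * x ^ k), 1:] * [:l * x ^ k, 1:] * P) =
        ?R * (smult (x ^ k) [:-\<alpha>, 1:] * smult (x ^ k) [:l, 1:] * dilate (x ^ k) P)"
      unfolding dilate_mult dilate_linear by (simp only:)
    also have "\<dots> = smult (x ^ k * x ^ k) (?R * ([:-\<alpha>, 1:] * [:l, 1:] * dilate (x ^ k) P))"
      by (simp only: mult_smult_left mult_smult_right smult_smult)
    also have "?R * ([:-\<alpha>, 1:] * [:l, 1:] * dilate (x ^ k) P) = 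
        [:-\<alpha>, 1:] * [:l, 1:] * (?R * dilate (x ^ k) P)"
      by (simp only: ac_simps)
    finally show ?thesis by (simp only: mult_2 power_add)
  qed
  also have "moment v \<dots> = x ^ (2 * k) * (x * moment v ([:-\<alpha>, x:] * dilate x (?R * dilate (x ^ k) P)))"
    by (simp only: moment_smult moment_dilate)
  also have "[:-\<alpha>, x:] * dilate x (?R * dilate (x ^ k) P) =
      (\<Prod>m=1..Suc k. [:-\<alpha>, x ^ m:]) * dilate (x ^ Suc k) P"
    unfolding shift by (simp only: dilate_mult dilate_dilate mult.assoc power_Suc)
  also have "x ^ (k * k) * (x ^ (2 * k) * (x * moment v \<dots>)) = x ^ (Suc k * Suc k) * moment v \<dots>"
  proof -
    have "x ^ (Suc k * Suc k) = x ^ (k * k + 2 * k + 1)" by (rule arg_cong[where f = "\<lambda>e. x ^ e"]) simp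
    then show ?thesis by (simp only: power_add power_one_right mult.assoc)
  qed
  finally show ?case .
qed

end

definition hankel :: "(nat \<Rightarrow> 'a) \<Rightarrow> nat \<Rightarrow> 'a mat" where
  "hankel v n = Matrix.mat n n (\<lambda>(i, j). v (i + j))"

lemma hankel_carrier [simp]: "hankel v n \<in> carrier_mat n n"
  by (simp add: hankel_def)

lemma moment_mult_eq_double_sum:
  assumes "degree P < n" "degree Q < n"
  shows "moment v (P * Q) = (\<Sum>a<n. \<Sum>b<n. coeff P a * coeff Q b * v (a + b))"
proof -
  have eq: "R = (\<Sum>i<n. monom (coeff R i) i)" if "degree R < n" for R :: "'a poly"
  proof -
    have "R = (\<Sum>i\<le>n - 1. monom (coeff R i) i)"
      by (rule poly_as_sum_of_monoms'[symmetric]) (use that in simp)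
    also have "{..n - 1} = {..<n}" using that by auto
    finally show ?thesis .
  qed
  show ?thesis
    by (subst eq[OF assms(1)], subst eq[OF assms(2)])
      (simp add: sum_product mult_monom moment_sum moment_monom)
qed

section \<open>Order of the Hankel determinants at the origin\<close>

text \<open>Only the worst permutation in the Leibniz formula matters. In the applications the exponents \<open>w i j\<close> are
  bounded below by \<open>f i + g j\<close>, and then all permutations give the same bound.\<close>

lemma power_dvd_det:
  fixes e :: "'a::comm_ring_1"
  assumes A: "A \<in> carrier_mat n n"
    and dvd: "\<And>i j. i < n \<Longrightarrow> j < n \<Longrightarrow> e ^ w i j dvd A $$ (i, j)"
    and W: "\<And>p. p permutes {0..<n} \<Longrightarrow> W \<le> (\<Sum>i<n. w i (p i))"
  shows "e ^ W dvd det A"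
  unfolding det_def'[OF A]
proof (intro dvd_sum dvd_mult)
  fix p assume "p \<in> {p. p permutes {0..<n}}"
  then have p: "p permutes {0..<n}" by simp
  have "e ^ W dvd e ^ (\<Sum>i<n. w i (p i))"
    by (rule le_imp_power_dvd[OF W[OF p]])
  also have "\<dots> = (\<Prod>i<n. e ^ w i (p i))"
    by (rule power_sum)
  also have "\<dots> dvd (\<Prod>i<n. A $$ (i, p i))"
    by (rule prod_dvd_prod) (use permutes_in_image[OF p] in \<open>auto intro!: dvd\<close>)
  finally show "e ^ W dvd (\<Prod>i = 0..<n. A $$ (i, p i))"
    by (simp add: lessThan_atLeast0)
qed

text \<open>The degree is only bounded, as the coefficient ring may be trivial.\<close>

definition monic_of_degree :: "'a::comm_ring_1 poly \<Rightarrow> nat \<Rightarrow> bool" where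
  "monic_of_degree P n \<longleftrightarrow> degree P \<le> n \<and> coeff P n = 1"

lemma monic_of_degree_mult:
  assumes "monic_of_degree P m" "monic_of_degree Q n"
  shows "monic_of_degree (P * Q) (m + n)"
proof -
  have "coeff (P * Q) (m + n) = (\<Sum>i\<le>m + n. if i = m then coeff P m * coeff Q n else 0)"
    unfolding coeff_mult
  proof (rule sum.cong)
    fix i assume i: "i \<in> {..m + n}"
    show "coeff P i * coeff Q (m + n - i) = (if i = m then coeff P m * coeff Q n else 0)"
    proof (cases i m rule: linorder_cases)
      case less
      then have "coeff Q (m + n - i) = 0"
        using assms(2) by (intro coeff_eq_0) (auto simp: monic_of_degree_def)
      with less show ?thesis by simp
    next
      case greater
      then have "coeff P i = 0"
        using assms(1) by (intro coeff_eq_0) (auto simp: monic_of_degree_def)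
      with greater show ?thesis by simp
    qed simp
  qed simp
  moreover have "degree (P * Q) \<le> m + n"
    using degree_mult_le[of P Q] assms by (simp add: monic_of_degree_def)
  ultimately show ?thesis
    using assms by (simp add: monic_of_degree_def)
qed

lemma monic_of_degree_1 [simp]: "monic_of_degree 1 0"
  and monic_of_degree_linear [simp]: "monic_of_degree [:b, 1:] (Suc 0)"
  and monic_of_degree_monom [simp]: "monic_of_degree (monom 1 n) n"
  by (auto simp: monic_of_degree_def degree_monom_le)

lemma monic_of_degree_prod:
  assumes "\<And>i. i \<in> A \<Longrightarrow> monic_of_degree (f i) (d i)"
  shows "monic_of_degree (\<Prod>i\<in>A. f i) (\<Sum>i\<in>A. d i)"
  using assms by (induction A rule: infinite_finite_induct) (auto intro!: monic_of_degree_mult)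

lemma monic_of_degree_power:
  assumes "monic_of_degree P n"
  shows "monic_of_degree (P ^ k) (k * n)"
  by (induction k) (auto intro!: monic_of_degree_mult assms)

lemma det_unit_lower_triangular:
  fixes p :: "nat \<Rightarrow> 'a::comm_ring_1 poly"
  assumes "\<And>i. monic_of_degree (p i) i"
  shows "det (Matrix.mat n n (\<lambda>(i, j). coeff (p i) j)) = 1"
proof -
  have zero: "coeff (p i) j = 0" if "i < j" for i j
    using assms[of i] that by (intro coeff_eq_0) (auto simp: monic_of_degree_def)
  have "det (Matrix.mat n n (\<lambda>(i, j). coeff (p i) j)) = prod_list (diag_mat (Matrix.mat n n (\<lambda>(i, j). coeff (p i) j)))"
    by (rule det_lower_triangular[where n = n]) (auto simp: zero)
  also have "\<dots> = 1"
    by (use assms in \<open>simp add: prod_list_diag_prod monic_of_degree_def\<close>)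
  finally show ?thesis .
qed

text \<open>Passing from the powers of t to other monic polynomials of the same degrees multiplies the Hankel matrix from
  both sides by unitriangular matrices.\<close>

lemma det_hankel_change_basis:
  fixes v :: "nat \<Rightarrow> 'a::comm_ring_1"
  assumes p: "\<And>i. monic_of_degree (p i) i" and r: "\<And>i. monic_of_degree (r i) i"
  shows "det (hankel v n) = det (Matrix.mat n n (\<lambda>(i, j). moment v (p i * r j)))"
proof -
  let ?A = "Matrix.mat n n (\<lambda>(i, j). coeff (p i) j)" and ?B = "Matrix.mat n n (\<lambda>(i, j). coeff (r i) j)"
  have "Matrix.mat n n (\<lambda>(i, j). moment v (p i * r j)) = ?A * hankel v n * transpose_mat ?B"
  proof (rule eq_matI)
    fix i j assume *: "i < dim_row (?A * hankel v n * transpose_mat ?B)"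
      "j < dim_col (?A * hankel v n * transpose_mat ?B)"
    then have ij: "i < n" "j < n" by auto
    have "moment v (p i * r j) = (\<Sum>a<n. \<Sum>b<n. coeff (p i) a * coeff (r j) b * v (a + b))"
      by (rule moment_mult_eq_double_sum) (use ij p[of i] r[of j] in \<open>auto simp: monic_of_degree_def\<close>)
    also have "\<dots> = (\<Sum>b<n. \<Sum>a<n. coeff (p i) a * coeff (r j) b * v (a + b))"
      by (rule sum.swap)
    finally show "Matrix.mat n n (\<lambda>(i, j). moment v (p i * r j)) $$ (i, j) =
        (?A * hankel v n * transpose_mat ?B) $$ (i, j)"
      using ij by (simp add: hankel_def scalar_prod_def sum_distrib_right sum_distrib_left 
          lessThan_atLeast0 ac_simps)
  qed auto
  then have "det (Matrix.mat n n (\<lambda>(i, j). moment v (p i * r j))) = det (?A * hankel v n * transpose_mat ?B)"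
    by (rule arg_cong)
  also have "\<dots> = det (?A * hankel v n) * det (transpose_mat ?B)"
    by (rule det_mult[of _ n]) (auto simp: hankel_def)
  also have "det (?A * hankel v n) = det ?A * det (hankel v n)"
    by (rule det_mult[of _ n]) (auto simp: hankel_def)
  also have "det (transpose_mat ?B) = det ?B"
    by (rule det_transpose[of _ n]) auto
  finally have "det (Matrix.mat n n (\<lambda>(i, j). moment v (p i * r j))) = det ?A * det (hankel v n) * det ?B" .
  with det_unit_lower_triangular[OF p] det_unit_lower_triangular[OF r] show ?thesis by simp
qed

lemma power_dvd_det_hankel:
  fixes v :: "nat \<Rightarrow> 'a::comm_ring_1"
  assumes "\<And>i. monic_of_degree (p i) i" "\<And>i. monic_of_degree (r i) i"
    and "\<And>i j. i < n \<Longrightarrow> j < n \<Longrightarrow> e ^ w i j dvd moment v (p i * r j)"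
    and "\<And>p. p permutes {0..<n} \<Longrightarrow> W \<le> (\<Sum>i<n. w i (p i))"
  shows "e ^ W dvd det (hankel v n)"
  unfolding det_hankel_change_basis[of p r, OF assms(1,2)]
  by (rule power_dvd_det[of _ n _ w]) (use assms(3,4) in auto)

lemma prod_smult: "(\<Prod>i\<in>A. smult (c i) (f i)) = smult (\<Prod>i\<in>A. c i) (\<Prod>i\<in>A. f i)"
  for c :: "'b \<Rightarrow> 'a::comm_ring_1"
  by (induction A rule: infinite_finite_induct) (simp_all add: mult.commute)

lemma sum_permutes_lessThan:
  assumes "p permutes {0..<n::nat}"
  shows "(\<Sum>i<n. f (p i)) = (\<Sum>i<n. f i)"
  using sum.permute[OF assms, of f] by (simp add: lessThan_atLeast0 comp_def)

context q_sequence
begin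

definition node_poly :: "nat \<Rightarrow> 'a poly" where
  "node_poly k = (\<Prod>m<k. [:-(\<alpha> * x ^ m), 1:] * [:l * x ^ m, 1:])"

text \<open>Each of the two factors with index \<open>m < k'\<close> gives up a factor \<open>x ^ m\<close>, because \<open>m \<le> k\<close>.\<close>

lemma dilate_node_poly:
  assumes "k' \<le> k"
  shows "\<exists>Q. dilate (x ^ k) (node_poly k') = smult (x ^ (k' * (k' - 1))) Q"
proof -
  have "dilate (x ^ k) (node_poly k') =
      (\<Prod>m<k'. smult (x ^ (2 * m)) ([:-\<alpha>, x ^ (k - m):] * [:l, x ^ (k - m):]))"
    unfolding node_poly_def dilate_prod dilate_mult dilate_linear
  proof (rule prod.cong)
    fix m assume "m \<in> {..<k'}"
    then have "m \<le> k" using assms by auto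
    then have "x ^ k = x ^ m * x ^ (k - m)" by (simp flip: power_add)
    then have "[:-(\<alpha> * x ^ m), 1 * x ^ k:] = smult (x ^ m) [:-\<alpha>, x ^ (k - m):]"
      "[:l * x ^ m, 1 * x ^ k:] = smult (x ^ m) [:l, x ^ (k - m):]" by simp_all
    then show "[:-(\<alpha> * x ^ m), 1 * x ^ k:] * [:l * x ^ m, 1 * x ^ k:] =
        smult (x ^ (2 * m)) ([:-\<alpha>, x ^ (k - m):] * [:l, x ^ (k - m):])"
      by (simp only: mult_smult_left mult_smult_right smult_smult mult_2 power_add)
  qed simp
  also have "\<dots> = smult (\<Prod>m<k'. x ^ (2 * m)) (\<Prod>m<k'. [:-\<alpha>, x ^ (k - m):] * [:l, x ^ (k - m):])"
    by (rule prod_smult)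
  also have "(\<Prod>m<k'. x ^ (2 * m)) = x ^ (\<Sum>m<k'. 2 * m)"
    by (simp add: power_sum)
  also have "(\<Sum>m<k'. 2 * m) = k' * (k' - 1)"
    by (induction k') (auto simp: algebra_simps)
  finally show ?thesis by blast
qed

lemma power_dvd_moment_node_polys:
  assumes "k' \<le> k"
  shows "x ^ (k * k + k' * (k' - 1)) dvd moment v (node_poly k * (P * node_poly k'))"
proof -
  obtain Q where Q: "dilate (x ^ k) (node_poly k') = smult (x ^ (k' * (k' - 1))) Q"
    using dilate_node_poly[OF assms] by blast
  have "moment v (node_poly k * (P * node_poly k')) =
      x ^ (k * k) * (x ^ (k' * (k' - 1)) * moment v ((\<Prod>m=1..k. [:-\<alpha>, x ^ m:]) * (dilate (x ^ k) P * Q)))"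
    unfolding node_poly_def[of k] moment_dilate_iterated
    by (simp only: dilate_mult Q mult_smult_left mult_smult_right moment_smult)
  then show ?thesis
    unfolding power_add mult.assoc[symmetric] by simp
qed

text \<open>The basis \<open>t ^ (i mod 2) * node_poly (i div 2)\<close> is used for rows and columns. In an entry the larger of the two
  node polynomials feeds the iterated identity, which yields \<open>x ^ (k * k)\<close> and dilates the smaller one, which yields
  \<open>x ^ (k' * (k' - 1))\<close>. Lowering the first exponent to \<open>k * (k - 1)\<close> makes the sum symmetric, so that no permutation is
  better than any other. The total is about \<open>n\<^sup>3 / 6\<close>.\<close>

lemma power_dvd_det_hankel_at_0:
  "x ^ (\<Sum>i<n. 2 * ((i div 2) * (i div 2 - 1))) dvd det (hankel v n)"
proof -
  define p where "p = (\<lambda>i. monom 1 (i mod 2) * node_poly (i div 2))"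
  define f :: "nat \<Rightarrow> nat" where "f = (\<lambda>i. (i div 2) * (i div 2 - 1))"
  have monic: "monic_of_degree (p i) i" for i
  proof -
    have "monic_of_degree (p i) (i mod 2 + (\<Sum>m<i div 2. Suc 0 + Suc 0))"
      unfolding p_def node_poly_def
      by (intro monic_of_degree_mult monic_of_degree_prod) auto
    moreover have "i mod 2 + (\<Sum>m<i div 2. Suc 0 + Suc 0) = i" by (simp, presburger)
    ultimately show ?thesis by simp
  qed
  have entry: "x ^ (f i + f j) dvd moment v (p i * p j)" if "j div 2 \<le> i div 2" for i j
  proof -
    have "f i + f j \<le> (i div 2) * (i div 2) + (j div 2) * (j div 2 - 1)"
      unfolding f_def by (intro add_mono mult_le_mono) auto
    then have "x ^ (f i + f j) dvd x ^ ((i div 2) * (i div 2) + (j div 2) * (j div 2 - 1))"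
      by (rule le_imp_power_dvd)
    also have "\<dots> dvd moment v (node_poly (i div 2) * (monom 1 (i mod 2) * monom 1 (j mod 2) * node_poly (j div 2)))"
      by (rule power_dvd_moment_node_polys[OF that])
    also have "node_poly (i div 2) * (monom 1 (i mod 2) * monom 1 (j mod 2) * node_poly (j div 2)) = p i * p j"
      by (simp only: p_def ac_simps)
    finally show ?thesis .
  qed
  show ?thesis
  proof (rule power_dvd_det_hankel[of p p n _ "\<lambda>i j. f i + f j"])
    fix i j assume "i < n" "j < n"
    show "x ^ (f i + f j) dvd moment v (p i * p j)"
      using entry[of j i] entry[of i j] by (cases "j div 2 \<le> i div 2") (auto simp: ac_simps)
  next
    fix \<pi> assume "\<pi> permutes {0..<n}"
    then show "(\<Sum>i<n. 2 * ((i div 2) * (i div 2 - 1))) \<le> (\<Sum>i<n. f i + f (\<pi> i))"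
      using sum_permutes_lessThan[of \<pi> n f]
      by (simp add: sum.distrib f_def flip: sum_distrib_left)
  qed (rule monic)+
qed

end

text \<open>For \<open>l = 0\<close> the factors \<open>t + l x ^ m\<close> degenerate to t. A single spare factor t now pays for a step of
  the identity, and the order at the origin grows from about \<open>n\<^sup>3 / 6\<close> to about \<open>5 n\<^sup>3 / 24\<close>.\<close>

locale q_sequence_0 = q_sequence x \<alpha> "0::'a::comm_ring_1" v for x \<alpha> v
begin

definition half_node_poly :: "nat \<Rightarrow> 'a poly" where
  "half_node_poly k = (\<Prod>m<k. [:-(\<alpha> * x ^ m), 1:])"

lemma moment_half_node_poly_step:
  "moment v (half_node_poly (Suc i) * (monom 1 (Suc j) * Q)) =
     x ^ (i + j + 1) * moment v (half_node_poly i * (monom 1 j * ([:-\<alpha>, x:] * dilate x Q)))"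
proof -
  let ?H = "\<Prod>m<i. [:-(\<alpha> * x ^ Suc m), 1:]"
  have eq: "half_node_poly (Suc i) = [:-\<alpha>, 1:] * ?H"
    by (simp add: half_node_poly_def prod.lessThan_Suc_shift del: prod.lessThan_Suc)
  have "dilate x ?H = (\<Prod>m<i. smult x [:-(\<alpha> * x ^ m), 1:])"
    unfolding dilate_prod dilate_linear by (rule prod.cong) (auto simp: ac_simps)
  also have "\<dots> = smult (x ^ i) (half_node_poly i)"
    unfolding prod_smult by (simp add: half_node_poly_def)
  finally have dil: "dilate x ?H = smult (x ^ i) (half_node_poly i)" .
  have "half_node_poly (Suc i) * (monom 1 (Suc j) * Q) = [:-\<alpha>, 1:] * [:0, 1:] * (?H * (monom 1 j * Q))"
    unfolding eq by (simp only: monom_Suc ac_simps) (simp add: ac_simps)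
  then have "moment v (half_node_poly (Suc i) * (monom 1 (Suc j) * Q)) =
      x * moment v ([:-\<alpha>, x:] * dilate x (?H * (monom 1 j * Q)))"
    by (simp only: moment_dilate)
  also have "[:-\<alpha>, x:] * dilate x (?H * (monom 1 j * Q)) =
      smult (x ^ j * x ^ i) (half_node_poly i * (monom 1 j * ([:-\<alpha>, x:] * dilate x Q)))"
  proof -
    have m: "dilate x (monom 1 j) = smult (x ^ j) (monom 1 j)"
      by (simp add: dilate_monom smult_monom)
    have "[:-\<alpha>, x:] * dilate x (?H * (monom 1 j * Q)) =
      smult (x ^ j * x ^ i) ([:-\<alpha>, x:] * (half_node_poly i * (monom 1 j * dilate x Q)))"
      by (simp only: dilate_mult dil m mult_smult_left mult_smult_right smult_smult)
    also have "[:-\<alpha>, x:] * (half_node_poly i * (monom 1 j * dilate x Q)) =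
        half_node_poly i * (monom 1 j * ([:-\<alpha>, x:] * dilate x Q))"
      by (simp only: ac_simps)
    finally show ?thesis .
  qed
  finally show ?thesis by (simp only: moment_smult power_add mult.assoc power_one_right ac_simps)
qed

text \<open>Without a factor t to start from, the last factor \<open>t - \<alpha> x ^ (d - 1)\<close> is expanded: its constant
  term contributes \<open>x ^ (d - 1)\<close> directly, and its linear term provides the missing t. Either way the order
  grows by \<open>d - 1\<close> while d drops by at most two, and \<open>d\<^sup>2 / 4 = (d - 1) + (d - 2)\<^sup>2 / 4\<close>.\<close>

lemma power_dvd_moment_half_node_poly:
  "x ^ (d * d div 4) dvd moment v (half_node_poly d * Q)"
proof (induction d arbitrary: Q rule: less_induct)
  case (less d)
  have tail: "x ^ (d * d div 4) dvd moment v (half_node_poly d * (monom 1 (Suc 0) * Q))" if pos: "d > 0" for Q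
  proof -
    obtain d' where d: "d = Suc d'" using pos by (cases d) auto
    have "d * d div 4 \<le> d' * d' div 4 + d'"
      by (cases d') (auto simp: d)
    then have "x ^ (d * d div 4) dvd x ^ (d' * d' div 4 + d')"
      by (rule le_imp_power_dvd)
    also have "\<dots> dvd moment v (half_node_poly (Suc d') * (monom 1 (Suc 0) * Q))"
      unfolding moment_half_node_poly_step power_add
      using less[of d'] by (subst mult.commute) (auto intro!: mult_dvd_mono simp: d)
    finally show ?thesis unfolding d .
  qed
  have const: "x ^ (d * d div 4) dvd moment v (half_node_poly d)"
  proof (cases "d \<le> 1")
    case True
    then have "d = 0 \<or> d = 1" by auto
    then show ?thesis by auto
  next
    case False
    then obtain d' where d: "d = Suc (Suc d')"
      by (metis One_nat_def Suc_leI le_SucI nat.exhaust not_less_eq_eq le0)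
    have split: "half_node_poly d = half_node_poly (Suc d') * (monom 1 (Suc 0) * 1) + 
        smult (- (\<alpha> * x ^ Suc d')) (half_node_poly (Suc d') * 1)"
    proof -
      have "half_node_poly d = half_node_poly (Suc d') * [:-(\<alpha> * x ^ Suc d'), 1:]"
        unfolding d half_node_poly_def by simp
      also have "[:-(\<alpha> * x ^ Suc d'), 1:] = monom 1 (Suc 0) + smult (- (\<alpha> * x ^ Suc d')) 1"
        by (simp add: monom_Suc monom_0)
      finally show ?thesis by (simp only: distrib_left mult_smult_right mult_1_right)
    qed
    have eq: "d * d div 4 = (d' + 0 + 1) + d' * d' div 4"
    proof -
      have "d * d = d' * d' + (d' + 1) * 4" by (simp add: d)
      then show ?thesis using div_mult_self1[of 4 "d' * d'" "d' + 1"] by simp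
    qed
    have "x ^ (d * d div 4) dvd moment v (half_node_poly (Suc d') * (monom 1 (Suc 0) * 1))"
      unfolding moment_half_node_poly_step eq power_add
      by (intro mult_dvd_mono dvd_refl less) (simp add: d)
    moreover have "x ^ (d * d div 4) dvd - (\<alpha> * x ^ Suc d') * moment v (half_node_poly (Suc d') * 1)"
    proof -
      have le: "d' * d' div 4 \<le> Suc d' * Suc d' div 4" by (intro div_le_mono mult_le_mono) auto
      have "x ^ (d' * d' div 4) dvd moment v (half_node_poly (Suc d') * 1)"
        using less[of "Suc d'" 1] by (intro dvd_trans[OF le_imp_power_dvd[OF le]]) (simp add: d)
      then have "x ^ (d' + 0 + 1) * x ^ (d' * d' div 4) dvd (- (\<alpha> * x ^ Suc d')) * moment v (half_node_poly (Suc d') * 1)"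
        by (intro mult_dvd_mono) auto
      then show ?thesis by (simp only: eq power_add)
    qed
    ultimately show ?thesis
      unfolding split moment_add moment_smult by (rule dvd_add)
  qed
  show ?case
  proof (cases "d = 0")
    case True
    then show ?thesis by simp
  next
    case False
    obtain c Q' where Q: "Q = pCons c Q'" by (cases Q)
    have "half_node_poly d * Q = smult c (half_node_poly d) + half_node_poly d * (monom 1 (Suc 0) * Q')"
      by (simp add: Q monom_Suc monom_0 distrib_left)
    then show ?thesis
      using tail[of Q'] const False by (simp add: moment_add moment_smult)
  qed
qed

text \<open>As long as a factor t is left, each step lowers i and j by one and contributes
  \<open>x ^ (i + j - 1)\<close>, the difference of \<open>i j\<close> and \<open>(i - 1) (j - 1)\<close>; the surplus \<open>i - j\<close> stays the same.\<close>

lemma power_dvd_moment_half_node_poly_monom: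
  "x ^ (i * j + (i - j) * (i - j) div 4) dvd moment v (half_node_poly i * (monom 1 j * Q))"
proof (induction i arbitrary: j Q)
  case 0
  show ?case by simp
next
  case (Suc i)
  show ?case
  proof (cases j)
    case 0
    then show ?thesis using power_dvd_moment_half_node_poly[of "Suc i" Q] by (simp add: monom_0)
  next
    case j: (Suc j')
    have "Suc i * j + (Suc i - j) * (Suc i - j) div 4 = (i + j' + 1) + (i * j' + (i - j') * (i - j') div 4)"
      by (simp add: j)
    then show ?thesis
      unfolding j moment_half_node_poly_step
      using Suc.IH[of j' "[:-\<alpha>, x:] * dilate x Q"]
      by (simp only: power_add) (auto intro!: mult_dvd_mono)
  qed
qed

end

lemma sum_real_lessThan: "(\<Sum>i<n. real i) = real n * (real n - 1) / 2"
  by (induction n) (auto simp: field_simps)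

lemma sum_real_squares_lessThan:
  "(\<Sum>i<n. (real i)\<^sup>2) = (real n - 1) * real n * (2 * real n - 1) / 6"
  by (induction n) (auto simp: field_simps power2_eq_square)

text \<open>For real i and j the exponent is \<open>(i + j)\<^sup>2 / 4 - (max 0 (j - i))\<^sup>2 / 4\<close>. With \<open>h = n / 2\<close>, the
  worst permutation is the reversal, where \<open>i + j = 2 h\<close>. Accordingly the first square is replaced by its tangent at
  \<open>2 h\<close>, and \<open>max 0 (j - i)\<close> is estimated by \<open>max 0 (h - i) + max 0 (j - h)\<close>. Both estimates are sharp at the reversal,
  and the result is a sum of a function of i and a function of j.\<close>

lemma sum_permutation_lower_bound:
  assumes "\<pi> permutes {0..<n}"
  shows "5 / 24 * real n ^ 3 - 2 * real n ^ 2 \<le>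
    real (\<Sum>i<n. i * \<pi> i + (i - \<pi> i) * (i - \<pi> i) div 4)"
proof -
  define h where "h = real n / 2"
  define F where "F = (\<lambda>t::real. (max 0 (h - t))\<^sup>2)"
  define G where "G = (\<lambda>t::real. (max 0 (t - h))\<^sup>2)"
  \<comment> \<open>This is why the permutation disappears from the final sum.\<close>
  have FG: "F t + G t = (t - h)\<^sup>2" for t
    by (auto simp: F_def G_def max_def power2_commute)
  have bound: "h * (real i + real j) - h\<^sup>2 - (F i + G j) / 2 - 1 \<le>
      real (i * j + (i - j) * (i - j) div 4)" for i j :: nat
  proof -
    have "real ((i - j) * (i - j)) / 4 - 1 \<le> real ((i - j) * (i - j) div 4)"
      by linarith
    moreover have "real ((i - j) * (i - j)) = (real i - real j)\<^sup>2 - (max 0 (real j - real i))\<^sup>2"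
    proof -
      have "real (i - j) = max 0 (real i - real j)" by linarith
      then show ?thesis unfolding of_nat_mult by (simp add: max_def power2_eq_square algebra_simps)
    qed
    moreover have "(max 0 (real j - real i))\<^sup>2 \<le> 2 * (F i + G j)"
    proof -
      have "max 0 (real j - real i) \<le> max 0 (h - i) + max 0 (j - h)" by (auto simp: max_def)
      then have "(max 0 (real j - real i))\<^sup>2 \<le> (max 0 (h - i) + max 0 (j - h))\<^sup>2"
        by (intro power_mono) auto
      also have "\<dots> \<le> 2 * (F i + G j)"
        using sum_squares_bound[of "max 0 (h - i)" "max 0 (j - h)"]
        by (simp add: F_def G_def power2_sum)
      finally show ?thesis .
    qed
    moreover have "(real i + real j)\<^sup>2 / 4 \<ge> h * (real i + real j) - h\<^sup>2"
      using zero_le_power2[of "(real i + real j) / 2 - h"]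
      by (simp add: power2_diff field_simps power2_eq_square)
    moreover have "real i * real j = (real i + real j)\<^sup>2 / 4 - (real i - real j)\<^sup>2 / 4"
      by (simp add: power2_eq_square field_simps)
    ultimately show ?thesis unfolding of_nat_add of_nat_mult[of i j] by linarith
  qed
  have perm: "(\<Sum>i<n. f (\<pi> i)) = (\<Sum>i<n. f i)" for f :: "nat \<Rightarrow> real"
    by (rule sum_permutes_lessThan[OF assms])
  have "(\<Sum>i<n. h * (real i + real (\<pi> i)) - h\<^sup>2 - (F i + G (\<pi> i)) / 2 - 1) =
      (\<Sum>i<n. h * real i) + (\<Sum>i<n. h * real i) - n * h\<^sup>2 - ((\<Sum>i<n. F i) + (\<Sum>i<n. G i)) / 2 - n"
    using perm[of "\<lambda>i. h * real i"] perm[of "\<lambda>i. G (real i)"]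
    by (simp add: sum.distrib sum_subtractf distrib_left flip: sum_divide_distrib)
  also have "\<dots> = 2 * h * (\<Sum>i<n. real i) - n * h\<^sup>2 - (\<Sum>i<n. (real i - h)\<^sup>2) / 2 - n"
    by (simp add: FG flip: sum.distrib sum_distrib_left)
  also have "(\<Sum>i<n. (real i - h)\<^sup>2) = (\<Sum>i<n. (real i)\<^sup>2) - 2 * h * (\<Sum>i<n. real i) + n * h\<^sup>2"
  proof -
    have "(real i - h)\<^sup>2 = (real i)\<^sup>2 - 2 * h * real i + h\<^sup>2" for i
      by (simp add: power2_diff)
    then show ?thesis
      by (simp only: sum.distrib sum_subtractf sum_constant card_lessThan flip: sum_distrib_left)
  qed
  finally have "(\<Sum>i<n. h * (real i + real (\<pi> i)) - h\<^sup>2 - (F i + G (\<pi> i)) / 2 - 1) =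
      5 / 24 * real n ^ 3 - n\<^sup>2 / 2 - 13 / 12 * n"
    unfolding sum_real_lessThan sum_real_squares_lessThan h_def
    by (simp add: field_simps power2_eq_square power3_eq_cube)
  moreover have "13 / 12 * real n \<le> 3 / 2 * real n ^ 2"
    by (cases n) (auto simp: power2_eq_square field_simps)
  moreover have "(\<Sum>i<n. h * (real i + real (\<pi> i)) - h\<^sup>2 - (F i + G (\<pi> i)) / 2 - 1) \<le>
      (\<Sum>i<n. real (i * \<pi> i + (i - \<pi> i) * (i - \<pi> i) div 4))"
    by (rule sum_mono) (rule bound)
  ultimately show ?thesis unfolding of_nat_sum by simp
qed

context q_sequence_0
begin

lemma power_dvd_det_hankel_at_0_improved:
  "\<exists>W. x ^ W dvd det (hankel v n) \<and> real W \<ge> 5 / 24 * real n ^ 3 - 2 * real n ^ 2"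
proof -
  define W where "W = nat \<lceil>5 / 24 * real n ^ 3 - 2 * real n ^ 2\<rceil>"
  have monic: "monic_of_degree (half_node_poly i) i" for i
    using monic_of_degree_prod[of "{..<i}" "\<lambda>m. [:-(\<alpha> * x ^ m), 1:]" "\<lambda>_. Suc 0"]
    by (simp add: half_node_poly_def)
  have "x ^ W dvd det (hankel v n)"
  proof (rule power_dvd_det_hankel[of half_node_poly "monom 1" n _ "\<lambda>i j. i * j + (i - j) * (i - j) div 4"])
    show "x ^ (i * j + (i - j) * (i - j) div 4) dvd moment v (half_node_poly i * monom 1 j)" for i j
      using power_dvd_moment_half_node_poly_monom[of i j 1] by simp
    fix \<pi> assume "\<pi> permutes {0..<n}"
    from sum_permutation_lower_bound[OF this]
    show "W \<le> (\<Sum>i<n. i * \<pi> i + (i - \<pi> i) * (i - \<pi> i) div 4)"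
      unfolding W_def by linarith
  qed (use monic in auto)
  moreover have "real W \<ge> 5 / 24 * real n ^ 3 - 2 * real n ^ 2"
    unfolding W_def by linarith
  ultimately show ?thesis by blast
qed

end

section \<open>Order of the Hankel determinants at roots of unity\<close>

text \<open>Membership in the ideal \<open>(A, e) ^ a * (B, e) ^ b\<close>. The rules follow the generators, which
  makes the closure properties below simple inductions.\<close>

inductive in_ideal_product :: "'r::comm_ring_1 \<Rightarrow> 'r \<Rightarrow> 'r \<Rightarrow> nat \<Rightarrow> nat \<Rightarrow> 'r \<Rightarrow> bool"
  for A B e where
  unit: "in_ideal_product A B e 0 0 F"
| mult_A: "in_ideal_product A B e a b F \<Longrightarrow> in_ideal_product A B e (Suc a) b (A * F)"
| mult_eA: "in_ideal_product A B e a b F \<Longrightarrow> in_ideal_product A B e (Suc a) b (e * F)"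
| mult_B: "in_ideal_product A B e a b F \<Longrightarrow> in_ideal_product A B e a (Suc b) (B * F)"
| mult_eB: "in_ideal_product A B e a b F \<Longrightarrow> in_ideal_product A B e a (Suc b) (e * F)"
| add: "in_ideal_product A B e a b F \<Longrightarrow> in_ideal_product A B e a b G \<Longrightarrow> in_ideal_product A B e a b (F + G)"

lemma in_ideal_product_mult:
  "in_ideal_product A B e a b F \<Longrightarrow> in_ideal_product A B e a b (H * F)"
proof (induction rule: in_ideal_product.induct)
  case (mult_A a b F)
  then show ?case by (subst mult.left_commute) (rule in_ideal_product.mult_A)
next
  case (mult_eA a b F)
  then show ?case by (subst mult.left_commute) (rule in_ideal_product.mult_eA)
next
  case (mult_B a b F)
  then show ?case by (subst mult.left_commute) (rule in_ideal_product.mult_B)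
next
  case (mult_eB a b F)
  then show ?case by (subst mult.left_commute) (rule in_ideal_product.mult_eB)
next
  case (add a b F G)
  then show ?case by (simp add: distrib_left in_ideal_product.add)
qed (rule in_ideal_product.unit)

lemma in_ideal_product_0: "in_ideal_product A B e a b F \<Longrightarrow> in_ideal_product A B e a b 0"
  using in_ideal_product_mult[of A B e a b F 0] by simp

lemma in_ideal_product_SucA:
  assumes "in_ideal_product A B e (Suc a) b F"
  shows "\<exists>G H. in_ideal_product A B e a b G \<and> in_ideal_product A B e a b H \<and> F = A * G + e * H"
  using assms
proof (induction "Suc a" b F rule: in_ideal_product.induct)
  case (mult_A b F)
  then show ?case using in_ideal_product_0[of A B e a b F] by (intro exI[of _ F] exI[of _ 0]) auto
next
  case (mult_eA b F)
  then show ?case using in_ideal_product_0[of A B e a b F] by (intro exI[of _ F] exI[of _ 0]) auto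
next
  case (mult_B b F)
  then obtain G H where "in_ideal_product A B e a b G" "in_ideal_product A B e a b H" "F = A * G + e * H"
    by blast
  then show ?case
    using in_ideal_product.mult_B[of A B e a b G] in_ideal_product.mult_B[of A B e a b H]
    by (intro exI[of _ "B * G"] exI[of _ "B * H"]) (simp add: algebra_simps)
next
  case (mult_eB b F)
  then obtain G H where "in_ideal_product A B e a b G" "in_ideal_product A B e a b H" "F = A * G + e * H"
    by blast
  then show ?case
    using in_ideal_product.mult_eB[of A B e a b G] in_ideal_product.mult_eB[of A B e a b H]
    by (intro exI[of _ "e * G"] exI[of _ "e * H"]) (simp add: algebra_simps)
next
  case (add b F G)
  then obtain F1 F2 G1 G2 where "in_ideal_product A B e a b F1" "in_ideal_product A B e a b F2" "F = A * F1 + e * F2"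
    "in_ideal_product A B e a b G1" "in_ideal_product A B e a b G2" "G = A * G1 + e * G2"
    by blast
  then show ?case
    by (intro exI[of _ "F1 + G1"] exI[of _ "F2 + G2"]) (auto intro: in_ideal_product.add simp: algebra_simps)
qed

lemma in_ideal_product_commute:
  "in_ideal_product A B e a b F \<Longrightarrow> in_ideal_product B A e b a F"
  by (induction rule: in_ideal_product.induct) (auto intro: in_ideal_product.intros)

lemma in_ideal_product_SucB:
  assumes "in_ideal_product A B e a (Suc b) F"
  shows "\<exists>G H. in_ideal_product A B e a b G \<and> in_ideal_product A B e a b H \<and> F = B * G + e * H"
proof -
  obtain G H where "in_ideal_product B A e b a G" "in_ideal_product B A e b a H" "F = B * G + e * H"
    using in_ideal_product_SucA[OF in_ideal_product_commute[OF assms]] by blast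
  then show ?thesis by (intro exI[of _ G] exI[of _ H]) (simp add: in_ideal_product_commute)
qed

lemma in_ideal_product_antimono:
  assumes "in_ideal_product A B e a b F" "a' \<le> a" "b' \<le> b"
  shows "in_ideal_product A B e a' b' F"
proof -
  have 1: "in_ideal_product A B e a b F" if "in_ideal_product A B e (Suc a) b F" for A B a b F
  proof -
    obtain G H where "in_ideal_product A B e a b G" "in_ideal_product A B e a b H" "F = A * G + e * H"
      using in_ideal_product_SucA[OF \<open>in_ideal_product A B e (Suc a) b F\<close>] by blast
    then show ?thesis by (simp add: in_ideal_product.add in_ideal_product_mult)
  qed
  have 2: "in_ideal_product A B e a' b F" if "a' \<le> a" "in_ideal_product A B e a b F" for A B a a' b F
    using that(1,2) by (induction rule: inc_induct) (simp_all add: 1)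
  show ?thesis
    by (rule in_ideal_product_commute, rule 2[OF assms(3)], rule in_ideal_product_commute,
        rule 2[OF assms(2,1)])
qed

lemma in_ideal_product_powers: "in_ideal_product A B e a b (A ^ a * (B ^ b * F))"
proof (induction a)
  case 0
  show ?case
    by (induction b) (simp_all add: in_ideal_product.unit in_ideal_product.mult_B mult.assoc)
qed (simp_all add: in_ideal_product.mult_A mult.assoc)

text \<open>An abstract form of the situation near a root of unity. Modulo e the automorphism \<open>sg\<close> is trivial, so the
  functional equation says that L annihilates the multiples of \<open>A * B\<close> modulo \<open>e0\<close>. The hypothesis that R lies in
  the ideal \<open>(A, e)\<close> makes the two factors behave differently for higher powers of \<open>e0\<close>.\<close>

locale twisted_functional =
  fixes A B e S R :: "'r::comm_ring_1" and e0 :: "'s::comm_ring_1"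
    and L :: "'r \<Rightarrow> 's" and sg :: "'r \<Rightarrow> 'r"
  assumes L_add: "L (F + G) = L F + L G" and L_e: "L (e * F) = e0 * L F"
    and sg_add: "sg (F + G) = sg F + sg G" and sg_mult: "sg (F * G) = sg F * sg G"
    and sg_e: "sg e = e" and sg_cong: "e dvd sg F - F"
    and functional_equation: "L (S * F) = L (R * sg F)"
    and R_cong: "\<exists>U U'. R = A * U + e * U'" and S_cong: "e dvd S - R - A * B"
begin

abbreviation J :: "nat \<Rightarrow> nat \<Rightarrow> 'r \<Rightarrow> bool" where
  "J \<equiv> in_ideal_product A B e"

text \<open>A difference quotient behaves like a derivation: it removes one factor A or one factor B. The bound lowers
  both exponents, which covers the two cases at once.\<close>

lemma sg_minus_in_ideal_product:
  assumes "J a b F"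
  shows "\<exists>F'. J (a - 1) (b - 1) F' \<and> sg F - F = e * F'"
  using assms
proof (induction rule: in_ideal_product.induct)
  case (unit F)
  then show ?case using sg_cong[of F] by (auto intro: in_ideal_product.unit elim!: dvdE)
next
  case (mult_A a b F)
  then obtain F' where F': "J (a - 1) (b - 1) F'" "sg F - F = e * F'" by blast
  obtain A' where A': "sg A - A = e * A'" using sg_cong[of A] by (auto elim: dvdE)
  have "J a (b - 1) (A * F' + e * (A' * F'))"
    by (rule in_ideal_product_antimono[OF in_ideal_product.add[OF
          in_ideal_product.mult_A[OF F'(1)] in_ideal_product.mult_eA[OF in_ideal_product_mult[OF F'(1)]]]]) auto
  moreover have "J a (b - 1) (A' * F)"
    by (rule in_ideal_product_mult, rule in_ideal_product_antimono[OF mult_A(1)]) auto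
  ultimately have "J a (b - 1) (A * F' + e * (A' * F') + A' * F)"
    by (rule in_ideal_product.add)
  moreover have "sg (A * F) - A * F = sg A * (sg F - F) + (sg A - A) * F"
    by (simp add: sg_mult algebra_simps)
  moreover have "sg A = A + e * A'" using A' by (simp add: algebra_simps)
  ultimately show ?case
    by (intro exI[of _ "A * F' + e * (A' * F') + A' * F"]) (auto simp: F'(2) algebra_simps)
next
  case (mult_B a b F)
  then obtain F' where F': "J (a - 1) (b - 1) F'" "sg F - F = e * F'" by blast
  obtain A' where A': "sg B - B = e * A'" using sg_cong[of B] by (auto elim: dvdE)
  have "J (a - 1) b (B * F' + e * (A' * F'))"
    by (rule in_ideal_product_antimono[OF in_ideal_product.add[OF
          in_ideal_product.mult_B[OF F'(1)] in_ideal_product.mult_eB[OF in_ideal_product_mult[OF F'(1)]]]]) auto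
  moreover have "J (a - 1) b (A' * F)"
    by (rule in_ideal_product_mult, rule in_ideal_product_antimono[OF mult_B(1)]) auto
  ultimately have "J (a - 1) b (B * F' + e * (A' * F') + A' * F)"
    by (rule in_ideal_product.add)
  moreover have "sg (B * F) - B * F = sg B * (sg F - F) + (sg B - B) * F"
    by (simp add: sg_mult algebra_simps)
  moreover have "sg B = B + e * A'" using A' by (simp add: algebra_simps)
  ultimately show ?case
    by (intro exI[of _ "B * F' + e * (A' * F') + A' * F"]) (auto simp: F'(2) algebra_simps)
next
  case (mult_eA a b F)
  then obtain F' where F': "J (a - 1) (b - 1) F'" "sg F - F = e * F'" by blast
  have "J a (b - 1) (e * F')"
    by (rule in_ideal_product_antimono[OF in_ideal_product.mult_eA[OF F'(1)]]) auto
  moreover have "sg (e * F) - e * F = e * (sg F - F)"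
    by (simp add: sg_mult sg_e algebra_simps)
  ultimately show ?case by (intro exI[of _ "e * F'"]) (auto simp: F'(2))
next
  case (mult_eB a b F)
  then obtain F' where F': "J (a - 1) (b - 1) F'" "sg F - F = e * F'" by blast
  have "J (a - 1) b (e * F')"
    by (rule in_ideal_product_antimono[OF in_ideal_product.mult_eB[OF F'(1)]]) auto
  moreover have "sg (e * F) - e * F = e * (sg F - F)"
    by (simp add: sg_mult sg_e algebra_simps)
  ultimately show ?case by (intro exI[of _ "e * F'"]) (auto simp: F'(2))
next
  case (add a b F G)
  then obtain F' G' where "J (a - 1) (b - 1) F'" "sg F - F = e * F'"
    "J (a - 1) (b - 1) G'" "sg G - G = e * G'" by blast
  moreover have "sg (F + G) - (F + G) = (sg F - F) + (sg G - G)" by (simp add: sg_add)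
  ultimately show ?case
    by (intro exI[of _ "F' + G'"]) (simp add: in_ideal_product.add distrib_left)
qed

lemma L_diff: "L (F - G) = L F - L G"
  using L_add[of "F - G" G] by simp

text \<open>Each power of \<open>e0\<close> costs one factor A and two factors B, except that the first one costs a single
  B. Indeed \<open>L(A * B * G)\<close> is \<open>L(R * (sg G - G))\<close> up to multiples of \<open>e0\<close>. The difference \<open>sg G - G\<close> yields a factor e at
  the price of one A and one B, and R restores the A. So the step consumes
  one A and two B.\<close>

lemma power_dvd_functional:
  assumes "J k (2 * k - 1) F"
  shows "e0 ^ k dvd L F"
  using assms
proof (induction k arbitrary: F)
  case 0
  show ?case by simp
next
  case (Suc k)
  have IH: "e0 ^ k dvd L G" if "J k (2 * k) G" for G
    using Suc.IH[OF in_ideal_product_antimono[OF that]] by auto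
  from Suc.prems have "J (Suc k) (Suc (2 * k)) F" by simp
  then obtain G H where GH: "J k (Suc (2 * k)) G"
    "J k (Suc (2 * k)) H" "F = A * G + e * H"
    using in_ideal_product_SucA by blast
  obtain G1 G2 where G: "J k (2 * k) G1" "J k (2 * k) G2"
    "G = B * G1 + e * G2"
    using in_ideal_product_SucB[OF GH(1)] by blast
  obtain C where C: "S - R - A * B = e * C" using S_cong by (auto elim: dvdE)
  obtain U U' where U: "R = A * U + e * U'" using R_cong by blast
  obtain G' where G': "J (k - 1) (2 * k - 1) G'" "sg G1 - G1 = e * G'"
    using sg_minus_in_ideal_product[OF G(1)] by auto
  have "F = (S * G1 - R * G1) + e * (A * G2 + H - C * G1)"
  proof -
    have "A * B = S - R - e * C" using C by (simp add: algebra_simps)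
    then have "A * B * G1 = (S - R - e * C) * G1" by simp
    then show ?thesis by (simp add: GH(3) G(3) algebra_simps)
  qed
  then have "L F = L (R * (sg G1 - G1)) + e0 * L (A * G2 + H - C * G1)"
    by (simp only: L_add L_diff L_e functional_equation right_diff_distrib)
  also have "R * (sg G1 - G1) = e * (R * G')" by (simp add: G'(2) mult.left_commute)
  finally have LF: "L F = e0 * (L (R * G') + L (A * G2 + H - C * G1))"
    by (simp add: L_e distrib_left)
  have "e0 ^ k dvd L (R * G')"
  proof (rule Suc.IH, cases k)
    case 0
    then show "J k (2 * k - 1) (R * G')" by (auto intro: in_ideal_product.unit)
  next
    case (Suc k')
    have "J (Suc (k - 1)) (2 * k - 1) (A * (U * G') + e * (U' * G'))"
      by (intro in_ideal_product.add in_ideal_product.mult_A in_ideal_product.mult_eA)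
        (rule in_ideal_product_mult[OF G'(1)])+
    then show "J k (2 * k - 1) (R * G')" by (simp add: Suc U algebra_simps)
  qed
  moreover have "e0 ^ k dvd L (A * G2 + H - C * G1)"
    unfolding L_diff L_add
    by (intro dvd_add dvd_diff IH in_ideal_product_mult[OF G(1)] in_ideal_product_mult[OF G(2)]
        in_ideal_product_antimono[OF GH(2)]) auto
  ultimately show ?case
    unfolding LF power_Suc by (intro mult_dvd_mono dvd_add) auto
qed

end

text \<open>Congruences modulo \<open>x - \<zeta>\<close> between polynomials in t with coefficients in \<open>\<complex>[x]\<close> can be checked by
  substituting numbers for t and \<zeta> for x.\<close>

lemma const_dvd_of_eval_zero:
  fixes P :: "complex poly poly"
  assumes "\<And>t. poly (poly P [:t:]) \<zeta> = 0"
  shows "[:[:-\<zeta>, 1:]:] dvd P"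
proof -
  have "poly (poly P [:t:]) \<zeta> = poly (map_poly (\<lambda>c. poly c \<zeta>) P) t" for t
    by (induction P) (auto simp: map_poly_pCons)
  with assms have "map_poly (\<lambda>c. poly c \<zeta>) P = 0"
    by (simp flip: poly_all_0_iff_0)
  then have "coeff (map_poly (\<lambda>c. poly c \<zeta>) P) n = 0" for n
    by simp
  then have "poly (coeff P n) \<zeta> = 0" for n
    by (simp add: coeff_map_poly)
  then show ?thesis
    by (simp add: const_poly_dvd_iff poly_eq_0_iff_dvd)
qed

lemma prod_roots_of_unity:
  assumes "m > 0"
  shows "(\<Prod>z\<in>{z::complex. z ^ m = 1}. [:-z, 1:]) = monom 1 m - 1"
proof -
  let ?Z = "{z::complex. z ^ m = 1}"
  have fin: "finite ?Z" and card: "card ?Z = m"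
    using assms finite_roots_unity[of m] card_roots_unity_eq[of m] by auto
  have "degree (\<Prod>z\<in>?Z. [:-z, 1:]) = m"
    by (subst degree_prod_eq_sum_degree) (auto simp: card)
  moreover have "lead_coeff (\<Prod>z\<in>?Z. [:-z, 1:]) = 1"
    by (simp add: lead_coeff_prod)
  moreover have "degree (monom 1 m - 1 :: complex poly) = m"
    using degree_add_eq_left[of "- 1" "monom (1::complex) m"] assms by (simp add: degree_monom_eq)
  moreover have "poly (\<Prod>z\<in>?Z. [:-z, 1:]) z = poly (monom 1 m - 1) z" if "z \<in> ?Z" for z
  proof -
    have "poly (\<Prod>z\<in>?Z. [:-z, 1:]) z = 0"
      unfolding poly_prod by (rule prod_zero) (use fin that in auto)
    then show ?thesis using that by (simp add: poly_monom)
  qed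
  ultimately show ?thesis
    by (intro poly_eqI_degree_lead_coeff[of _ m _ ?Z]) (use card assms in auto)
qed

definition primitive_root :: "nat \<Rightarrow> complex \<Rightarrow> bool" where
  "primitive_root d \<zeta> \<longleftrightarrow> d > 0 \<and> \<zeta> ^ d = 1 \<and> (\<forall>k. 0 < k \<longrightarrow> k < d \<longrightarrow> \<zeta> ^ k \<noteq> 1)"

lemma primitive_root_powers:
  assumes "primitive_root d \<zeta>"
  shows "inj_on (\<lambda>m. \<zeta> ^ m) {..<d}" and "(\<lambda>m. \<zeta> ^ m) ` {..<d} = {z. z ^ d = 1}"
proof -
  have d: "d > 0" "\<zeta> ^ d = 1" and prim: "\<And>k. 0 < k \<Longrightarrow> k < d \<Longrightarrow> \<zeta> ^ k \<noteq> 1"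
    using assms by (auto simp: primitive_root_def)
  have "\<zeta> \<noteq> 0" using d by (auto simp: zero_power)
  have *: False if "i < j" "j < d" "\<zeta> ^ i = \<zeta> ^ j" for i j
  proof -
    have "\<zeta> ^ j = \<zeta> ^ i * \<zeta> ^ (j - i)" using that(1) power_add[of \<zeta> i "j - i"] by simp
    then have "\<zeta> ^ (j - i) = 1" using that(3) \<open>\<zeta> \<noteq> 0\<close> by simp
    moreover have "0 < j - i" "j - i < d" using that by auto
    ultimately show False using prim by blast
  qed
  show inj: "inj_on (\<lambda>m. \<zeta> ^ m) {..<d}"
  proof (rule inj_onI)
    fix i j assume "i \<in> {..<d}" "j \<in> {..<d}" "\<zeta> ^ i = \<zeta> ^ j"
    then show "i = j" using *[of i j] *[of j i] by (cases i j rule: linorder_cases) auto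
  qed
  show "(\<lambda>m. \<zeta> ^ m) ` {..<d} = {z. z ^ d = 1}"
  proof (rule card_subset_eq)
    show "finite {z::complex. z ^ d = 1}" using d finite_roots_unity[of d] by auto
    show "(\<lambda>m. \<zeta> ^ m) ` {..<d} \<subseteq> {z. z ^ d = 1}"
    proof
      fix z assume "z \<in> (\<lambda>m. \<zeta> ^ m) ` {..<d}"
      then obtain m where z: "z = \<zeta> ^ m" by blast
      have "z ^ d = (\<zeta> ^ d) ^ m" unfolding z by (simp only: power_mult[symmetric] mult.commute)
      then show "z \<in> {z. z ^ d = 1}" using d by simp
    qed
    show "card ((\<lambda>m. \<zeta> ^ m) ` {..<d}) = card {z::complex. z ^ d = 1}"
      using card_roots_unity_eq[of d] d by (simp add: card_image[OF inj])
  qed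
qed

lemma prod_primitive_root_powers:
  assumes "primitive_root d \<zeta>"
  shows "(\<Prod>m<d. t - a * \<zeta> ^ m) = t ^ d - a ^ d"
proof (cases "a = 0")
  case True
  then show ?thesis using assms by (simp add: primitive_root_def)
next
  case False
  have d: "d > 0" using assms by (simp add: primitive_root_def)
  have "(\<Prod>m<d. t - a * \<zeta> ^ m) = (\<Prod>m<d. a * (t / a - \<zeta> ^ m))"
    by (rule prod.cong) (use False in \<open>auto simp: field_simps\<close>)
  also have "\<dots> = a ^ d * (\<Prod>m<d. t / a - \<zeta> ^ m)" by (simp add: prod.distrib)
  also have "(\<Prod>m<d. t / a - \<zeta> ^ m) = (\<Prod>z\<in>(\<lambda>m. \<zeta> ^ m) ` {..<d}. t / a - z)"
    by (simp add: prod.reindex[OF primitive_root_powers(1)[OF assms]])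
  also have "\<dots> = poly (\<Prod>z\<in>{z::complex. z ^ d = 1}. [:-z, 1:]) (t / a)"
    by (simp add: poly_prod primitive_root_powers(2)[OF assms])
  also have "\<dots> = (t / a) ^ d - 1"
    unfolding prod_roots_of_unity[OF d] by (simp add: poly_monom)
  finally show ?thesis using False by (simp add: power_divide right_diff_distrib)
qed

lemma prod_primitive_root_powers':
  assumes "primitive_root d \<zeta>"
  shows "(\<Prod>m=1..d. \<zeta> ^ m * t - a) = (\<Prod>m=1..d. \<zeta> ^ m) * (t ^ d - a ^ d)"
proof -
  have d: "d > 0" "\<zeta> ^ d = 1" using assms by (auto simp: primitive_root_def)
  have "(\<Prod>m=1..d. \<zeta> ^ m * t - a) = (\<Prod>m=1..d. \<zeta> ^ m * (t - a * \<zeta> ^ (d - m)))"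
  proof (rule prod.cong)
    fix m assume "m \<in> {1..d}"
    then have "\<zeta> ^ m * \<zeta> ^ (d - m) = 1" using d by (simp flip: power_add)
    then show "\<zeta> ^ m * t - a = \<zeta> ^ m * (t - a * \<zeta> ^ (d - m))"
      by (simp add: algebra_simps)
  qed simp
  also have "\<dots> = (\<Prod>m=1..d. \<zeta> ^ m) * (\<Prod>m=1..d. t - a * \<zeta> ^ (d - m))"
    by (rule prod.distrib)
  also have "(\<Prod>m=1..d. t - a * \<zeta> ^ (d - m)) = (\<Prod>m<d. t - a * \<zeta> ^ m)"
    by (rule prod.reindex_bij_witness[of _ "\<lambda>m. d - m" "\<lambda>m. d - m"]) auto
  finally show ?thesis by (simp add: prod_primitive_root_powers[OF assms])
qed

text \<open>The number of positive integers up to u that are not congruent to 1 modulo 3, by \<^emph>\<open>gain_eq_sum\<close>.\<close>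

definition gain :: "nat \<Rightarrow> nat" where
  "gain u = u div 3 + (u + 1) div 3"

locale poly_q_sequence =
  q_sequence "[:0, 1:] :: complex poly" "[:a:]" "[:c:]" v for a c :: complex and v
begin

text \<open>The d-fold iterate of the dilation identity is the functional equation of \<^emph>\<open>twisted_functional\<close> with
  \<open>e0 = x - \<zeta>\<close> and the dilation by \<open>x ^ d\<close> as automorphism, since \<open>x ^ d\<close> is 1 at \<zeta>.
  At \<open>x = \<zeta>\<close> the product of the \<open>t - a x ^ m\<close> is \<open>t ^ d - a ^ d\<close>, that of the \<open>t + c x ^ m\<close> is
  \<open>t ^ d - (- c) ^ d\<close>, and the right-hand product is a constant times \<open>t ^ d - a ^ d\<close> again.
  This determines A and B.\<close>

lemma power_dvd_moment_at_root_of_unity: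
  assumes \<zeta>: "primitive_root d \<zeta>"
  shows "\<exists>A B. monic_of_degree A d \<and> monic_of_degree B d \<and>
    (\<forall>k F. in_ideal_product A B [:[:-\<zeta>, 1:]:] k (2 * k - 1) F \<longrightarrow> [:-\<zeta>, 1:] ^ k dvd moment v F)"
proof -
  define X :: "complex poly" where "X = [:0, 1:]"
  define s where "s = (\<Prod>m=1..d. \<zeta> ^ m)"
  define A :: "complex poly poly" where "A = monom 1 d + [:[:- (a ^ d):]:]"
  define B :: "complex poly poly" where "B = monom 1 d + [:[:- ((- c) ^ d + s):]:]"
  define R where "R = smult (X ^ (d * d)) (\<Prod>m=1..d. [:-[:a:], X ^ m:])"
  define S where "S = (\<Prod>m<d. [:-([:a:] * X ^ m), 1:] * [:[:c:] * X ^ m, 1:])"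
  let ?e = "[:[:-\<zeta>, 1:]:]"
  have d: "d > 0" "\<zeta> ^ d = 1" using \<zeta> by (auto simp: primitive_root_def)
  have dd: "\<zeta> ^ (d * d) = 1" using d by (simp add: power_mult)
  have evA: "poly (poly A [:t:]) \<zeta> = t ^ d - a ^ d" for t
    by (simp add: A_def poly_monom poly_power)
  have evB: "poly (poly B [:t:]) \<zeta> = t ^ d - ((- c) ^ d + s)" for t
    by (simp add: B_def poly_monom poly_power)
  have evR: "poly (poly R [:t:]) \<zeta> = s * (t ^ d - a ^ d)" for t
    using prod_primitive_root_powers'[OF \<zeta>, of t a] dd
    by (simp add: R_def poly_prod poly_power X_def s_def mult.commute)
  have evS: "poly (poly S [:t:]) \<zeta> = (t ^ d - a ^ d) * (t ^ d - (- c) ^ d)" for t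
  proof -
    have "poly (poly S [:t:]) \<zeta> = (\<Prod>m<d. (t - a * \<zeta> ^ m) * (t - (- c) * \<zeta> ^ m))"
      unfolding S_def poly_prod by (rule prod.cong) (simp_all add: poly_power X_def algebra_simps)
    then show ?thesis
      by (simp only: prod.distrib prod_primitive_root_powers[OF \<zeta>])
  qed
  interpret twisted_functional A B ?e S R "[:-\<zeta>, 1:]" "moment v" "dilate (X ^ d)"
  proof
    fix F G :: "complex poly poly"
    show "?e dvd dilate (X ^ d) F - F"
    proof (subst const_poly_dvd_iff, rule allI)
      fix n
      have "poly ((X ^ d) ^ n - 1) \<zeta> = 0" by (simp add: X_def poly_power d)
      then have "[:-\<zeta>, 1:] dvd ((X ^ d) ^ n - 1) * coeff F n"
        by (simp only: poly_eq_0_iff_dvd) simp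
      then show "[:-\<zeta>, 1:] dvd coeff (dilate (X ^ d) F - F) n"
        by (simp add: coeff_dilate algebra_simps)
    qed
    show "moment v (S * F) = moment v (R * dilate (X ^ d) F)"
      using moment_dilate_iterated[of d F] by (simp add: S_def R_def X_def moment_smult)
    have "?e dvd R - A * [:[:s:]:]"
      by (rule const_dvd_of_eval_zero) (simp add: evR evA)
    then obtain U' where "R - A * [:[:s:]:] = ?e * U'" by (elim dvdE)
    then have "R = A * [:[:s:]:] + ?e * U'" by (simp only: diff_eq_eq add.commute)
    then show "\<exists>U U'. R = A * U + ?e * U'" by blast
    show "?e dvd S - R - A * B"
      by (rule const_dvd_of_eval_zero) (simp add: evR evA evS evB algebra_simps)
  qed (simp_all add: moment_add moment_smult dilate_add dilate_mult)
  have "monic_of_degree (monom 1 d + [:y:]) d" for y :: "complex poly"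
    using d degree_add_le[of "monom 1 d" d "[:y:]"]
    by (simp add: monic_of_degree_def degree_monom_le coeff_pCons split: nat.split)
  then have "monic_of_degree A d" "monic_of_degree B d"
    by (simp_all only: A_def B_def)
  with power_dvd_functional show ?thesis by blast
qed

text \<open>The polynomial of degree i contains \<open>i div d\<close> factors A or B, distributed in the ratio 1 to 2 required by
  \<^emph>\<open>power_dvd_functional\<close>. For an entry with indices i and j this gives at least half the sum of the two
  gains, rounded up, so that again the permutation drops out.\<close>

lemma power_dvd_det_hankel_at_root_of_unity:
  assumes \<zeta>: "primitive_root d \<zeta>"
  shows "[:-\<zeta>, 1:] ^ (\<Sum>i<n. gain (i div d)) dvd det (hankel v n)"
proof -
  have d: "d > 0" using \<zeta> by (auto simp: primitive_root_def)
  obtain A B where AB: "monic_of_degree A d" "monic_of_degree B d"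
    and dvd: "\<And>k F. in_ideal_product A B [:[:-\<zeta>, 1:]:] k (2 * k - 1) F \<Longrightarrow> [:-\<zeta>, 1:] ^ k dvd moment v F"
    using power_dvd_moment_at_root_of_unity[OF \<zeta>] by blast
  define f g where "f = (\<lambda>i. (i div d + 1) div 3)" and "g = (\<lambda>i. i div d - (i div d + 1) div 3)"
  define p where "p = (\<lambda>i. A ^ f i * B ^ g i * monom 1 (i mod d))"
  define w where "w = (\<lambda>i j. min (f i + f j) ((g i + g j + 1) div 2))"
  have monic: "monic_of_degree (p i) i" for i
  proof -
    have "monic_of_degree (p i) (f i * d + g i * d + i mod d)"
      unfolding p_def by (intro monic_of_degree_mult monic_of_degree_power AB) simp
    moreover have "f i + g i = i div d" by (auto simp: f_def g_def)
    then have "f i * d + g i * d = i div d * d" by (simp flip: distrib_right)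
    ultimately show ?thesis by simp
  qed
  show ?thesis
  proof (rule power_dvd_det_hankel[of p p n _ w])
    fix i j assume "i < n" "j < n"
    have "p i * p j = A ^ (f i + f j) * (B ^ (g i + g j) * (monom 1 (i mod d) * monom 1 (j mod d)))"
      by (simp only: p_def power_add ac_simps)
    then have "in_ideal_product A B [:[:-\<zeta>, 1:]:] (f i + f j) (g i + g j) (p i * p j)"
      by (simp only: in_ideal_product_powers)
    then have "in_ideal_product A B [:[:-\<zeta>, 1:]:] (w i j) (2 * w i j - 1) (p i * p j)"
    proof (rule in_ideal_product_antimono)
      have "w i j \<le> (g i + g j + 1) div 2" by (simp add: w_def)
      then show "2 * w i j - 1 \<le> g i + g j" by linarith
    qed (simp add: w_def)
    then show "[:-\<zeta>, 1:] ^ w i j dvd moment v (p i * p j)" by (rule dvd)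
  next
    fix \<pi> assume \<pi>: "\<pi> permutes {0..<n}"
    let ?G = "\<lambda>i. gain (i div d)"
    have "gain u \<le> 2 * ((u + 1) div 3)" "gain u \<le> u - (u + 1) div 3" for u
    proof -
      have "(u + 1) div 3 = u div 3 \<or> (u + 1) div 3 = u div 3 + 1" by linarith
      moreover have "3 * (u div 3) \<le> u" "3 * ((u + 1) div 3) \<le> u + 1" by simp_all
      ultimately show "gain u \<le> 2 * ((u + 1) div 3)" "gain u \<le> u - (u + 1) div 3"
        unfolding gain_def by auto
    qed
    then have Gf: "?G i \<le> 2 * f i" and Gg: "?G i \<le> g i" for i
      unfolding f_def g_def by blast+
    have G: "?G i + ?G j \<le> 2 * (f i + f j)" "?G i + ?G j \<le> g i + g j" for i j
      using add_mono[OF Gf[of i] Gf[of j]] add_mono[OF Gg[of i] Gg[of j]] by (simp_all only: distrib_left)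
    have m: "s \<le> 2 * min a ((b + 1) div 2)" if "s \<le> 2 * a" "s \<le> b" for s a b :: nat
      using that by (auto simp: min_def)
    have "?G i + ?G j \<le> 2 * w i j" for i j
      unfolding w_def by (rule m[OF G])
    then have "(\<Sum>i<n. ?G i + ?G (\<pi> i)) \<le> (\<Sum>i<n. 2 * w i (\<pi> i))"
      by (intro sum_mono)
    then show "(\<Sum>i<n. ?G i) \<le> (\<Sum>i<n. w i (\<pi> i))"
      using sum_permutes_lessThan[OF \<pi>, of ?G] by (simp only: sum.distrib sum_distrib_left[symmetric])
  qed (simp_all only: monic)
qed

end

section \<open>Cyclotomic factors and integrality\<close>

lemma prod_power_linear_dvd:
  fixes V :: "complex poly"
  assumes "finite Z" "\<And>z. z \<in> Z \<Longrightarrow> [:-z, 1:] ^ m z dvd V"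
  shows "(\<Prod>z\<in>Z. [:-z, 1:] ^ m z) dvd V"
proof (cases "V = 0")
  case False
  show ?thesis
    using assms
  proof (induction Z)
    case (insert z Z)
    let ?P = "\<Prod>w\<in>Z. [:-w, 1:] ^ m w"
    from insert obtain Q where Q: "V = ?P * Q" by (auto elim: dvdE)
    have "poly ?P z \<noteq> 0" using insert.hyps by (auto simp: poly_prod)
    then have "order z ?P = 0" by (simp add: order_root)
    moreover have "?P * Q \<noteq> 0" using False Q by simp
    then have "order z V = order z ?P + order z Q" unfolding Q by (rule order_mult)
    moreover have "m z \<le> order z V"
      using insert.prems[of z] False by (simp add: order_divides)
    ultimately have "[:-z, 1:] ^ m z dvd Q" by (simp add: order_divides)
    then show ?case using insert.hyps by (simp add: Q mult.commute)
  qed simp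
qed simp

definition integral_poly :: "complex poly \<Rightarrow> bool" where
  "integral_poly P \<longleftrightarrow> (\<forall>n. coeff P n \<in> \<int>)"

lemma integral_poly_add: "integral_poly P \<Longrightarrow> integral_poly Q \<Longrightarrow> integral_poly (P + Q)"
  and integral_poly_diff: "integral_poly P \<Longrightarrow> integral_poly Q \<Longrightarrow> integral_poly (P - Q)"
  and integral_poly_mult: "integral_poly P \<Longrightarrow> integral_poly Q \<Longrightarrow> integral_poly (P * Q)"
  and integral_poly_const: "r \<in> \<int> \<Longrightarrow> integral_poly [:r:]"
  and integral_poly_1 [simp]: "integral_poly 1"
  and integral_poly_X [simp]: "integral_poly [:0, 1:]"
  and integral_poly_monom [simp]: "integral_poly (monom 1 n)"
  and integral_poly_0 [simp]: "integral_poly 0"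
  by (auto simp: integral_poly_def coeff_mult coeff_pCons intro!: Ints_sum split: nat.split)

lemma integral_poly_prod: "(\<And>i. i \<in> A \<Longrightarrow> integral_poly (f i)) \<Longrightarrow> integral_poly (\<Prod>i\<in>A. f i)"
  by (induction A rule: infinite_finite_induct) (auto intro: integral_poly_mult)

lemma integral_poly_sum: "(\<And>i. i \<in> A \<Longrightarrow> integral_poly (f i)) \<Longrightarrow> integral_poly (\<Sum>i\<in>A. f i)"
  by (induction A rule: infinite_finite_induct) (auto intro: integral_poly_add)

lemma integral_poly_power: "integral_poly P \<Longrightarrow> integral_poly (P ^ n)"
  by (induction n) (auto intro: integral_poly_mult)

text \<open>Comparing coefficients from the top, the coefficients of R are obtained without division because M is
  monic.\<close>

lemma integral_poly_factor:
  assumes "integral_poly (M * R)" "integral_poly M" "lead_coeff M = 1"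
  shows "integral_poly R"
proof -
  have "coeff R n \<in> \<int>" if "n + k = degree R" for n k
    using that
  proof (induction k arbitrary: n rule: less_induct)
    case (less k)
    let ?d = "degree M"
    have "coeff (M * R) (?d + n) = (\<Sum>i\<le>?d + n. coeff M i * coeff R (?d + n - i))"
      by (rule coeff_mult)
    also have "\<dots> = coeff M ?d * coeff R n + (\<Sum>i\<in>{..?d + n} - {?d}. coeff M i * coeff R (?d + n - i))"
      by (subst sum.remove[of _ ?d]) auto
    finally have "coeff R n = coeff (M * R) (?d + n) - (\<Sum>i\<in>{..?d + n} - {?d}. coeff M i * coeff R (?d + n - i))"
      using assms(3) by simp
    also have "\<dots> \<in> \<int>"
    proof (intro Ints_diff Ints_sum)
      show "coeff (M * R) (?d + n) \<in> \<int>" using assms(1) by (simp add: integral_poly_def)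
      fix i assume i: "i \<in> {..?d + n} - {?d}"
      show "coeff M i * coeff R (?d + n - i) \<in> \<int>"
      proof (cases "i > ?d")
        case True
        then show ?thesis by (simp add: coeff_eq_0)
      next
        case False
        with i have id: "i < ?d" by auto
        have "coeff R (?d + n - i) \<in> \<int>"
        proof (cases "?d + n - i \<le> degree R")
          case True
          show ?thesis
            by (rule less.IH[of "degree R - (?d + n - i)"]) (use True id less.prems in auto)
        qed (simp add: coeff_eq_0)
        then show ?thesis using assms(2) by (auto simp: integral_poly_def intro: Ints_mult)
      qed
    qed
    finally show ?case .
  qed
  then show ?thesis
    unfolding integral_poly_def by (metis Ints_0 coeff_eq_0 le_Suc_ex not_le)
qed

lemma integral_poly_eval_rational:
  assumes "integral_poly P" "degree P \<le> N" "\<sigma> \<noteq> (0::int)"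
  shows "of_int \<sigma> ^ N * poly P (of_int \<rho> / of_int \<sigma>) \<in> \<int>"
proof -
  have "of_int \<sigma> ^ N * poly P (of_int \<rho> / of_int \<sigma>) =
      (\<Sum>i\<le>degree P. of_int \<sigma> ^ N * (coeff P i * (of_int \<rho> / of_int \<sigma>) ^ i))"
    by (simp add: poly_altdef sum_distrib_left)
  also have "\<dots> = (\<Sum>i\<le>degree P. coeff P i * (of_int \<rho> ^ i * of_int \<sigma> ^ (N - i)))"
  proof (rule sum.cong)
    fix i assume "i \<in> {..degree P}"
    then have "(of_int \<sigma> :: complex) ^ N = of_int \<sigma> ^ i * of_int \<sigma> ^ (N - i)"
      using assms(2) by (simp flip: power_add)
    then show "of_int \<sigma> ^ N * (coeff P i * (of_int \<rho> / of_int \<sigma>) ^ i) =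
        coeff P i * (of_int \<rho> ^ i * of_int \<sigma> ^ (N - i))"
      using assms(3) by (simp add: power_divide)
  qed simp
  also have "\<dots> \<in> \<int>"
    using assms(1) by (auto simp: integral_poly_def intro!: Ints_sum Ints_mult Ints_power)
  finally show ?thesis .
qed

definition cyclotomic :: "nat \<Rightarrow> complex poly" where
  "cyclotomic d = (\<Prod>z | primitive_root d z. [:-z, 1:])"

lemma finite_primitive_roots: "finite {z. primitive_root d z}"
proof (cases "d = 0")
  case False
  then show ?thesis
    using finite_subset[of "{z. primitive_root d z}" "{z. z ^ d = 1}"] finite_roots_unity[of d]
    by (auto simp: primitive_root_def)
qed (simp add: primitive_root_def)

lemma primitive_root_unique:
  assumes "primitive_root d z" "primitive_root d' z"
  shows "d = d'"
proof -
  have "\<not> d < d'" "\<not> d' < d" using assms unfolding primitive_root_def by blast+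
  then show ?thesis by simp
qed

text \<open>The exact order of a root of unity divides every exponent that annihilates it.\<close>

lemma roots_of_unity_partition:
  assumes "m > 0"
  shows "{z::complex. z ^ m = 1} = (\<Union>d\<in>{d. d dvd m}. {z. primitive_root d z})"
proof (intro equalityI subsetI)
  fix z :: complex assume "z \<in> {z. z ^ m = 1}"
  then have z: "z ^ m = 1" by simp
  define d where "d = (LEAST k. 0 < k \<and> z ^ k = 1)"
  have d: "0 < d" "z ^ d = 1"
    using LeastI[of "\<lambda>k. 0 < k \<and> z ^ k = 1" m] assms z unfolding d_def by auto
  have min: "z ^ k \<noteq> 1" if "0 < k" "k < d" for k
    using not_less_Least[of k "\<lambda>k. 0 < k \<and> z ^ k = 1"] that unfolding d_def by auto
  have "z ^ m = z ^ (d * (m div d)) * z ^ (m mod d)" by (simp flip: power_add)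
  then have "z ^ (m mod d) = 1" using z d by (simp add: power_mult)
  then have "m mod d = 0" using min[of "m mod d"] d by (metis mod_less_divisor gr_zeroI)
  then show "z \<in> (\<Union>d\<in>{d. d dvd m}. {z. primitive_root d z})"
    using d min by (auto simp: primitive_root_def mod_eq_0_iff_dvd)
next
  fix z :: complex assume "z \<in> (\<Union>d\<in>{d. d dvd m}. {z. primitive_root d z})"
  then show "z \<in> {z. z ^ m = 1}"
    by (auto simp: primitive_root_def power_mult elim!: dvdE)
qed

lemma prod_cyclotomic:
  assumes "m > 0"
  shows "(\<Prod>d | d dvd m. cyclotomic d) = monom 1 m - 1"
proof -
  have "monom 1 m - 1 = (\<Prod>z\<in>(\<Union>d\<in>{d. d dvd m}. {z. primitive_root d z}). [:-z, 1:])"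
    by (simp only: prod_roots_of_unity[OF assms, symmetric] roots_of_unity_partition[OF assms])
  also have "\<dots> = (\<Prod>d | d dvd m. cyclotomic d)"
    unfolding cyclotomic_def
    by (rule prod.UNION_disjoint)
      (use assms in \<open>auto simp: finite_primitive_roots dest: primitive_root_unique\<close>)
  finally show ?thesis by simp
qed

lemma lead_coeff_cyclotomic [simp]: "lead_coeff (cyclotomic d) = 1"
  by (simp add: cyclotomic_def lead_coeff_prod)

text \<open>By induction, as the cofactor in \<open>x ^ d - 1\<close> is a product of cyclotomic polynomials of smaller index and monic.\<close>

lemma integral_poly_cyclotomic:
  assumes "d > 0"
  shows "integral_poly (cyclotomic d)"
  using assms
proof (induction d rule: less_induct)
  case (less d)
  let ?M = "\<Prod>e\<in>{e. e dvd d} - {d}. cyclotomic e"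
  have "?M * cyclotomic d = monom 1 d - 1"
    using prod_cyclotomic[OF less.prems] less.prems
    by (subst (asm) prod.remove[of _ d]) (auto simp: mult.commute)
  then have "integral_poly (?M * cyclotomic d)"
    by (simp add: integral_poly_diff)
  moreover have "integral_poly ?M"
  proof (rule integral_poly_prod)
    fix e assume "e \<in> {e. e dvd d} - {d}"
    then have "e \<le> d" "e \<noteq> d" "e > 0" using less.prems by (auto dest: dvd_imp_le dvd_pos_nat)
    then show "integral_poly (cyclotomic e)" using less.IH[of e] by simp
  qed
  moreover have "lead_coeff ?M = 1" by (simp add: lead_coeff_prod)
  ultimately show ?case by (rule integral_poly_factor)
qed

locale rational_base =
  fixes \<rho> \<sigma> :: int and q :: complex
  assumes \<rho>_nonzero: "\<rho> \<noteq> 0" and \<sigma>_nonzero: "\<sigma> \<noteq> 0" and q_eq: "q = of_int \<rho> / of_int \<sigma>"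
    and q_gt_1: "norm q > 1"
begin

text \<open>The value at \<open>(\<rho>, \<sigma>)\<close> of the homogenised polynomial. It is multiplicative, and an integer for integral
  P.\<close>

definition hom_value :: "complex poly \<Rightarrow> complex" where
  "hom_value P = of_int \<sigma> ^ degree P * poly P q"

lemma hom_value_mult: "hom_value (P * Q) = hom_value P * hom_value Q"
  by (cases "P = 0 \<or> Q = 0") (auto simp: hom_value_def degree_mult_eq power_add)

lemma hom_value_1 [simp]: "hom_value 1 = 1"
  by (simp add: hom_value_def)

lemma hom_value_prod: "hom_value (\<Prod>i\<in>A. f i) = (\<Prod>i\<in>A. hom_value (f i))"
  by (induction A rule: infinite_finite_induct) (auto simp: hom_value_mult)

lemma hom_value_power: "hom_value (P ^ n) = hom_value P ^ n"
  by (induction n) (auto simp: hom_value_mult)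

lemma hom_value_integral: "integral_poly P \<Longrightarrow> hom_value P \<in> \<int>"
  using integral_poly_eval_rational[of P "degree P" \<sigma> \<rho>] \<sigma>_nonzero
  unfolding hom_value_def by (simp add: q_eq)

lemma hom_value_X_power: "hom_value (monom 1 n) = of_int \<rho> ^ n"
  using \<sigma>_nonzero unfolding hom_value_def by (simp add: degree_monom_eq poly_monom q_eq power_divide)

lemma norm_Ints_ge_1: "z \<in> \<int> \<Longrightarrow> z \<noteq> 0 \<Longrightarrow> norm (z :: complex) \<ge> 1"
  by (auto elim!: Ints_cases simp: norm_of_int)

text \<open>The value at 0 is arbitrary. It is chosen such that all values are non-negative.\<close>

definition log_cyclotomic :: "nat \<Rightarrow> real" where
  "log_cyclotomic d = (if d = 0 then 0 else ln (norm (hom_value (cyclotomic d))))"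

lemma hom_value_cyclotomic_nonzero: "hom_value (cyclotomic d) \<noteq> 0"
proof -
  have "\<not> primitive_root d q"
  proof
    assume "primitive_root d q"
    then have "norm q ^ d = 1" "d > 0" by (auto simp: primitive_root_def simp flip: norm_power)
    then show False using q_gt_1 one_less_power[of "norm q" d] by simp
  qed
  then show ?thesis
    using \<sigma>_nonzero finite_primitive_roots
    by (auto simp: hom_value_def cyclotomic_def poly_prod)
qed

lemma log_cyclotomic_nonneg: "log_cyclotomic d \<ge> 0"
  using norm_Ints_ge_1[OF hom_value_integral[OF integral_poly_cyclotomic[of d]] hom_value_cyclotomic_nonzero]
  by (auto simp: log_cyclotomic_def)

lemma sum_log_cyclotomic:
  assumes "m > 0"
  shows "(\<Sum>d | d dvd m. log_cyclotomic d) = ln (norm (q ^ m - 1)) + m * ln \<bar>real_of_int \<sigma>\<bar>"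
proof -
  have deg: "degree (monom 1 m - 1 :: complex poly) = m"
    using degree_add_eq_left[of "- 1" "monom (1::complex) m"] assms by (simp add: degree_monom_eq)
  have "norm (q ^ m) > 1" using q_gt_1 assms by (simp add: norm_power one_less_power)
  then have nz: "q ^ m - 1 \<noteq> 0" by auto
  have "(\<Sum>d | d dvd m. log_cyclotomic d) = (\<Sum>d | d dvd m. ln (norm (hom_value (cyclotomic d))))"
    by (rule sum.cong) (use assms in \<open>auto simp: log_cyclotomic_def\<close>)
  also have "\<dots> = ln (\<Prod>d | d dvd m. norm (hom_value (cyclotomic d)))"
    by (rule ln_prod[symmetric]) (use assms hom_value_cyclotomic_nonzero in auto)
  also have "(\<Prod>d | d dvd m. norm (hom_value (cyclotomic d))) = norm (hom_value (monom 1 m - 1))"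
    by (simp add: prod_norm hom_value_prod[symmetric] prod_cyclotomic[OF assms])
  also have "\<dots> = \<bar>real_of_int \<sigma>\<bar> ^ m * norm (q ^ m - 1)"
    by (simp add: hom_value_def deg poly_monom norm_mult norm_power)
  also have "ln \<dots> = ln (norm (q ^ m - 1)) + m * ln \<bar>real_of_int \<sigma>\<bar>"
    using nz \<sigma>_nonzero by (simp add: ln_mult ln_realpow)
  finally show ?thesis .
qed

text \<open>The cofactor of M in V is integral, so its suitably homogenised value is a non-zero integer and has
  absolute value at least one.\<close>

lemma integral_poly_lower_bound:
  assumes "integral_poly V" "degree V \<le> N" "poly V q \<noteq> 0"
    and "integral_poly M" "lead_coeff M = 1" "M dvd V"
  shows "norm (hom_value M) \<le> \<bar>real_of_int \<sigma>\<bar> ^ N * norm (poly V q)"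
proof -
  obtain R where R: "V = M * R" using assms(6) by (auto elim: dvdE)
  have "V \<noteq> 0" using assms(3) by auto
  then have deg: "degree V = degree M + degree R" unfolding R by (intro degree_mult_eq) auto
  have "integral_poly R" using integral_poly_factor assms(1,4,5) R by blast
  then have "of_int \<sigma> ^ (N - degree M) * poly R q \<in> \<int>"
    unfolding q_eq by (rule integral_poly_eval_rational) (use deg assms(2) \<sigma>_nonzero in auto)
  moreover have "of_int \<sigma> ^ (N - degree M) * poly R q \<noteq> 0"
    using assms(3) \<sigma>_nonzero by (auto simp: R)
  ultimately have "norm (of_int \<sigma> ^ (N - degree M) * poly R q) \<ge> 1"
    by (rule norm_Ints_ge_1)
  then have "norm (hom_value M) * 1 \<le> norm (hom_value M) * norm (of_int \<sigma> ^ (N - degree M) * poly R q)"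
    by (intro mult_left_mono) auto
  also have "\<dots> = norm (of_int \<sigma> ^ (degree M + (N - degree M)) * poly V q)"
    by (simp add: hom_value_def R norm_mult power_add)
  also have "degree M + (N - degree M) = N" using deg assms(2) by simp
  finally show ?thesis by (simp add: norm_mult norm_power)
qed

end

lemma smult_sum_right: "smult r (\<Sum>i\<in>A. f i) = (\<Sum>i\<in>A. smult r (f i))"
  by (induction A rule: infinite_finite_induct) (simp_all add: smult_add_right)

lemma double_sum_permutes:
  assumes "\<pi> permutes {0..<n::nat}"
  shows "(\<Sum>i<n. f i + f (\<pi> i)) = 2 * (\<Sum>i<n. f i :: nat)"
  using sum_permutes_lessThan[OF assms, of f] by (simp add: sum.distrib)

context poly_q_sequence
begin

text \<open>By the recurrence \<open>D ^ (k + 1) * v k\<close> is integral. In each term of the Leibniz formula the indices \<open>i + \<pi> i\<close> sum up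
  to \<open>n * (n - 1)\<close>, so that the exponents of D add up to \<open>n * n\<close>.\<close>

lemma det_hankel_integral:
  assumes D: "D \<in> \<int>" "D * a \<in> \<int>" "D * c \<in> \<int>" and v0: "v 0 = [:b:]" "D * b \<in> \<int>"
  shows "integral_poly (smult (D ^ (n * n)) (det (hankel v n)))"
proof -
  have v: "integral_poly (smult (D ^ Suc k) (v k))" for k
  proof (induction k)
    case 0
    show ?case using v0 integral_poly_const[OF v0(2)] by simp
  next
    case (Suc k)
    have eq: "smult (D ^ Suc (Suc k)) (v (Suc k)) =
        ([:D:] * [:0, 1:] ^ Suc k - [:D * c:]) * smult (D ^ Suc k) (v k) - [:D:] * [:D * a:] ^ Suc k"
    proof -
      have 1: "smult (D ^ j) P = [:D:] ^ j * P" for j P by (simp add: poly_const_pow)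
      have 2: "[:D * y:] = [:D:] * [:y:]" for y by simp
      show ?thesis unfolding step[of k] 1 2 power_mult_distrib by (simp only: power_Suc algebra_simps)
    qed
    show ?case unfolding eq
      by (intro integral_poly_diff integral_poly_mult integral_poly_power integral_poly_const Suc.IH D) simp
  qed
  have "det (hankel v n) = (\<Sum>\<pi> | \<pi> permutes {0..<n}. signof \<pi> * (\<Prod>i<n. v (i + \<pi> i)))"
    unfolding det_def'[OF hankel_carrier]
    by (intro sum.cong refl arg_cong2[where f = "(*)"] prod.cong)
      (auto simp: hankel_def lessThan_atLeast0 dest: permutes_in_image)
  then have "smult (D ^ (n * n)) (det (hankel v n)) =
      (\<Sum>\<pi> | \<pi> permutes {0..<n}. signof \<pi> * smult (D ^ (n * n)) (\<Prod>i<n. v (i + \<pi> i)))"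
    by (simp only: smult_sum_right mult_smult_right)
  also have "integral_poly \<dots>"
  proof (intro integral_poly_sum integral_poly_mult)
    fix \<pi> assume "\<pi> \<in> {\<pi>. \<pi> permutes {0..<n}}"
    then have \<pi>: "\<pi> permutes {0..<n}" by simp
    show "integral_poly (signof \<pi>)" by (cases "evenperm \<pi>") (auto simp: sign_def integral_poly_def)
    have "(\<Sum>i<n. Suc (i + \<pi> i)) = (\<Sum>i<n. i + \<pi> i) + n"
      by (simp only: Suc_eq_plus1 sum.distrib[of "\<lambda>i. i + \<pi> i" "\<lambda>_. 1"]) simp
    also have "\<dots> = n * n"
      unfolding double_sum_permutes[OF \<pi>, of "\<lambda>i. i"]
      using Sum_Ico_nat[of 0 n] by (cases n) (auto simp: lessThan_atLeast0 algebra_simps)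
    finally have "D ^ (n * n) = (\<Prod>i<n. D ^ Suc (i + \<pi> i))" by (metis power_sum)
    then have "smult (D ^ (n * n)) (\<Prod>i<n. v (i + \<pi> i)) = (\<Prod>i<n. smult (D ^ Suc (i + \<pi> i)) (v (i + \<pi> i)))"
      unfolding prod_smult by simp
    then show "integral_poly (smult (D ^ (n * n)) (\<Prod>i<n. v (i + \<pi> i)))"
      using v by (auto intro: integral_poly_prod)
  qed
  finally show ?thesis .
qed

text \<open>The degree of \<open>v k\<close> is at most \<open>k (k + 1) / 2\<close>, and \<open>2 i j \<le> i\<^sup>2 + j\<^sup>2\<close> separates the indices.\<close>

lemma degree_det_hankel:
  assumes v0: "v 0 = [:b:]"
  shows "degree (det (hankel v n)) \<le> (\<Sum>i<n. 2 * (i * i + i))"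
proof -
  have v: "2 * degree (v k) \<le> k * (k + 1)" for k
  proof (induction k)
    case (Suc k)
    have "degree (v (Suc k)) \<le> max (degree (([:0, 1:] ^ Suc k - [:c:]) * v k)) (degree ([:a:] ^ Suc k))"
      unfolding step[of k] by (rule degree_diff_le_max)
    also have "degree ([:a:] ^ Suc k) = 0" by (simp add: poly_const_pow)
    also have "degree (([:0, 1:] ^ Suc k - [:c:]) * v k) \<le> Suc k + degree (v k)"
    proof -
      have "degree ([:0, 1:] ^ Suc k - [:c:]) \<le> max (degree ([:0, 1 :: complex:] ^ Suc k)) (degree [:c:])"
        by (rule degree_diff_le_max)
      also have "\<dots> \<le> Suc k" using degree_power_le[of "[:0, 1::complex:]" "Suc k"] by simp
      finally show ?thesis
        using degree_mult_le[of "[:0, 1:] ^ Suc k - [:c:]" "v k"] by linarith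
    qed
    finally have "degree (v (Suc k)) \<le> Suc k + degree (v k)" by simp
    then show ?case using Suc by (simp add: algebra_simps)
  qed (simp add: v0)
  show ?thesis
    unfolding det_def'[OF hankel_carrier]
  proof (rule degree_sum_le)
    show "finite {p. p permutes {0..<n}}" by (simp add: finite_permutations)
    fix \<pi> assume "\<pi> \<in> {p. p permutes {0..<n}}"
    then have \<pi>: "\<pi> permutes {0..<n}" by simp
    have "degree (signof \<pi> * (\<Prod>i = 0..<n. hankel v n $$ (i, \<pi> i))) \<le>
        degree (signof \<pi> :: complex poly) + degree (\<Prod>i = 0..<n. hankel v n $$ (i, \<pi> i))"
      by (rule degree_mult_le)
    also have "degree (signof \<pi> :: complex poly) = 0" by (simp add: sign_def)
    also have "degree (\<Prod>i = 0..<n. hankel v n $$ (i, \<pi> i)) \<le> (\<Sum>i = 0..<n. degree (hankel v n $$ (i, \<pi> i)))"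
      using degree_prod_sum_le[of "{0..<n}" "\<lambda>i. hankel v n $$ (i, \<pi> i)"] by (simp add: comp_def)
    also have "\<dots> \<le> (\<Sum>i = 0..<n. (i * i + i) + (\<pi> i * \<pi> i + \<pi> i))"
    proof (rule sum_mono)
      fix i assume "i \<in> {0..<n}"
      then have "hankel v n $$ (i, \<pi> i) = v (i + \<pi> i)"
        using permutes_in_image[OF \<pi>, of i] by (simp add: hankel_def)
      moreover have "(i + \<pi> i) * (i + \<pi> i + 1) \<le> 2 * ((i * i + i) + (\<pi> i * \<pi> i + \<pi> i))"
      proof -
        have "2 * (i * \<pi> i) \<le> i * i + \<pi> i * \<pi> i"
        proof -
          have "real (2 * (i * \<pi> i)) \<le> real (i * i + \<pi> i * \<pi> i)"
            using sum_squares_bound[of "real i" "real (\<pi> i)"] by (simp add: power2_eq_square)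
          then show ?thesis by (simp only: of_nat_le_iff)
        qed
        then show ?thesis by (simp add: algebra_simps)
      qed
      ultimately show "degree (hankel v n $$ (i, \<pi> i)) \<le> (i * i + i) + (\<pi> i * \<pi> i + \<pi> i)"
        using v[of "i + \<pi> i"] by simp
    qed
    also have "\<dots> = (\<Sum>i<n. 2 * (i * i + i))"
      using double_sum_permutes[OF \<pi>, of "\<lambda>i. i * i + i"]
      by (simp only: lessThan_atLeast0 sum_distrib_left)
    finally show "degree (signof \<pi> * (\<Prod>i = 0..<n. hankel v n $$ (i, \<pi> i))) \<le> (\<Sum>i<n. 2 * (i * i + i))"
      by simp
  qed
qed

definition known_factor :: "nat \<Rightarrow> nat \<Rightarrow> complex poly" where
  "known_factor W n = monom 1 W * (\<Prod>d=1..n. cyclotomic d ^ (\<Sum>i<n. gain (i div d)))"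

text \<open>The roots of the factor are the origin and the roots of unity of order at most n, with multiplicities given by the two
  preceding sections.\<close>

lemma known_factor_dvd:
  assumes "[:0, 1:] ^ W dvd det (hankel v n)"
  shows "known_factor W n dvd det (hankel v n)"
proof -
  define e where "e = (\<lambda>d. \<Sum>i<n. gain (i div d))"
  define U where "U = (\<Union>d\<in>{1..n}. {z. primitive_root d z})"
  define ex where "ex = (\<lambda>z. if z = 0 then W else e (THE d. primitive_root d z))"
  have the: "(THE d. primitive_root d z) = d" if "primitive_root d z" for d z
    using that primitive_root_unique by blast
  have nz: "z \<noteq> 0" if "primitive_root d z" for d z
    using that by (auto simp: primitive_root_def zero_power)
  have fin: "finite U" by (auto simp: U_def finite_primitive_roots)
  have "(\<Prod>z\<in>insert 0 U. [:-z, 1:] ^ ex z) dvd det (hankel v n)"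
  proof (rule prod_power_linear_dvd)
    show "finite (insert 0 U)" using fin by simp
    fix z assume "z \<in> insert 0 U"
    then show "[:-z, 1:] ^ ex z dvd det (hankel v n)"
    proof
      assume "z \<in> U"
      then obtain d where d: "primitive_root d z" by (auto simp: U_def)
      then show ?thesis
        using power_dvd_det_hankel_at_root_of_unity[OF d, of n] nz[OF d] by (simp add: ex_def the[OF d] e_def)
    qed (use assms in \<open>simp add: ex_def\<close>)
  qed
  also have "(\<Prod>z\<in>insert 0 U. [:-z, 1:] ^ ex z) = [:0, 1:] ^ W * (\<Prod>z\<in>U. [:-z, 1:] ^ ex z)"
    using fin nz by (subst prod.insert) (auto simp: U_def ex_def)
  also have "(\<Prod>z\<in>U. [:-z, 1:] ^ ex z) = (\<Prod>d=1..n. \<Prod>z | primitive_root d z. [:-z, 1:] ^ ex z)"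
    unfolding U_def by (rule prod.UNION_disjoint) (auto simp: finite_primitive_roots dest: primitive_root_unique)
  also have "\<dots> = (\<Prod>d=1..n. cyclotomic d ^ e d)"
  proof (rule prod.cong)
    fix d assume "d \<in> {1..n}"
    have "(\<Prod>z | primitive_root d z. [:-z, 1:] ^ ex z) = (\<Prod>z | primitive_root d z. [:-z, 1:] ^ e d)"
      by (rule prod.cong) (auto simp: ex_def the nz)
    then show "(\<Prod>z | primitive_root d z. [:-z, 1:] ^ ex z) = cyclotomic d ^ e d"
      by (simp add: cyclotomic_def prod_power_distrib)
  qed simp
  also have "[:0, 1::complex:] ^ W = monom 1 W" by (simp add: monom_altdef)
  finally show ?thesis by (simp add: known_factor_def e_def)
qed

lemma known_factor_monic: "lead_coeff (known_factor W n) = 1"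
  by (simp add: known_factor_def lead_coeff_mult lead_coeff_prod lead_coeff_power degree_monom_eq)

lemma known_factor_integral: "integral_poly (known_factor W n)"
  unfolding known_factor_def
  by (intro integral_poly_mult integral_poly_prod integral_poly_power integral_poly_cyclotomic) auto

end

section \<open>Asymptotic weight of the cyclotomic factor\<close>

lemma inverse_square_le_telescope:
  assumes "M > 0"
  shows "1 / (real (Suc M))\<^sup>2 \<le> 1 / real M - 1 / real (Suc M)"
proof -
  have "1 / (real (Suc M))\<^sup>2 \<le> 1 / (real M * real (Suc M))"
    using assms unfolding power2_eq_square by (intro divide_left_mono mult_right_mono) auto
  also have "\<dots> = 1 / real M - 1 / real (Suc M)"
    using assms by (simp add: field_simps)
  finally show ?thesis .
qed

lemma nat_floor_bounds:
  assumes "y \<ge> (0::real)"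
  shows "real (nat \<lfloor>y\<rfloor>) \<le> y" "y < real (nat \<lfloor>y\<rfloor>) + 1"
proof -
  have "real (nat \<lfloor>y\<rfloor>) = of_int \<lfloor>y\<rfloor>" using assms by simp
  then show "real (nat \<lfloor>y\<rfloor>) \<le> y" "y < real (nat \<lfloor>y\<rfloor>) + 1"
    using floor_correct[of y] by simp_all
qed

lemma sum_inverse_squares_tail_le:
  assumes "0 < N" "N \<le> M"
  shows "(\<Sum>k=1..M. 1 / (real k)\<^sup>2) \<le> (\<Sum>k=1..N. 1 / (real k)\<^sup>2) + 1 / N - 1 / M"
  using assms(2)
proof (induction M rule: dec_induct)
  case (step M)
  with assms(1) have "M > 0" by simp
  from inverse_square_le_telescope[OF this] show ?case using step by simp
qed simp

lemma inverse_squares_LIMSEQ: "(\<lambda>N. \<Sum>k=1..N. 1 / (real k)\<^sup>2) \<longlonglongrightarrow> pi\<^sup>2 / 6"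
proof -
  have "(\<lambda>N. \<Sum>n<N. 1 / (real n + 1)\<^sup>2) \<longlonglongrightarrow> pi\<^sup>2 / 6"
    using inverse_squares_sums by (simp add: sums_def add.commute)
  also have "(\<lambda>N. \<Sum>n<N. 1 / (real n + 1)\<^sup>2) = (\<lambda>N. \<Sum>k=1..N. 1 / (real k)\<^sup>2)"
    by (simp add: sum.atLeast1_atMost_eq add.commute)
  finally show ?thesis .
qed

lemma inverse_squares_tail:
  assumes "N > 0"
  shows "(\<Sum>k=1..N. 1 / (real k)\<^sup>2) \<le> pi\<^sup>2 / 6" and "pi\<^sup>2 / 6 \<le> (\<Sum>k=1..N. 1 / (real k)\<^sup>2) + 1 / N"
proof -
  show "(\<Sum>k=1..N. 1 / (real k)\<^sup>2) \<le> pi\<^sup>2 / 6"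
    by (rule LIMSEQ_le_const[OF inverse_squares_LIMSEQ], rule exI[of _ N], intro allI impI sum_mono2)
      auto
  show "pi\<^sup>2 / 6 \<le> (\<Sum>k=1..N. 1 / (real k)\<^sup>2) + 1 / N"
  proof (rule LIMSEQ_le_const2[OF inverse_squares_LIMSEQ], intro exI[of _ N] allI impI)
    fix M assume "N \<le> M"
    have "0 \<le> 1 / real M" by simp
    with sum_inverse_squares_tail_le[OF assms \<open>N \<le> M\<close>]
    show "(\<Sum>k=1..M. 1 / (real k)\<^sup>2) \<le> (\<Sum>k=1..N. 1 / (real k)\<^sup>2) + 1 / N"
      by linarith
  qed
qed

lemma sum_inverse_squares_from_2: "(\<Sum>k=2..N. 1 / (real k)\<^sup>2) \<le> 3 / 4"
proof (cases "N \<ge> 2")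
  case True
  then have "(\<Sum>k=2..N. 1 / (real k)\<^sup>2) \<le> 3 / 4 - 1 / N"
  proof (induction N rule: dec_induct)
    case (step M)
    then have "M > 0" by simp
    from inverse_square_le_telescope[OF this] show ?case using step by simp
  qed simp
  moreover have "0 \<le> 1 / real N" by simp
  ultimately show ?thesis by linarith
qed simp

text \<open>A non-negative function whose divisor sums are nearly linear behaves on average like a multiple of
  Euler's totient.\<close>

locale divisor_weights =
  fixes h :: "nat \<Rightarrow> real" and K C :: real
  assumes h_nonneg: "h d \<ge> 0" and K_pos: "K > 0"
    and divisor_sum: "m > 0 \<Longrightarrow> \<bar>(\<Sum>d | d dvd m. h d) - real m * K\<bar> \<le> C"
begin

text \<open>The second iterated summatory function of h, extended to real arguments. The multiplicity of a cyclotomic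
  factor is a sum of terms \<open>n - \<theta> l = \<theta> (n / \<theta> - l)\<close>, so \<open>ramp (n / \<theta>)\<close> is what has to be
  estimated.\<close>

definition ramp :: "real \<Rightarrow> real" where
  "ramp y = (\<Sum>l=1..nat \<lfloor>y\<rfloor>. h l * (y - l))"

lemma ramp_eq:
  assumes "y \<ge> 0" "y < real N + 1"
  shows "ramp y = (\<Sum>l=1..N. h l * max 0 (y - l))"
proof -
  note y = nat_floor_bounds[OF assms(1)]
  have N: "nat \<lfloor>y\<rfloor> \<le> N" using assms by linarith
  have "(\<Sum>l=1..N. h l * max 0 (y - l)) = (\<Sum>l=1..nat \<lfloor>y\<rfloor>. h l * max 0 (y - l))"
  proof (rule sum.mono_neutral_right)
    show "\<forall>l\<in>{1..N} - {1..nat \<lfloor>y\<rfloor>}. h l * max 0 (y - l) = 0"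
    proof
      fix l assume "l \<in> {1..N} - {1..nat \<lfloor>y\<rfloor>}"
      then have "real (nat \<lfloor>y\<rfloor>) + 1 \<le> real l" by auto
      then have "y \<le> real l" using y by linarith
      then show "h l * max 0 (y - l) = 0" by (simp add: max_def)
    qed
  qed (use N in auto)
  also have "\<dots> = ramp y"
    unfolding ramp_def
  proof (rule sum.cong)
    fix l assume "l \<in> {1..nat \<lfloor>y\<rfloor>}"
    then have "real l \<le> real (nat \<lfloor>y\<rfloor>)" by auto
    then have "real l \<le> y" using y by linarith
    then show "h l * max 0 (y - l) = h l * (y - l)" by (simp add: max_def)
  qed simp
  finally show ?thesis by simp
qed

lemma ramp_nonneg: "ramp y \<ge> 0"
  unfolding ramp_def by (intro sum_nonneg mult_nonneg_nonneg h_nonneg) (auto; linarith)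

lemma C_nonneg: "C \<ge> 0"
  using order_trans[OF abs_ge_zero divisor_sum[of 1]] by simp

text \<open>Both sides sum \<open>h l * (y - k l)\<close> over the pairs with \<open>k l \<le> y\<close>, on the right sorted by
  \<open>m = k l\<close>.\<close>

lemma sum_ramp_eq:
  assumes "y \<ge> 1"
  defines "N \<equiv> nat \<lfloor>y\<rfloor>"
  shows "(\<Sum>k=1..N. real k * ramp (y / real k)) = (\<Sum>m=1..N. (\<Sum>d | d dvd m. h d) * (y - real m))"
proof -
  have N: "real N \<le> y" "y < real N + 1"
    using nat_floor_bounds[of y] assms(1) by (auto simp: N_def)
  have "real k * ramp (y / real k) = (\<Sum>l=1..N. h l * max 0 (y - k * l))" if "k \<in> {1..N}" for k
  proof -
    have k: "k \<ge> 1" using that by simp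
    have "y / k \<le> y / 1" by (rule divide_left_mono) (use k assms in auto)
    then have "y / k < real N + 1" using N(2) by simp
    with assms(1) have "ramp (y / k) = (\<Sum>l=1..N. h l * max 0 (y / k - l))"
      by (intro ramp_eq) auto
    moreover have "real k * (h l * max 0 (y / k - l)) = h l * max 0 (y - k * l)" for l
      using k by (auto simp: max_def field_simps)
    ultimately show ?thesis by (simp only: sum_distrib_left)
  qed
  then have "(\<Sum>k=1..N. real k * ramp (y / real k)) = (\<Sum>k=1..N. \<Sum>l=1..N. h l * max 0 (y - k * l))"
    by simp
  also have "\<dots> = (\<Sum>(k, l)\<in>{1..N} \<times> {1..N}. h l * max 0 (y - k * l))"
    by (simp add: sum.cartesian_product)
  also have "\<dots> = (\<Sum>(k, l)\<in>{(k, l). k \<in> {1..N} \<and> l \<in> {1..N} \<and> k * l \<le> N}. h l * max 0 (y - k * l))"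
  proof (rule sum.mono_neutral_right, goal_cases)
    case 3
    show ?case
    proof
      fix p assume p: "p \<in> {1..N} \<times> {1..N} - {(k, l). k \<in> {1..N} \<and> l \<in> {1..N} \<and> k * l \<le> N}"
      obtain k l where kl: "p = (k, l)" by (cases p)
      with p have "N + 1 \<le> k * l" by auto
      then have "real (N + 1) \<le> real (k * l)" by (simp only: of_nat_le_iff)
      then have "y - k * l \<le> 0" using N by simp
      then show "(case p of (k, l) \<Rightarrow> h l * max 0 (y - k * l)) = 0" by (simp add: kl max_def)
    qed
  qed auto
  also have "\<dots> = (\<Sum>(m, d)\<in>(SIGMA m:{1..N}. {d. d dvd m}). h d * (y - real m))"
  proof (rule sum.reindex_bij_witness[of _ "\<lambda>(m, d). (m div d, d)" "\<lambda>(k, l). (k * l, l)"], goal_cases)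
    case (2 a)
    then show ?case by auto
  next
    case (4 b)
    then obtain m d where b: "b = (m, d)" "1 \<le> m" "m \<le> N" "d dvd m" by auto
    then obtain k where m: "m = d * k" by auto
    with b have "0 < d" "0 < k" by (auto intro: gr0I)
    then have "d \<le> d * k" "k \<le> d * k" by simp_all
    then have "d \<le> N" "k \<le> N" using b(3) m by linarith+
    with b m \<open>0 < d\<close> \<open>0 < k\<close> show ?case by (auto simp: mult.commute)
  next
    case (5 a)
    then obtain k l where a: "a = (k, l)" "k * l \<le> N" by auto
    then have "real (k * l) \<le> y" using N(1) of_nat_mono[OF a(2), where ?'a = real] by linarith
    then show ?case using a by (simp add: max_def)
  qed auto
  also have "\<dots> = (\<Sum>m=1..N. \<Sum>d | d dvd m. h d * (y - real m))"
    by (rule sum.Sigma[symmetric]) (auto)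
  finally show ?thesis by (simp add: sum_distrib_right)
qed

lemma sum_linear_weights:
  assumes "y \<ge> 1"
  defines "N \<equiv> nat \<lfloor>y\<rfloor>"
  shows "\<bar>(\<Sum>m=1..N. real m * (y - real m)) - y ^ 3 / 6\<bar> \<le> y\<^sup>2"
proof -
  define t where "t = y - N"
  have t: "0 \<le> t" "t < 1"
    using nat_floor_bounds[of y] assms(1) unfolding N_def t_def by linarith+
  have N: "real N = y - t" by (simp add: t_def)
  have sums: "(\<Sum>m=1..M. real m * (y - real m)) =
      y * real M * (real M + 1) / 2 - real M * (real M + 1) * (2 * real M + 1) / 6" for M :: nat
    by (induction M) (auto simp: field_simps)
  have "(\<Sum>m=1..N. real m * (y - real m)) - y ^ 3 / 6 = 
      (3 * t - 3 * t\<^sup>2 - 1) * y / 6 - t * (1 - t) * (2 * t - 1) / 6"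
    unfolding sums N by (simp add: field_simps power2_eq_square power3_eq_cube)
  moreover have "\<bar>3 * t - 3 * t\<^sup>2 - 1\<bar> \<le> 1"
  proof -
    have "0 \<le> t * (1 - t)" using t by simp
    moreover have "t * (1 - t) \<le> 1 / 4"
      using zero_le_power2[of "t - 1 / 2"] by (simp add: power2_eq_square field_simps)
    moreover have "3 * t - 3 * t\<^sup>2 - 1 = 3 * (t * (1 - t)) - 1"
      by (simp add: power2_eq_square algebra_simps)
    ultimately show ?thesis by linarith
  qed
  then have "\<bar>(3 * t - 3 * t\<^sup>2 - 1) * y\<bar> \<le> 1 * y"
    unfolding abs_mult using assms by (intro mult_mono) auto
  moreover have "\<bar>t * (1 - t) * (2 * t - 1)\<bar> \<le> 1 * 1 * 1"
    unfolding abs_mult using t by (intro mult_mono) auto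
  moreover have "1 \<le> y\<^sup>2" "y \<le> y\<^sup>2" using power_increasing[of 0 2 y] power_increasing[of 1 2 y] assms(1) by auto
  ultimately show ?thesis by linarith
qed

text \<open>With \<open>(\<Sum>d | d dvd m. h d)\<close> replaced by \<open>m K\<close>, the right-hand side of \<^emph>\<open>sum_ramp_eq\<close> is explicit.\<close>

lemma sum_ramp_bound:
  assumes "y \<ge> 1"
  defines "N \<equiv> nat \<lfloor>y\<rfloor>"
  shows "\<bar>(\<Sum>k=1..N. real k * ramp (y / real k)) - K * y ^ 3 / 6\<bar> \<le> (K + C) * y\<^sup>2"
proof -
  have N: "real N \<le> y" using nat_floor_bounds[of y] assms(1) by (simp add: N_def)
  have "(\<Sum>k=1..N. real k * ramp (y / real k)) - K * (\<Sum>m=1..N. real m * (y - real m)) =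
      (\<Sum>m=1..N. ((\<Sum>d | d dvd m. h d) - real m * K) * (y - real m))"
    unfolding N_def sum_ramp_eq[OF assms(1)] sum_distrib_left sum_subtractf[symmetric]
    by (rule sum.cong) (simp_all add: algebra_simps)
  also have "\<bar>\<dots>\<bar> \<le> (\<Sum>m=1..N. C * y)"
  proof (rule order_trans[OF sum_abs], rule sum_mono)
    fix m assume "m \<in> {1..N}"
    then have "0 < m" "real m \<le> real N" by auto
    with divisor_sum[of m] N have "\<bar>(\<Sum>d | d dvd m. h d) - real m * K\<bar> \<le> C" "\<bar>y - real m\<bar> \<le> y"
      by auto
    then show "\<bar>((\<Sum>d | d dvd m. h d) - real m * K) * (y - real m)\<bar> \<le> C * y"
      unfolding abs_mult using C_nonneg by (intro mult_mono) auto
  qed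
  also have "(\<Sum>m=1..N. C * y) = real N * (C * y)" by simp
  also have "\<dots> \<le> C * y\<^sup>2"
    using mult_right_mono[OF N, of "C * y"] C_nonneg assms(1) by (simp add: power2_eq_square mult_ac)
  finally have "\<bar>(\<Sum>k=1..N. real k * ramp (y / real k)) - K * (\<Sum>m=1..N. real m * (y - real m))\<bar> \<le> C * y\<^sup>2" .
  moreover have "\<bar>K * (\<Sum>m=1..N. real m * (y - real m)) - K * (y ^ 3 / 6)\<bar> \<le> K * y\<^sup>2"
    unfolding right_diff_distrib[symmetric] abs_mult
    using sum_linear_weights[OF assms(1)] K_pos by (intro mult_mono) (auto simp: N_def)
  ultimately show ?thesis unfolding distrib_right by linarith
qed

text \<open>The constant is forced: \<open>ramp y = \<kappa> y\<^sup>3\<close> in the relation \<^emph>\<open>sum_ramp_bound\<close> requires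
  \<open>\<kappa> * \<zeta>(2) = K / 6\<close>, where \<open>\<zeta>(2) = \<pi>\<^sup>2 / 6\<close>.\<close>

definition ramp_error :: "real \<Rightarrow> real" where
  "ramp_error y = ramp y - K / pi\<^sup>2 * y ^ 3"

text \<open>Subtracting the relation for the main term from \<^emph>\<open>sum_ramp_bound\<close> leaves
  \<open>(\<Sum>k. k * ramp_error (y / k)) = O(y\<^sup>2)\<close>, which is solved for the summand with \<open>k = 1\<close>. The crude bound of order
  \<open>y\<^sup>3\<close> uses that \<open>ramp\<close> is non-negative.\<close>

lemma ramp_error_bounds:
  "\<exists>C2 M0. C2 \<ge> 0 \<and> M0 > 0 \<and> (\<forall>y\<ge>1.
    \<bar>ramp_error y\<bar> \<le> C2 * y\<^sup>2 + (\<Sum>k=2..nat \<lfloor>y\<rfloor>. real k * \<bar>ramp_error (y / real k)\<bar>) \<and>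
    \<bar>ramp_error y\<bar> \<le> M0 * y ^ 3)"
proof -
  define \<kappa> where "\<kappa> = K / pi\<^sup>2"
  have \<kappa>: "\<kappa> > 0" using K_pos by (simp add: \<kappa>_def)
  have split: "(\<Sum>k=1..nat \<lfloor>y\<rfloor>. f k) = f 1 + (\<Sum>k=2..nat \<lfloor>y\<rfloor>. f k)" if "y \<ge> 1" for y :: real and f :: "nat \<Rightarrow> real"
  proof -
    have "1 \<le> nat \<lfloor>y\<rfloor>" using le_nat_floor[of 1 y] that by simp
    then show ?thesis by (subst sum.atLeast_Suc_atMost) (auto simp: numeral_2_eq_2)
  qed
  have main: "\<bar>\<Sum>k=1..nat \<lfloor>y\<rfloor>. real k * ramp_error (y / real k)\<bar> \<le> (K + C + 2 * \<kappa>) * y\<^sup>2" if y: "y \<ge> 1" for y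
  proof -
    define N where "N = nat \<lfloor>y\<rfloor>"
    have "1 \<le> N" using le_nat_floor[of 1 y] y by (simp add: N_def)
    then have N: "N > 0" "y / 2 \<le> real N"
      using nat_floor_bounds[of y] y unfolding N_def[symmetric] by auto
    have "(\<Sum>k=1..N. real k * ramp_error (y / real k)) = (\<Sum>k=1..N. real k * ramp (y / real k)) - (\<Sum>k=1..N. \<kappa> * y ^ 3 * (1 / (real k)\<^sup>2))"
      unfolding sum_subtractf[symmetric] ramp_error_def \<kappa>_def[symmetric]
      by (rule sum.cong) (auto simp: field_simps power2_eq_square power3_eq_cube)
    also have "(\<Sum>k=1..N. \<kappa> * y ^ 3 * (1 / (real k)\<^sup>2)) = \<kappa> * y ^ 3 * (\<Sum>k=1..N. 1 / (real k)\<^sup>2)"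
      by (simp only: sum_distrib_left)
    finally have 1: "(\<Sum>k=1..N. real k * ramp_error (y / real k)) =
        (\<Sum>k=1..N. real k * ramp (y / real k)) - \<kappa> * y ^ 3 * (\<Sum>k=1..N. 1 / (real k)\<^sup>2)" .
    have 2: "\<kappa> * y ^ 3 * (pi\<^sup>2 / 6) = K * y ^ 3 / 6" by (simp add: \<kappa>_def)
    have eq: "(\<Sum>k=1..N. real k * ramp_error (y / real k)) =
        ((\<Sum>k=1..N. real k * ramp (y / real k)) - K * y ^ 3 / 6) + \<kappa> * y ^ 3 * (pi\<^sup>2 / 6 - (\<Sum>k=1..N. 1 / (real k)\<^sup>2))"
      using 1 2 unfolding right_diff_distrib by linarith
    have "1 / real N \<le> 2 / y" using N y by (simp add: field_simps)
    then have "0 \<le> pi\<^sup>2 / 6 - (\<Sum>k=1..N. 1 / (real k)\<^sup>2)" "pi\<^sup>2 / 6 - (\<Sum>k=1..N. 1 / (real k)\<^sup>2) \<le> 2 / y"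
      using inverse_squares_tail[OF N(1)] by linarith+
    then have "\<bar>\<kappa> * y ^ 3 * (pi\<^sup>2 / 6 - (\<Sum>k=1..N. 1 / (real k)\<^sup>2))\<bar> \<le> \<kappa> * y ^ 3 * (2 / y)"
      unfolding abs_mult using \<kappa> y by (intro mult_mono) auto
    also have "\<dots> = 2 * \<kappa> * y\<^sup>2" using y by (simp add: power2_eq_square power3_eq_cube)
    finally show ?thesis
      using sum_ramp_bound[OF y] unfolding N_def[symmetric] eq distrib_right by linarith
  qed
  show ?thesis
  proof (rule exI[of _ "K + C + 2 * \<kappa>"], rule exI[of _ "K + C + K + \<kappa>"], intro conjI allI impI)
    show "K + C + 2 * \<kappa> \<ge> 0" "K + C + K + \<kappa> > 0" using K_pos C_nonneg \<kappa> by auto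
    fix y :: real assume y: "y \<ge> 1"
    have "\<bar>ramp_error y\<bar> \<le> \<bar>\<Sum>k=1..nat \<lfloor>y\<rfloor>. real k * ramp_error (y / real k)\<bar> + \<bar>\<Sum>k=2..nat \<lfloor>y\<rfloor>. real k * ramp_error (y / real k)\<bar>"
      unfolding split[OF y] by simp
    also have "\<bar>\<Sum>k=2..nat \<lfloor>y\<rfloor>. real k * ramp_error (y / real k)\<bar> \<le> (\<Sum>k=2..nat \<lfloor>y\<rfloor>. real k * \<bar>ramp_error (y / real k)\<bar>)"
      by (rule order_trans[OF sum_abs]) (simp add: abs_mult)
    finally show "\<bar>ramp_error y\<bar> \<le> (K + C + 2 * \<kappa>) * y\<^sup>2 + (\<Sum>k=2..nat \<lfloor>y\<rfloor>. real k * \<bar>ramp_error (y / real k)\<bar>)"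
      using main[OF y] by linarith
    have "ramp y \<le> (\<Sum>k=1..nat \<lfloor>y\<rfloor>. real k * ramp (y / real k))"
      unfolding split[OF y] by (simp add: sum_nonneg ramp_nonneg)
    also have "\<dots> \<le> K * y ^ 3 / 6 + (K + C) * y\<^sup>2" using sum_ramp_bound[OF y] by linarith
    also have "(K + C) * y\<^sup>2 \<le> (K + C) * y ^ 3"
      using y K_pos C_nonneg by (intro mult_left_mono power_increasing) auto
    finally have "ramp y \<le> K * y ^ 3 / 6 + (K + C) * y ^ 3" by simp
    moreover have "0 \<le> K * y ^ 3" using K_pos y by simp
    ultimately have "ramp y \<le> (K + C + K) * y ^ 3" unfolding distrib_right by linarith
    moreover have "0 \<le> \<kappa> * y ^ 3" "0 \<le> (K + C + K) * y ^ 3" using \<kappa> y K_pos C_nonneg by simp_all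
    ultimately show "\<bar>ramp_error y\<bar> \<le> (K + C + K + \<kappa>) * y ^ 3"
      using ramp_nonneg[of y] unfolding ramp_error_def \<kappa>_def[symmetric] distrib_right[of _ \<kappa>]
      by (simp add: abs_le_iff)
  qed
qed

text \<open>If \<open>|ramp_error y| \<le> M y\<^sup>3\<close> for all large y, then the recursive bound improves
  M by the factor \<open>(\<Sum>k\<ge>2. 1 / k\<^sup>2) \<le> 3/4\<close>, up to lower order terms. Iterating this contraction shows
  \<open>ramp_error y = o(y\<^sup>3)\<close>.\<close>

lemma ramp_asymptotics: "((\<lambda>y. ramp y / y ^ 3) \<longlongrightarrow> K / pi\<^sup>2) at_top"
proof -
  obtain C2 M0 where C2: "C2 \<ge> 0" and M0: "M0 > 0"
    and rec: "\<And>y. y \<ge> 1 \<Longrightarrow> \<bar>ramp_error y\<bar> \<le> C2 * y\<^sup>2 + (\<Sum>k=2..nat \<lfloor>y\<rfloor>. real k * \<bar>ramp_error (y / real k)\<bar>)"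
    and bound: "\<And>y. y \<ge> 1 \<Longrightarrow> \<bar>ramp_error y\<bar> \<le> M0 * y ^ 3"
    using ramp_error_bounds by blast
  have contract: "\<exists>Y\<ge>1. \<forall>y\<ge>Y. \<bar>ramp_error y\<bar> \<le> (7 / 8 * M) * y ^ 3"
    if M: "M > 0" and Y: "Y \<ge> 1" and hyp: "\<forall>y\<ge>Y. \<bar>ramp_error y\<bar> \<le> M * y ^ 3" for M Y
  proof (intro exI[of _ "max 1 (8 * (C2 + M0 * Y\<^sup>2) / M)"] conjI allI impI)
    fix y assume "max 1 (8 * (C2 + M0 * Y\<^sup>2) / M) \<le> y"
    then have y: "y \<ge> 1" "8 * (C2 + M0 * Y\<^sup>2) \<le> M * y" using M by (auto simp: field_simps)
    \<comment> \<open>The arguments below Y, where only the crude bound is available, contribute \<open>O(y\<^sup>2)\<close> in total.\<close>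
    have summand: "real k * \<bar>ramp_error (y / real k)\<bar> \<le> M * y ^ 3 * (1 / (real k)\<^sup>2) + M0 * Y\<^sup>2 * y"
      if "k \<in> {2..nat \<lfloor>y\<rfloor>}" for k
    proof (cases "y / k \<ge> Y")
      case True
      then have "real k * \<bar>ramp_error (y / real k)\<bar> \<le> k * (M * (y / k) ^ 3)"
        using hyp by (intro mult_left_mono) auto
      also have "\<dots> = M * y ^ 3 * (1 / (real k)\<^sup>2)"
        using that by (simp add: field_simps power2_eq_square power3_eq_cube)
      finally show ?thesis using M0 y by (simp add: add_increasing2)
    next
      case False
      have "real k \<le> real (nat \<lfloor>y\<rfloor>)" "k > 0" using that by auto
      moreover have "real (nat \<lfloor>y\<rfloor>) \<le> y" by (rule nat_floor_bounds) (use y in simp)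
      ultimately have k: "real k \<le> y" "k > 0" by linarith+
      then have yk: "1 \<le> y / k" by simp
      have "real k * \<bar>ramp_error (y / real k)\<bar> \<le> k * (M0 * (y / k) ^ 3)"
        using bound[OF yk] by (intro mult_left_mono) auto
      also have "\<dots> = M0 * (y / k)\<^sup>2 * y"
        using k by (simp add: field_simps power2_eq_square power3_eq_cube)
      also have "\<dots> \<le> M0 * Y\<^sup>2 * y"
        using False yk M0 y by (intro mult_right_mono mult_left_mono power_mono) auto
      finally show ?thesis using M y by (simp add: add_increasing)
    qed
    have "\<bar>ramp_error y\<bar> \<le> C2 * y\<^sup>2 + (\<Sum>k=2..nat \<lfloor>y\<rfloor>. M * y ^ 3 * (1 / (real k)\<^sup>2) + M0 * Y\<^sup>2 * y)"
      using rec[OF y(1)] sum_mono[OF summand, of "{2..nat \<lfloor>y\<rfloor>}" "\<lambda>k. k"] by linarith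
    also have "\<dots> = C2 * y\<^sup>2 + (M * y ^ 3 * (\<Sum>k=2..nat \<lfloor>y\<rfloor>. 1 / (real k)\<^sup>2) + real (nat \<lfloor>y\<rfloor> - 1) * (M0 * Y\<^sup>2 * y))"
      by (simp add: sum.distrib sum_distrib_left)
    also have "\<dots> \<le> C2 * y\<^sup>2 + (M * y ^ 3 * (3 / 4) + y * (M0 * Y\<^sup>2 * y))"
    proof (intro add_mono mult_left_mono mult_right_mono)
      show "real (nat \<lfloor>y\<rfloor> - 1) \<le> y" using y by linarith
    qed (use sum_inverse_squares_from_2 M M0 y C2 in auto)
    also have "\<dots> = 3 / 4 * M * y ^ 3 + (C2 + M0 * Y\<^sup>2) * y\<^sup>2"
      by (simp add: algebra_simps power2_eq_square)
    also have "(C2 + M0 * Y\<^sup>2) * y\<^sup>2 \<le> (M * y / 8) * y\<^sup>2"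
      using y by (intro mult_right_mono) auto
    finally show "\<bar>ramp_error y\<bar> \<le> (7 / 8 * M) * y ^ 3"
      by (simp add: power2_eq_square power3_eq_cube algebra_simps)
  qed simp
  have iterate: "\<exists>Y\<ge>1. \<forall>y\<ge>Y. \<bar>ramp_error y\<bar> \<le> ((7 / 8) ^ j * M0) * y ^ 3" for j
  proof (induction j)
    case 0
    show ?case using bound by (intro exI[of _ 1]) auto
  next
    case (Suc j)
    then obtain Y where "Y \<ge> 1" "\<forall>y\<ge>Y. \<bar>ramp_error y\<bar> \<le> ((7 / 8) ^ j * M0) * y ^ 3" by blast
    from contract[OF _ this] M0 show ?case by (simp add: mult.assoc)
  qed
  have "((\<lambda>y. ramp y / y ^ 3 - K / pi\<^sup>2) \<longlongrightarrow> 0) at_top"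
  proof (rule tendstoI)
    fix e :: real assume e: "e > 0"
    obtain j where j: "(7 / 8 :: real) ^ j < e / M0"
      using real_arch_pow_inv[of "e / M0" "7 / 8"] e M0 by auto
    obtain Y where Y: "Y \<ge> 1" "\<forall>y\<ge>Y. \<bar>ramp_error y\<bar> \<le> ((7 / 8) ^ j * M0) * y ^ 3"
      using iterate by blast
    show "\<forall>\<^sub>F y in at_top. dist (ramp y / y ^ 3 - K / pi\<^sup>2) 0 < e"
      using eventually_ge_at_top[of Y]
    proof eventually_elim
      case (elim y)
      then have y: "y > 0" using Y by linarith
      have "ramp y / y ^ 3 - K / pi\<^sup>2 = ramp_error y / y ^ 3"
        using y by (simp add: ramp_error_def diff_divide_distrib)
      then have "dist (ramp y / y ^ 3 - K / pi\<^sup>2) 0 = \<bar>ramp_error y\<bar> / y ^ 3"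
        using y by (simp add: dist_real_def)
      also have "\<dots> \<le> (7 / 8) ^ j * M0" using Y elim y by (simp add: divide_le_eq)
      also have "\<dots> < e" using j M0 by (simp add: field_simps)
      finally show ?case .
    qed
  qed
  then show ?thesis by (simp add: LIM_zero_iff)
qed

lemma gain_eq_sum: "gain u = (\<Sum>\<theta>=1..u. if \<theta> mod 3 = 1 then 0 else 1)"
proof (induction u)
  case (Suc u)
  have "gain (Suc u) = gain u + (if Suc u mod 3 = 1 then 0 else 1)"
  proof -
    have u: "u = 3 * (u div 3) + u mod 3" by simp
    have "u mod 3 < 3" by simp
    with u have "u = 3 * (u div 3) \<or> u = 3 * (u div 3) + 1 \<or> u = 3 * (u div 3) + 2" by linarith
    then obtain w where "u = 3 * w \<or> u = 3 * w + 1 \<or> u = 3 * w + 2" by blast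
    then show ?thesis by (elim disjE) (simp add: gain_def, presburger?)+
  qed
  then show ?case using Suc by simp
qed (simp add: gain_def)

text \<open>Both sides count pairs \<open>(i, \<theta>)\<close> with \<open>\<theta> l \<le> i < n\<close>, the left-hand side without the
  restriction \<open>\<theta> \<le> M\<close>.\<close>

lemma sum_gain_ge:
  assumes "l > 0"
  shows "(\<Sum>i<n. gain (i div l)) \<ge> (\<Sum>\<theta>\<in>{\<theta>\<in>{1..M}. \<theta> mod 3 \<noteq> 1}. n - \<theta> * l)"
proof -
  let ?T = "{\<theta>\<in>{1..M}. \<theta> mod 3 \<noteq> 1}"
  have "(\<Sum>\<theta>\<in>?T. n - \<theta> * l) = (\<Sum>\<theta>\<in>?T. \<Sum>i<n. if \<theta> * l \<le> i then 1 else 0)"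
  proof (rule sum.cong)
    fix \<theta> assume "\<theta> \<in> ?T"
    have "(\<Sum>i<n. if \<theta> * l \<le> i then 1 else 0) = card ({..<n} \<inter> {i. \<theta> * l \<le> i})"
      by (simp add: sum.If_cases)
    also have "{..<n} \<inter> {i. \<theta> * l \<le> i} = {\<theta> * l..<n}" by auto
    finally show "n - \<theta> * l = (\<Sum>i<n. if \<theta> * l \<le> i then 1 else 0)" by simp
  qed simp
  also have "\<dots> = (\<Sum>i<n. \<Sum>\<theta>\<in>?T. if \<theta> * l \<le> i then 1 else 0)"
    by (rule sum.swap)
  also have "\<dots> \<le> (\<Sum>i<n. gain (i div l))"
  proof (rule sum_mono)
    fix i
    have "(\<Sum>\<theta>\<in>?T. if \<theta> * l \<le> i then 1 else (0::nat)) = card (?T \<inter> {\<theta>. \<theta> * l \<le> i})"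
      by (simp add: sum.If_cases)
    also have "\<dots> \<le> card {\<theta>\<in>{1..i div l}. \<theta> mod 3 \<noteq> 1}"
    proof (rule card_mono)
      show "finite {\<theta>\<in>{1..i div l}. \<theta> mod 3 \<noteq> 1}" by (rule finite_subset[of _ "{1..i div l}"]) auto
    qed (use assms in \<open>auto simp: less_eq_div_iff_mult_less_eq\<close>)
    also have "\<dots> = gain (i div l)"
    proof -
      have "gain (i div l) = (\<Sum>\<theta>\<in>{1..i div l}. if \<theta> mod 3 \<noteq> 1 then 1 else 0)"
        unfolding gain_eq_sum by (rule sum.cong) auto
      also have "\<dots> = card ({1..i div l} \<inter> {\<theta>. \<theta> mod 3 \<noteq> 1})"
        by (simp add: sum.If_cases)
      finally show ?thesis by (simp add: Int_def conj_commute)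
    qed
    finally show "(\<Sum>\<theta>\<in>?T. if \<theta> * l \<le> i then 1 else 0) \<le> gain (i div l)" .
  qed
  finally show ?thesis .
qed

lemma gain_weighted_sum_lower_bound:
  assumes "e > 0"
  shows "\<forall>\<^sub>F n in sequentially. (\<Sum>l=1..n. real (\<Sum>i<n. gain (i div l)) * h l) \<ge>
    (K / pi\<^sup>2 * (\<Sum>\<theta>\<in>{\<theta>\<in>{1..M}. \<theta> mod 3 \<noteq> 1}. 1 / (real \<theta>)\<^sup>2) - e) * real n ^ 3"
proof -
  let ?T = "{\<theta>\<in>{1..M}. \<theta> mod 3 \<noteq> 1}"
  have ge: "(\<Sum>l=1..n. real (\<Sum>i<n. gain (i div l)) * h l) \<ge> (\<Sum>\<theta>\<in>?T. \<theta> * ramp (n / \<theta>))" for n :: nat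
  proof -
    have ramp: "\<theta> * ramp (n / \<theta>) = (\<Sum>l=1..n. real (n - \<theta> * l) * h l)" if "\<theta> \<in> ?T" for \<theta>
    proof -
      have \<theta>: "\<theta> > 0" using that by auto
      have "real n / \<theta> \<le> real n / 1" using \<theta> by (intro divide_left_mono) auto
      then have "ramp (n / \<theta>) = (\<Sum>l=1..n. h l * max 0 (n / \<theta> - l))"
        by (intro ramp_eq) auto
      moreover have "real \<theta> * (h l * max 0 (n / \<theta> - l)) = real (n - \<theta> * l) * h l" for l
      proof (cases "\<theta> * l \<le> n")
        case True
        then have "real \<theta> * real l \<le> real n" by (simp only: of_nat_le_iff flip: of_nat_mult)
        then show ?thesis using \<theta> True by (simp add: max_def field_simps of_nat_diff)
      next
        case False
        then have "real n < real \<theta> * real l" by (simp only: of_nat_less_iff not_le flip: of_nat_mult)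
        then show ?thesis using \<theta> False by (simp add: max_def field_simps)
      qed
      ultimately show ?thesis by (simp only: sum_distrib_left)
    qed
    have "(\<Sum>\<theta>\<in>?T. \<theta> * ramp (n / \<theta>)) = (\<Sum>l=1..n. \<Sum>\<theta>\<in>?T. real (n - \<theta> * l) * h l)"
      by (subst sum.swap) (simp add: ramp)
    also have "\<dots> = (\<Sum>l=1..n. real (\<Sum>\<theta>\<in>?T. n - \<theta> * l) * h l)"
      by (simp add: sum_distrib_right)
    also have "\<dots> \<le> (\<Sum>l=1..n. real (\<Sum>i<n. gain (i div l)) * h l)"
      by (intro sum_mono mult_right_mono h_nonneg of_nat_mono sum_gain_ge) auto
    finally show ?thesis .
  qed
  have "(\<lambda>n. (\<Sum>\<theta>\<in>?T. \<theta> * ramp (n / \<theta>)) / real n ^ 3) \<longlonglongrightarrow> (\<Sum>\<theta>\<in>?T. K / pi\<^sup>2 * (1 / (real \<theta>)\<^sup>2))"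
    unfolding sum_divide_distrib
  proof (rule tendsto_sum)
    fix \<theta> assume "\<theta> \<in> ?T"
    then have \<theta>: "\<theta> > 0" by auto
    have "filterlim (\<lambda>n. real n / real \<theta>) at_top sequentially"
      using \<theta> by (intro filterlim_at_top_mult_tendsto_pos[of "\<lambda>_. 1 / real \<theta>" "1 / real \<theta>", simplified] filterlim_real_sequentially) auto
    from tendsto_mult_right[OF filterlim_compose[OF ramp_asymptotics this], of "1 / (real \<theta>)\<^sup>2"]
    have "(\<lambda>n. ramp (n / \<theta>) / (n / \<theta>) ^ 3 * (1 / (real \<theta>)\<^sup>2)) \<longlonglongrightarrow> K / pi\<^sup>2 * (1 / (real \<theta>)\<^sup>2)" .
    moreover have "ramp (n / \<theta>) / (n / \<theta>) ^ 3 * (1 / (real \<theta>)\<^sup>2) = \<theta> * ramp (n / \<theta>) / real n ^ 3" for n :: nat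
      using \<theta> by (cases "n = 0") (simp_all add: field_simps power2_eq_square power3_eq_cube)
    ultimately show "(\<lambda>n. \<theta> * ramp (n / \<theta>) / real n ^ 3) \<longlonglongrightarrow> K / pi\<^sup>2 * (1 / (real \<theta>)\<^sup>2)"
      by (simp only:)
  qed
  then have "(\<lambda>n. (\<Sum>\<theta>\<in>?T. \<theta> * ramp (n / \<theta>)) / real n ^ 3) \<longlonglongrightarrow> K / pi\<^sup>2 * (\<Sum>\<theta>\<in>?T. 1 / (real \<theta>)\<^sup>2)"
    by (simp only: sum_distrib_left)
  from order_tendstoD(1)[OF this, of "K / pi\<^sup>2 * (\<Sum>\<theta>\<in>?T. 1 / (real \<theta>)\<^sup>2) - e"] assms
  have "\<forall>\<^sub>F n in sequentially. K / pi\<^sup>2 * (\<Sum>\<theta>\<in>?T. 1 / (real \<theta>)\<^sup>2) - e < (\<Sum>\<theta>\<in>?T. \<theta> * ramp (n / \<theta>)) / real n ^ 3"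
    by simp
  then show ?thesis
    using eventually_gt_at_top[of 0]
  proof eventually_elim
    case (elim n)
    then have "(K / pi\<^sup>2 * (\<Sum>\<theta>\<in>?T. 1 / (real \<theta>)\<^sup>2) - e) * real n ^ 3 \<le> (\<Sum>\<theta>\<in>?T. \<theta> * ramp (n / \<theta>))"
      by (simp add: field_simps)
    then show ?case using ge[of n] by linarith
  qed
qed

end

section \<open>Non-vanishing of the Hankel determinants\<close>

lemma poly_dilate: "poly (dilate y P) z = poly P (y * z)"
  by (simp add: dilate_def poly_pcompose mult.commute)

lemma dilate_dilate_inverse: "y * z = 1 \<Longrightarrow> dilate y (dilate z P) = P"
  by (simp add: dilate_dilate) (simp add: dilate_def)

lemma moment_mult_eq_sum:
  "moment v (P * R) = (\<Sum>i\<le>degree P. coeff P i * moment v (monom 1 i * R))"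
proof -
  have "P * R = (\<Sum>i\<le>degree P. monom (coeff P i) i) * R"
    by (simp add: poly_as_sum_of_monoms)
  also have "\<dots> = (\<Sum>i\<le>degree P. smult (coeff P i) (monom 1 i * R))"
    by (simp add: sum_distrib_right smult_monom flip: mult_smult_left)
  finally show ?thesis by (simp add: moment_sum moment_smult)
qed

lemma det_hankel_eq_0_iff:
  fixes v :: "nat \<Rightarrow> 'a::idom"
  shows "det (hankel v n) = 0 \<longleftrightarrow>
    (\<exists>P. P \<noteq> 0 \<and> degree P < n \<and> (\<forall>i<n. moment v (monom 1 i * P) = 0))"
proof -
  have entry: "vec_index (hankel v n *\<^sub>v w) i = moment v (monom 1 i * P)"
    if "i < n" "w \<in> carrier_vec n" "degree P < n" "\<And>j. j < n \<Longrightarrow> vec_index w j = coeff P j" for w i P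
  proof -
    have "moment v (monom 1 i * P) = (\<Sum>j\<le>degree P. coeff P j * v (j + i))"
      unfolding moment_monom_mult by (simp add: moment_def)
    also have "\<dots> = (\<Sum>j = 0..<n. coeff P j * v (j + i))"
      by (rule sum.mono_neutral_left) (use that in \<open>auto simp: coeff_eq_0\<close>)
    finally show ?thesis
      using that by (simp add: hankel_def scalar_prod_def ac_simps)
  qed
  show ?thesis
  proof
    assume "det (hankel v n) = 0"
    then obtain w where w: "w \<in> carrier_vec n" "w \<noteq> 0\<^sub>v n" "hankel v n *\<^sub>v w = 0\<^sub>v n"
      using det_0_iff_vec_prod_zero[OF hankel_carrier] by blast
    define P where "P = (\<Sum>j<n. monom (vec_index w j) j)"
    have coeff: "coeff P j = (if j < n then vec_index w j else 0)" for j
      by (simp add: P_def coeff_sum)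
    obtain j where j: "j < n" "vec_index w j \<noteq> 0" 
    proof (rule ccontr)
      assume "\<not> thesis"
      with that have "w = 0\<^sub>v n" using w(1) by (intro eq_vecI) auto
      with w(2) show False by simp
    qed
    then have "P \<noteq> 0" using coeff[of j] by auto
    moreover have deg: "degree P < n"
      using j by (intro degree_lessI) (auto simp: coeff)
    moreover have "moment v (monom 1 i * P) = 0" if "i < n" for i
      using entry[OF that w(1) deg] coeff w(3) that by simp
    ultimately show "\<exists>P. P \<noteq> 0 \<and> degree P < n \<and> (\<forall>i<n. moment v (monom 1 i * P) = 0)"
      by blast
  next
    assume "\<exists>P. P \<noteq> 0 \<and> degree P < n \<and> (\<forall>i<n. moment v (monom 1 i * P) = 0)"
    then obtain P where P: "P \<noteq> 0" "degree P < n" "\<And>i. i < n \<Longrightarrow> moment v (monom 1 i * P) = 0"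
      by blast
    let ?w = "Matrix.vec n (coeff P)"
    have "vec_index ?w (degree P) \<noteq> vec_index (0\<^sub>v n) (degree P)" using P(1,2) by simp
    then have "?w \<noteq> 0\<^sub>v n" by auto
    moreover have "hankel v n *\<^sub>v ?w = 0\<^sub>v n"
    proof (rule eq_vecI)
      fix i assume "i < dim_vec (0\<^sub>v n :: 'a Matrix.vec)"
      then have i: "i < n" by simp
      have "vec_index (hankel v n *\<^sub>v ?w) i = moment v (monom 1 i * P)"
        by (rule entry) (use i P(2) in auto)
      then show "vec_index (hankel v n *\<^sub>v ?w) i = vec_index (0\<^sub>v n) i" using i P(3) by simp
    qed (simp add: hankel_def)
    moreover have "?w \<in> carrier_vec n" by simp
    ultimately show "det (hankel v n) = 0"
      using det_0_iff_vec_prod_zero[OF hankel_carrier, of v n] by blast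
  qed
qed

text \<open>Let n be the last index with a non-zero determinant. A kernel vector of the next Hankel matrix is a polynomial a
  that is orthogonal to \<open>1, t, \<dots>, t ^ n\<close>. If \<open>t ^ m\<close> were the first power that is not orthogonal to a, take
  a kernel polynomial b of the singular Hankel matrix of size \<open>m + 1\<close>. Then \<open>L(b * t ^ (m - degree b) * a)\<close> vanishes by
  orthogonality of b, but it equals the leading coefficient of b times \<open>L(t ^ m * a)\<close> by orthogonality of a.\<close>

lemma kronecker_hankel:
  fixes v :: "nat \<Rightarrow> 'a::idom"
  assumes "\<And>n. n \<ge> N \<Longrightarrow> det (hankel v n) = 0"
  shows "\<exists>a. a \<noteq> 0 \<and> (\<forall>P. moment v (a * P) = 0)"
proof -
  define n where "n = Max {n. n < N \<and> det (hankel v n) \<noteq> 0}"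
  have "det (hankel v 0) \<noteq> 0" by simp
  then have "0 \<in> {n. n < N \<and> det (hankel v n) \<noteq> 0}" using assms[of 0] by auto
  then have n: "n \<in> {n. n < N \<and> det (hankel v n) \<noteq> 0}"
    unfolding n_def by (intro Max_in) auto
  have max: "det (hankel v m) = 0" if "m > n" for m
  proof (rule ccontr)
    assume *: "det (hankel v m) \<noteq> 0"
    with assms have "m < N" by (meson not_le)
    with * have "m \<le> n" unfolding n_def by (intro Max_ge) auto
    with that show False by simp
  qed
  have regular: "P = 0" if "degree P < n" "\<And>i. i < n \<Longrightarrow> moment v (monom 1 i * P) = 0" for P
    using n that unfolding mem_Collect_eq det_hankel_eq_0_iff by blast
  obtain a where a: "a \<noteq> 0" "degree a \<le> n" "\<And>i. i \<le> n \<Longrightarrow> moment v (monom 1 i * a) = 0"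
    using max[of "Suc n"] unfolding det_hankel_eq_0_iff less_Suc_eq_le by blast
  have zero: "moment v (monom 1 m * a) = 0" for m
  proof (induction m rule: less_induct)
    case (less m)
    show ?case
    proof (cases "m \<le> n")
      case False
      then obtain b where b: "b \<noteq> 0" "degree b \<le> m" "\<And>i. i \<le> m \<Longrightarrow> moment v (monom 1 i * b) = 0"
        using max[of "Suc m"] unfolding det_hankel_eq_0_iff less_Suc_eq_le by auto
      have "\<not> degree b < n" using regular[of b] b False by auto
      let ?s = "m - degree b"
      have s: "degree b + ?s = m" using b(2) by simp
      have "moment v ((monom 1 ?s * a) * b) = 0"
      proof (subst moment_mult_eq_sum, rule sum.neutral, intro ballI)
        fix i assume "i \<in> {..degree (monom 1 ?s * a)}"
        moreover have "degree (monom 1 ?s * a) \<le> ?s + n"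
          using degree_mult_le[of "monom 1 ?s" a] degree_monom_le[of "1::'a" ?s] a(2) by linarith
        ultimately have "i \<le> m" using \<open>\<not> degree b < n\<close> s by simp
        then show "coeff (monom 1 ?s * a) i * moment v (monom 1 i * b) = 0" by (simp add: b(3))
      qed
      also have "(monom 1 ?s * a) * b = b * (monom 1 ?s * a)" by (rule mult.commute)
      also have "moment v \<dots> = (\<Sum>i\<le>degree b. coeff b i * moment v (monom 1 (i + ?s) * a))"
        by (subst moment_mult_eq_sum) (simp add: mult_monom flip: mult.assoc)
      also have "\<dots> = (\<Sum>i\<in>{degree b}. coeff b i * moment v (monom 1 (i + ?s) * a))"
      proof (rule sum.mono_neutral_right)
        show "\<forall>i\<in>{..degree b} - {degree b}. coeff b i * moment v (monom 1 (i + ?s) * a) = 0"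
          using less.IH s by auto
      qed auto
      finally show ?thesis using b(1) s by simp
    qed (rule a(3))
  qed
  have "moment v (a * P) = 0" for P
    using zero by (subst mult.commute, subst moment_mult_eq_sum) simp
  with a(1) show ?thesis by blast
qed

lemma powers_inj:
  fixes q :: complex
  assumes "norm q > 1" "z \<noteq> 0"
  shows "inj (\<lambda>k. q ^ k * z)" and "inj (\<lambda>k. z / q ^ k)"
proof -
  have *: "i = j" if "q ^ i = q ^ j" for i j
  proof -
    have "norm q ^ i = norm q ^ j" using that by (simp flip: norm_power)
    then show ?thesis using power_inject_exp[OF assms(1)] by blast
  qed
  have "q \<noteq> 0" using assms(1) by auto
  then show "inj (\<lambda>k. q ^ k * z)" "inj (\<lambda>k. z / q ^ k)"
    using assms(2) * by (auto intro!: injI simp: frac_eq_eq)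
qed

lemma poly_eq_0_of_infinite_roots:
  fixes a :: "complex poly"
  assumes "inj f" "\<And>k::nat. poly a (f k) = 0"
  shows "a = 0"
proof (rule ccontr)
  assume "a \<noteq> 0"
  then have "finite {z. poly a z = 0}" by (rule poly_roots_finite)
  moreover have "range f \<subseteq> {z. poly a z = 0}" using assms(2) by auto
  ultimately show False using assms(1) finite_subset range_inj_infinite by blast
qed

locale complex_q_sequence = q_sequence q \<alpha> l v for q \<alpha> l :: complex and v +
  assumes q_gt_1: "norm q > 1" and \<alpha>_nonzero: "\<alpha> \<noteq> 0"
begin

lemma q_nonzero: "q \<noteq> 0"
  using q_gt_1 by auto

text \<open>The polynomials that annihilate L form an ideal. By the dilation identity this ideal contains, with \<open>g(t)\<close>, also
  \<open>(q t - \<alpha>) g(q t)\<close> and \<open>(t - \<alpha>) (t + l) g(t / q)\<close>. Applied to a generator, this gives two closure properties of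
  its set of roots. A non-zero root z has \<open>q z = \<alpha>\<close> or \<open>q z\<close> is a root; as there are finitely many roots,
  \<open>q ^ r * z = \<alpha>\<close> for some \<open>r > 0\<close>. In the other direction \<open>z / q\<close> is a root, unless
  z is \<alpha> or \<open>- l\<close>; the latter must happen somewhere along the way and contradicts the hypothesis. So 0 is the
  only root, the sequence vanishes eventually, and this is impossible because of the term \<open>\<alpha> ^ (n+1)\<close> in the
  recurrence.\<close>

lemma no_annihilator:
  assumes \<alpha>: "\<And>k. k > 0 \<Longrightarrow> \<alpha> \<noteq> - l * q ^ k"
    and a: "a \<noteq> 0" "\<And>P. moment v (a * P) = 0"
  shows False
proof -
  define Ann where "Ann = {a. \<forall>P. moment v (a * P) = 0}"
  define d where "d = (LEAST d. \<exists>a\<in>Ann. a \<noteq> 0 \<and> degree a = d)"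
  have "\<exists>a\<in>Ann. a \<noteq> 0 \<and> degree a = d"
    unfolding d_def by (rule LeastI_ex) (use a in \<open>auto simp: Ann_def\<close>)
  then obtain g where g: "g \<in> Ann" "g \<noteq> 0" "degree g = d" by blast
  have dvd: "g dvd b" if "b \<in> Ann" for b
  proof -
    have "b mod g = b - g * (b div g)" by (simp add: minus_mult_div_eq_mod)
    moreover have "moment v ((b - g * (b div g)) * P) = 0" for P
      using that g(1) by (simp add: Ann_def left_diff_distrib moment_diff mult.assoc)
    ultimately have mem: "b mod g \<in> Ann" by (simp add: Ann_def)
    have "b mod g = 0"
    proof (rule ccontr)
      assume nz: "b mod g \<noteq> 0"
      then have "d \<le> degree (b mod g)" unfolding d_def using mem by (intro Least_le) blast
      with nz degree_mod_less'[of g b] g show False by auto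
    qed
    then show ?thesis by (simp add: mod_eq_0_iff_dvd)
  qed
  have up: "[:-\<alpha>, q:] * dilate q g \<in> Ann"
    unfolding Ann_def
  proof (intro CollectI allI)
    fix P
    have eq: "dilate q (g * dilate (1 / q) P) = dilate q g * P"
      using q_nonzero by (simp add: dilate_mult dilate_dilate_inverse)
    have "moment v (g * ([:-\<alpha>, 1:] * [:l, 1:] * dilate (1 / q) P)) = 0"
      using g(1) by (simp only: Ann_def mem_Collect_eq)
    also have "g * ([:-\<alpha>, 1:] * [:l, 1:] * dilate (1 / q) P) = [:-\<alpha>, 1:] * [:l, 1:] * (g * dilate (1 / q) P)"
      by (rule mult.left_commute)
    also have "moment v \<dots> = q * moment v ([:-\<alpha>, q:] * dilate q g * P)"
      unfolding moment_dilate eq by (simp only: mult.assoc)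
    finally show "moment v ([:-\<alpha>, q:] * dilate q g * P) = 0" using q_nonzero by simp
  qed
  have down: "[:-\<alpha>, 1:] * [:l, 1:] * dilate (1 / q) g \<in> Ann"
    unfolding Ann_def
  proof (intro CollectI allI)
    fix P
    have eq: "dilate q (dilate (1 / q) g * P) = g * dilate q P"
      using q_nonzero by (simp add: dilate_mult dilate_dilate_inverse)
    have "moment v ([:-\<alpha>, 1:] * [:l, 1:] * (dilate (1 / q) g * P)) = q * moment v ([:-\<alpha>, q:] * (g * dilate q P))"
      by (simp only: moment_dilate eq)
    also have "[:-\<alpha>, q:] * (g * dilate q P) = g * ([:-\<alpha>, q:] * dilate q P)"
      by (rule mult.left_commute)
    also have "moment v \<dots> = 0" using g(1) by (simp only: Ann_def mem_Collect_eq)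
    finally have "moment v ([:-\<alpha>, 1:] * [:l, 1:] * (dilate (1 / q) g * P)) = 0" by simp
    then show "moment v ([:-\<alpha>, 1:] * [:l, 1:] * dilate (1 / q) g * P) = 0"
      by (simp only: mult.assoc)
  qed
  have root_up: "q * z = \<alpha> \<or> poly g (q * z) = 0" if "poly g z = 0" for z
  proof -
    have "poly ([:-\<alpha>, q:] * dilate q g) z = 0"
      using dvd_trans[OF _ dvd[OF up]] that unfolding poly_eq_0_iff_dvd by blast
    then show ?thesis unfolding poly_mult mult_eq_0_iff by (auto simp: poly_dilate mult.commute)
  qed
  have root_down: "z = \<alpha> \<or> z = - l \<or> poly g (z / q) = 0" if "poly g z = 0" for z
  proof -
    have "poly ([:-\<alpha>, 1:] * [:l, 1:] * dilate (1 / q) g) z = 0"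
      using dvd_trans[OF _ dvd[OF down]] that unfolding poly_eq_0_iff_dvd by blast
    then show ?thesis unfolding poly_mult mult_eq_0_iff by (auto simp: poly_dilate add_eq_0_iff)
  qed
  have only_zero: "z = 0" if z: "poly g z = 0" for z
  proof (rule ccontr)
    assume nz: "z \<noteq> 0"
    have "\<exists>r>0. q ^ r * z = \<alpha>"
    proof (rule ccontr)
      assume none: "\<not> (\<exists>r>0. q ^ r * z = \<alpha>)"
      have "poly g (q ^ k * z) = 0" for k
      proof (induction k)
        case (Suc k)
        then show ?case using root_up[of "q ^ k * z"] none by (auto simp: mult.assoc)
      qed (simp add: z)
      then have "g = 0" by (rule poly_eq_0_of_infinite_roots[OF powers_inj(1)[OF q_gt_1 nz]])
      with g(2) show False by simp
    qed
    then obtain r where r: "r > 0" "q ^ r * z = \<alpha>" by blast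
    have "poly g (z / q ^ k) = 0" for k
    proof (induction k)
      case (Suc k)
      have "z / q ^ k \<noteq> \<alpha>"
      proof
        assume "z / q ^ k = \<alpha>"
        then have "q ^ (r + k) * z = q ^ 0 * z" using r(2) q_nonzero by (simp add: power_add field_simps)
        then have "r + k = 0" using powers_inj(1)[OF q_gt_1 nz] by (meson injD)
        with r(1) show False by simp
      qed
      moreover have "z / q ^ k \<noteq> - l"
      proof
        assume "z / q ^ k = - l"
        then have "\<alpha> = - l * q ^ (r + k)" using r(2) q_nonzero by (simp add: power_add field_simps)
        with \<alpha>[of "r + k"] r(1) show False by simp
      qed
      ultimately show ?case using root_down[OF Suc] by (simp add: field_simps)
    qed (simp add: z)
    then have "g = 0" by (rule poly_eq_0_of_infinite_roots[OF powers_inj(2)[OF q_gt_1 nz]])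
    with g(2) show False by simp
  qed
  obtain b where b: "g = [:-0, 1:] ^ order 0 g * b" "\<not> [:-0, 1:] dvd b"
    using order_decomp[OF g(2), of 0] by blast
  have "poly b 0 \<noteq> 0" using b(2) by (simp add: poly_eq_0_iff_dvd)
  have "constant (poly b)"
  proof (rule ccontr)
    assume "\<not> constant (poly b)"
    then obtain z where z: "poly b z = 0" using fundamental_theorem_of_algebra by blast
    then have "poly g z = 0" by (subst b(1)) simp
    with only_zero have "z = 0" by blast
    with z \<open>poly b 0 \<noteq> 0\<close> show False by simp
  qed
  then have "degree b = 0" by (simp add: constant_degree)
  then obtain c where c: "b = [:c:]" by (rule degree_eq_zeroE)
  have "c \<noteq> 0" using g(2) b(1) c by auto
  have "v n = 0" if "n \<ge> order 0 g" for n
  proof -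
    have "g * monom 1 (n - order 0 g) = smult c (monom 1 n)"
      using that by (subst b(1)) (simp add: c monom_altdef flip: power_add)
    then have "c * v n = moment v (g * monom 1 (n - order 0 g))"
      by (simp add: moment_smult moment_monom)
    also have "\<dots> = 0" using g(1) by (simp add: Ann_def)
    finally show ?thesis using \<open>c \<noteq> 0\<close> by simp
  qed
  then have "v (order 0 g) = 0" "v (Suc (order 0 g)) = 0" by auto
  with step[of "order 0 g"] \<alpha>_nonzero show False by simp
qed

lemma det_hankel_nonzero_infinitely_often:
  assumes "\<And>k. k > 0 \<Longrightarrow> \<alpha> \<noteq> - l * q ^ k"
  shows "\<exists>n\<ge>N. det (hankel v n) \<noteq> 0"
  using no_annihilator[OF assms] kronecker_hankel[of N v] by blast

definition decaying_node_poly :: "nat \<Rightarrow> complex poly" where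
  "decaying_node_poly k = (\<Prod>m=1..k. [:-(\<alpha> / q ^ m), 1:])"

text \<open>The product of the \<open>q ^ m t - \<alpha>\<close> on the right of the iterated identity is a power of q times
  \<open>decaying_node_poly k\<close>. Read backwards, the identity thus expresses a product with \<open>decaying_node_poly k\<close> through a
  much larger polynomial, and the powers of q on the left more than compensate for this.\<close>

lemma moment_decaying_node_polys:
  "q ^ (k * k + (\<Sum>m=1..k. m)) * moment v (decaying_node_poly k * decaying_node_poly j) =
     moment v ((\<Prod>m<k. [:-(\<alpha> * q ^ m), 1:]) * ((\<Prod>m<k. [:l * q ^ m, 1:]) *
       ((\<Prod>m=1..j. [:-(\<alpha> / q ^ m), 1 / q ^ k:]) * 1)))"
proof -
  have "(\<Prod>m=1..k. [:-\<alpha>, q ^ m:]) = (\<Prod>m=1..k. smult (q ^ m) [:-(\<alpha> / q ^ m), 1:])"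
    by (rule prod.cong) (use q_nonzero in auto)
  also have "\<dots> = smult (\<Prod>m=1..k. q ^ m) (decaying_node_poly k)"
    unfolding prod_smult decaying_node_poly_def ..
  finally have R: "(\<Prod>m=1..k. [:-\<alpha>, q ^ m:]) = smult (q ^ (\<Sum>m=1..k. m)) (decaying_node_poly k)"
    by (simp add: power_sum)
  have P: "dilate (q ^ k) (\<Prod>m=1..j. [:-(\<alpha> / q ^ m), 1 / q ^ k:]) = decaying_node_poly j"
    unfolding decaying_node_poly_def dilate_prod dilate_linear using q_nonzero by simp
  show ?thesis
    using moment_dilate_iterated[of k "\<Prod>m=1..j. [:-(\<alpha> / q ^ m), 1 / q ^ k:]"]
    unfolding R P mult_smult_left moment_smult prod.distrib mult_1_right power_add
    by (simp only: mult.assoc)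
qed

end

locale decaying_q_sequence = complex_q_sequence +
  fixes C0 :: real
  assumes v_bound: "norm (v n) \<le> C0 * norm \<alpha> ^ n"
begin

text \<open>The shift by s is included so that the property passes through products with linear
  factors.\<close>

definition moment_bounded :: "complex poly \<Rightarrow> real \<Rightarrow> bool" where
  "moment_bounded P M \<longleftrightarrow> (\<forall>s. norm (moment v (monom 1 s * P)) \<le> C0 * norm \<alpha> ^ s * M)"

lemma moment_bounded_linear_mult:
  assumes "moment_bounded P M"
  shows "moment_bounded ([:b, c:] * P) ((norm b + norm c * norm \<alpha>) * M)"
  unfolding moment_bounded_def
proof
  fix s
  have M: "norm (moment v (monom 1 t * P)) \<le> C0 * norm \<alpha> ^ t * M" for t
    using assms unfolding moment_bounded_def by blast
  have "monom 1 s * ([:b, c:] * P) = smult b (monom 1 s * P) + smult c (monom 1 (Suc s) * P)"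
    by (simp add: monom_Suc algebra_simps)
  then have "norm (moment v (monom 1 s * ([:b, c:] * P))) \<le>
      norm b * norm (moment v (monom 1 s * P)) + norm c * norm (moment v (monom 1 (Suc s) * P))"
    by (simp only: moment_add moment_smult norm_mult[symmetric] norm_triangle_ineq)
  also have "\<dots> \<le> norm b * (C0 * norm \<alpha> ^ s * M) + norm c * (C0 * norm \<alpha> ^ Suc s * M)"
    by (intro add_mono mult_left_mono M norm_ge_zero)
  finally show "norm (moment v (monom 1 s * ([:b, c:] * P))) \<le> C0 * norm \<alpha> ^ s * ((norm b + norm c * norm \<alpha>) * M)"
    by (simp add: algebra_simps)
qed

lemma moment_bounded_prod_mult:
  assumes "moment_bounded P M" "finite A"
  shows "moment_bounded ((\<Prod>i\<in>A. [:b i, c i:]) * P) ((\<Prod>i\<in>A. norm (b i) + norm (c i) * norm \<alpha>) * M)"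
  using assms(2)
proof (induction A)
  case (insert i A)
  from moment_bounded_linear_mult[OF insert.IH, of "b i" "c i"] show ?case
    unfolding prod.insert[OF insert.hyps] mult.assoc .
qed (use assms(1) in simp)

lemma moment_bounded_1: "moment_bounded 1 1"
  using v_bound by (simp add: moment_bounded_def moment_monom)

lemma C0_nonneg: "C0 \<ge> 0"
  using order_trans[OF norm_ge_zero v_bound[of 0]] by simp

lemma norm_moment_decaying_node_polys:
  "norm q ^ (k * k + (\<Sum>m=1..k. m)) * norm (moment v (decaying_node_poly k * decaying_node_poly j)) \<le>
     C0 * ((\<Prod>m<k. norm (\<alpha> * q ^ m) + norm \<alpha>) * ((\<Prod>m<k. norm (l * q ^ m) + norm \<alpha>) *
       (\<Prod>m=1..j. norm (\<alpha> / q ^ m) + norm \<alpha> / norm q ^ k)))"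
proof -
  let ?A = "\<Prod>m<k. [:-(\<alpha> * q ^ m), 1:]" and ?B = "\<Prod>m<k. [:l * q ^ m, 1:]"
    and ?C = "\<Prod>m=1..j. [:-(\<alpha> / q ^ m), 1 / q ^ k:]"
  have "moment_bounded (?A * (?B * (?C * 1)))
    ((\<Prod>m<k. norm (-(\<alpha> * q ^ m)) + norm (1::complex) * norm \<alpha>) *
     ((\<Prod>m<k. norm (l * q ^ m) + norm (1::complex) * norm \<alpha>) *
     ((\<Prod>m=1..j. norm (-(\<alpha> / q ^ m)) + norm (1 / q ^ k) * norm \<alpha>) * 1)))"
    by (intro moment_bounded_prod_mult moment_bounded_1) auto
  then have "norm (moment v (monom 1 0 * (?A * (?B * (?C * 1))))) \<le> C0 * norm \<alpha> ^ 0 *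
    ((\<Prod>m<k. norm (-(\<alpha> * q ^ m)) + norm (1::complex) * norm \<alpha>) *
     ((\<Prod>m<k. norm (l * q ^ m) + norm (1::complex) * norm \<alpha>) *
     ((\<Prod>m=1..j. norm (-(\<alpha> / q ^ m)) + norm (1 / q ^ k) * norm \<alpha>) * 1)))"
    unfolding moment_bounded_def by blast
  moreover have "monom 1 0 * (?A * (?B * (?C * 1))) = ?A * (?B * (?C * 1))"
    by (simp only: monom_0 one_pCons[symmetric] mult_1_left)
  ultimately show ?thesis
    unfolding norm_power[symmetric] norm_mult[symmetric] moment_decaying_node_polys
    by (simp add: norm_power norm_divide)
qed

end

section \<open>Size of the Hankel determinants\<close>

lemma fact_le_two_power_square: "fact n \<le> (2::real) ^ (n * n)"
proof (induction n)
  case (Suc n)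
  have "real (Suc n) \<le> 2 ^ n" by (induction n) auto
  with Suc have "fact (Suc n) \<le> 2 ^ n * (2::real) ^ (n * n)"
    unfolding fact_Suc by (intro mult_mono) auto
  also have "\<dots> \<le> 2 ^ (Suc n * Suc n)"
    unfolding power_add[symmetric] by (intro power_increasing) auto
  finally show ?case .
qed simp

lemma norm_det_le:
  fixes A :: "complex mat"
  assumes A: "A \<in> carrier_mat n n"
    and bound: "\<And>\<pi>. \<pi> permutes {0..<n} \<Longrightarrow> (\<Prod>i<n. norm (A $$ (i, \<pi> i))) \<le> b"
  shows "norm (det A) \<le> 2 ^ (n * n) * b"
proof -
  let ?S = "{\<pi>. \<pi> permutes {0..<n}}"
  have "0 \<le> (\<Prod>i<n. norm (A $$ (i, i)))" by (rule prod_nonneg) simp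
  also have "\<dots> \<le> b" using bound[OF permutes_id] by simp
  finally have b: "b \<ge> 0" .
  have "norm (det A) \<le> (\<Sum>\<pi>\<in>?S. norm (signof \<pi> * (\<Prod>i = 0..<n. A $$ (i, \<pi> i))))"
    unfolding det_def'[OF A] by (rule norm_sum)
  also have "\<dots> \<le> (\<Sum>\<pi>\<in>?S. b)"
  proof (rule sum_mono)
    fix \<pi> assume "\<pi> \<in> ?S"
    then have \<pi>: "\<pi> permutes {0..<n}" by simp
    have "norm (signof \<pi> :: complex) = 1" by (simp add: sign_def)
    then show "norm (signof \<pi> * (\<Prod>i = 0..<n. A $$ (i, \<pi> i))) \<le> b"
      using bound[OF \<pi>] by (simp add: norm_mult prod_norm lessThan_atLeast0)
  qed
  also have "\<dots> = fact n * b" by (simp add: card_permutations)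
  also have "\<dots> \<le> 2 ^ (n * n) * b"
    by (intro mult_right_mono fact_le_two_power_square b)
  finally show ?thesis .
qed

context decaying_q_sequence
begin

text \<open>For \<open>l = 0\<close> the factors \<open>t + l q ^ m\<close> do not grow with m, which improves the decay.\<close>

definition decay_rate :: real where
  "decay_rate = (if l = 0 then 3 / 4 else 1 / 2)"

definition factor_bound :: real where
  "factor_bound = max 1 (max (2 * norm \<alpha>) (norm l + norm \<alpha>))"

lemma factor_bound_bounds: "1 \<le> factor_bound" "2 * norm \<alpha> \<le> factor_bound" "norm l + norm \<alpha> \<le> factor_bound" "norm \<alpha> \<le> factor_bound"
  using norm_ge_zero[of \<alpha>] norm_ge_zero[of l] by (auto simp: factor_bound_def max_def)

lemma norm_power_eq_exp: "norm q ^ m = exp (m * ln (norm q))"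
proof -
  have "norm q > 0" using q_gt_1 by linarith
  then show ?thesis by (simp add: exp_of_nat_mult)
qed

text \<open>With \<open>Q = |q|\<close>, the three products on the right of \<^emph>\<open>norm_moment_decaying_node_polys\<close> are at most
  exponential factors times Q to the powers \<open>k\<^sup>2 / 2\<close>, \<open>k\<^sup>2 / 2\<close> (or 0 for \<open>l = 0\<close>) and \<open>- j\<^sup>2 / 2\<close>, up to linear terms,
  while the left-hand side has Q to the power \<open>3 k\<^sup>2 / 2\<close>. For \<open>l = 0\<close> the resulting exponent
  \<open>k\<^sup>2 + j\<^sup>2 / 2\<close> is made symmetric by means of \<open>j \<le> k\<close>.\<close>

lemma moment_decaying_node_polys_bound:
  assumes "j \<le> k"
  shows "norm (moment v (decaying_node_poly k * decaying_node_poly j)) \<le>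
    C0 * factor_bound ^ (2 * (k + j)) * exp (- decay_rate * ln (norm q) * ((real k)\<^sup>2 + (real j)\<^sup>2))"
proof -
  let ?Q = "norm q" and ?L = "ln (norm q)"
  have Q: "?Q > 1" "?L > 0" "?Q > 0" using q_gt_1 ln_gt_zero[OF q_gt_1] by linarith+
  have sum1: "real (\<Sum>m<k. m) = real k * (real k - 1) / 2"
    using sum_real_lessThan[of k] by simp
  have sum2: "real (\<Sum>m=1..j. m) = real j * (real j + 1) / 2" for j :: nat
    by (induction j) (auto simp: field_simps)
  have growth: "(\<Prod>m<k. norm (c * q ^ m) + norm \<alpha>) \<le> factor_bound ^ k * exp (real k * (real k - 1) / 2 * ?L)"
    if "norm c + norm \<alpha> \<le> factor_bound" for c
  proof -
    have "(\<Prod>m<k. norm (c * q ^ m) + norm \<alpha>) \<le> (\<Prod>m<k. factor_bound * ?Q ^ m)"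
    proof (rule prod_mono, intro conjI)
      fix m
      have "1 \<le> ?Q ^ m" using Q by (simp add: one_le_power)
      then have "norm \<alpha> * 1 \<le> norm \<alpha> * ?Q ^ m" by (intro mult_left_mono) auto
      then have "norm (c * q ^ m) + norm \<alpha> \<le> (norm c + norm \<alpha>) * ?Q ^ m"
        by (simp add: norm_mult norm_power distrib_right)
      also have "\<dots> \<le> factor_bound * ?Q ^ m" by (intro mult_right_mono that) auto
      finally show "norm (c * q ^ m) + norm \<alpha> \<le> factor_bound * ?Q ^ m" .
    qed simp
    also have "\<dots> = factor_bound ^ k * ?Q ^ (\<Sum>m<k. m)" by (simp add: prod.distrib power_sum)
    finally show ?thesis unfolding norm_power_eq_exp sum1 .
  qed
  have P1: "(\<Prod>m<k. norm (\<alpha> * q ^ m) + norm \<alpha>) \<le> factor_bound ^ k * exp (real k * (real k - 1) / 2 * ?L)"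
    using growth[of \<alpha>] factor_bound_bounds(2) by simp
  have P2: "(\<Prod>m<k. norm (l * q ^ m) + norm \<alpha>) \<le>
      factor_bound ^ k * exp ((if l = 0 then 0 else real k * (real k - 1) / 2) * ?L)"
  proof (cases "l = 0")
    case True
    have "norm \<alpha> ^ k \<le> factor_bound ^ k" by (intro power_mono factor_bound_bounds) auto
    with True show ?thesis by simp
  qed (use growth[OF factor_bound_bounds(3)] in simp)
  have P3: "(\<Prod>m=1..j. norm (\<alpha> / q ^ m) + norm \<alpha> / ?Q ^ k) \<le> factor_bound ^ j * exp (- (real j * (real j + 1) / 2) * ?L)"
  proof -
    have "(\<Prod>m=1..j. norm (\<alpha> / q ^ m) + norm \<alpha> / ?Q ^ k) \<le> (\<Prod>m=1..j. factor_bound * inverse (?Q ^ m))"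
    proof (rule prod_mono, intro conjI)
      fix m assume "m \<in> {1..j}"
      then have "?Q ^ m \<le> ?Q ^ k" using Q assms by (intro power_increasing) auto
      then have "norm \<alpha> / ?Q ^ k \<le> norm \<alpha> / ?Q ^ m"
        using Q(3) by (intro divide_left_mono mult_pos_pos zero_less_power norm_ge_zero)
      moreover have "norm (\<alpha> / q ^ m) = norm \<alpha> / ?Q ^ m" by (simp add: norm_divide norm_power)
      ultimately have "norm (\<alpha> / q ^ m) + norm \<alpha> / ?Q ^ k \<le> 2 * norm \<alpha> * inverse (?Q ^ m)"
        unfolding divide_inverse by linarith
      also have "\<dots> \<le> factor_bound * inverse (?Q ^ m)" using Q by (intro mult_right_mono factor_bound_bounds) auto
      finally show "norm (\<alpha> / q ^ m) + norm \<alpha> / ?Q ^ k \<le> factor_bound * inverse (?Q ^ m)" .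
    qed simp
    also have "\<dots> = factor_bound ^ j * inverse (?Q ^ (\<Sum>m=1..j. m))"
      by (simp add: prod.distrib power_sum prod_inversef[symmetric])
    finally show ?thesis unfolding norm_power_eq_exp sum2 by (simp add: exp_minus)
  qed
  define E1 where "E1 = real k * (real k - 1) / 2 * ?L"
  define E2 where "E2 = (if l = 0 then 0 else real k * (real k - 1) / 2) * ?L"
  define E3 where "E3 = - (real j * (real j + 1) / 2) * ?L"
  define E4 where "E4 = ((real k)\<^sup>2 + real k * (real k + 1) / 2) * ?L"
  have "real (k * k + (\<Sum>m=1..k. m)) = (real k)\<^sup>2 + real k * (real k + 1) / 2"
    unfolding of_nat_add sum2 by (simp add: power2_eq_square)
  then have "exp E4 * norm (moment v (decaying_node_poly k * decaying_node_poly j)) =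
      ?Q ^ (k * k + (\<Sum>m=1..k. m)) * norm (moment v (decaying_node_poly k * decaying_node_poly j))"
    unfolding norm_power_eq_exp E4_def by simp
  also have "\<dots> \<le> C0 * ((\<Prod>m<k. norm (\<alpha> * q ^ m) + norm \<alpha>) * ((\<Prod>m<k. norm (l * q ^ m) + norm \<alpha>) *
       (\<Prod>m=1..j. norm (\<alpha> / q ^ m) + norm \<alpha> / norm q ^ k)))"
    by (rule norm_moment_decaying_node_polys)
  also have "\<dots> \<le> C0 * ((factor_bound ^ k * exp E1) * ((factor_bound ^ k * exp E2) * (factor_bound ^ j * exp E3)))"
    using P1 P2 P3 C0_nonneg factor_bound_bounds(1) unfolding E1_def[symmetric] E2_def[symmetric] E3_def[symmetric]
    by (intro mult_left_mono mult_mono) (auto intro!: mult_nonneg_nonneg prod_nonneg add_nonneg_nonneg)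
  also have "\<dots> = C0 * factor_bound ^ (2 * k + j) * exp (E1 + E2 + E3)"
    by (simp add: exp_add power_add mult_2)
  also have "\<dots> \<le> C0 * factor_bound ^ (2 * (k + j)) * exp (E1 + E2 + E3)"
    using C0_nonneg factor_bound_bounds(1) by (intro mult_right_mono mult_left_mono power_increasing) auto
  finally have "norm (moment v (decaying_node_poly k * decaying_node_poly j)) \<le>
      C0 * factor_bound ^ (2 * (k + j)) * exp (E1 + E2 + E3 - E4)"
    by (simp add: exp_diff field_simps)
  also have "E1 + E2 + E3 - E4 \<le> - decay_rate * ?L * ((real k)\<^sup>2 + (real j)\<^sup>2)"
  proof -
    have jk: "(real j)\<^sup>2 \<le> (real k)\<^sup>2" using assms by (intro power_mono) auto
    have "E1 + E2 + E3 - E4 = (real k * (real k - 1) / 2 + (if l = 0 then 0 else real k * (real k - 1) / 2)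
        - real j * (real j + 1) / 2 - ((real k)\<^sup>2 + real k * (real k + 1) / 2)) * ?L"
      by (simp add: E1_def E2_def E3_def E4_def algebra_simps)
    also have "\<dots> \<le> (- decay_rate * ((real k)\<^sup>2 + (real j)\<^sup>2)) * ?L"
    proof (intro mult_right_mono)
      show "real k * (real k - 1) / 2 + (if l = 0 then 0 else real k * (real k - 1) / 2)
        - real j * (real j + 1) / 2 - ((real k)\<^sup>2 + real k * (real k + 1) / 2) \<le> - decay_rate * ((real k)\<^sup>2 + (real j)\<^sup>2)"
        unfolding decay_rate_def using jk by (cases "l = 0") (simp_all add: power2_eq_square field_simps)
    qed (use Q in simp)
    finally show ?thesis by (simp add: mult_ac)
  qed
  finally show ?thesis
    using C0_nonneg factor_bound_bounds(1) by (simp add: mult_left_mono)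
qed

lemma norm_det_hankel_bound:
  "\<exists>c. \<forall>n. norm (det (hankel v n)) \<le>
     exp (c * (real n)\<^sup>2 - 2 / 3 * decay_rate * ln (norm q) * real n ^ 3)"
proof -
  define C1 where "C1 = max 1 C0"
  define c where "c = ln 2 + ln C1 + 2 * ln factor_bound + decay_rate * ln (norm q)"
  have C1: "C1 \<ge> 1" "C0 \<le> C1" by (auto simp: C1_def)
  have L: "ln (norm q) > 0" "decay_rate > 0" using ln_gt_zero[OF q_gt_1] by (auto simp: decay_rate_def)
  have monic: "monic_of_degree (decaying_node_poly i) i" for i
    using monic_of_degree_prod[of "{1..i}" "\<lambda>m. [:-(\<alpha> / q ^ m), 1:]" "\<lambda>_. Suc 0"]
    by (simp add: decaying_node_poly_def)
  define A where "A n = Matrix.mat n n (\<lambda>(i, j). moment v (decaying_node_poly i * decaying_node_poly j))" for n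
  have det: "det (hankel v n) = det (A n)" for n
    unfolding A_def by (rule det_hankel_change_basis) (rule monic)+
  define f where "f i j = C1 * factor_bound ^ (2 * (i + j)) * exp (- decay_rate * ln (norm q) * ((real i)\<^sup>2 + (real j)\<^sup>2))" for i j :: nat
  have entry: "norm (moment v (decaying_node_poly i * decaying_node_poly j)) \<le> f i j" for i j
  proof -
    have "norm (moment v (decaying_node_poly i * decaying_node_poly j)) \<le> f i j" if "j \<le> i" for i j
      using moment_decaying_node_polys_bound[OF that] unfolding f_def
      by (rule order_trans) (intro mult_right_mono C1, use factor_bound_bounds(1) in auto)
    from this[of i j] this[of j i] show ?thesis
      by (cases "j \<le> i") (auto simp: f_def ac_simps)
  qed
  have "norm (det (hankel v n)) \<le> exp (c * (real n)\<^sup>2 - 2 / 3 * decay_rate * ln (norm q) * real n ^ 3)" for n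
  proof -
    let ?b = "C1 ^ n * factor_bound ^ (2 * (n * n)) * exp (- 2 * decay_rate * ln (norm q) * (\<Sum>i<n. (real i)\<^sup>2))"
    have "norm (det (A n)) \<le> 2 ^ (n * n) * ?b"
    proof (rule norm_det_le)
      show "A n \<in> carrier_mat n n" by (simp add: A_def)
      fix \<pi> assume \<pi>: "\<pi> permutes {0..<n}"
      have "(\<Prod>i<n. norm (A n $$ (i, \<pi> i))) \<le> (\<Prod>i<n. f i (\<pi> i))"
        using permutes_in_image[OF \<pi>] by (intro prod_mono) (auto simp: A_def intro: entry)
      also have "\<dots> = C1 ^ n * factor_bound ^ (2 * (\<Sum>i<n. i + \<pi> i)) *
          exp (\<Sum>i<n. - decay_rate * ln (norm q) * ((real i)\<^sup>2 + (real (\<pi> i))\<^sup>2))"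
        by (simp add: f_def prod.distrib power_sum exp_sum sum_distrib_left)
      also have "(\<Sum>i<n. - decay_rate * ln (norm q) * ((real i)\<^sup>2 + (real (\<pi> i))\<^sup>2)) =
          - 2 * decay_rate * ln (norm q) * (\<Sum>i<n. (real i)\<^sup>2)"
        unfolding sum_distrib_left[symmetric] sum.distrib
        using sum_permutes_lessThan[OF \<pi>, of "\<lambda>i. (real i)\<^sup>2"] by simp
      also have "(\<Sum>i<n. i + \<pi> i) = 2 * (\<Sum>i<n. i)" by (rule double_sum_permutes[OF \<pi>, of "\<lambda>i. i"])
      also have "C1 ^ n * factor_bound ^ (2 * (2 * (\<Sum>i<n. i))) * exp (- 2 * decay_rate * ln (norm q) * (\<Sum>i<n. (real i)\<^sup>2)) \<le> ?b"
      proof -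
        have "2 * (\<Sum>i<n. i) \<le> n * n" by (induction n) auto
        then show ?thesis
          using C1 factor_bound_bounds(1) by (intro mult_right_mono mult_left_mono power_increasing) auto
      qed
      finally show "(\<Prod>i<n. norm (A n $$ (i, \<pi> i))) \<le> ?b" .
    qed
    also have "\<dots> \<le> 2 ^ (n * n) * (C1 ^ (n * n) * factor_bound ^ (2 * (n * n)) * exp (- 2 * decay_rate * ln (norm q) * (\<Sum>i<n. (real i)\<^sup>2)))"
    proof -
      have "n \<le> n * n" by (cases n) auto
      then show ?thesis
        using C1 factor_bound_bounds(1) by (intro mult_right_mono mult_left_mono power_increasing) auto
    qed
    also have "\<dots> = exp (n * n * ln 2 + n * n * ln C1 + 2 * (n * n) * ln factor_bound - 2 * decay_rate * ln (norm q) * (\<Sum>i<n. (real i)\<^sup>2))"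
    proof -
      have "x ^ m = exp (m * ln x)" if "x > 0" for x :: real and m
        using that by (simp add: exp_of_nat_mult)
      from this[of 2 "n * n"] this[of C1 "n * n"] this[of factor_bound "2 * (n * n)"] show ?thesis
        using C1 factor_bound_bounds(1) by (simp add: exp_add exp_diff exp_minus field_simps)
    qed
    also have "\<dots> \<le> exp (c * (real n)\<^sup>2 - 2 / 3 * decay_rate * ln (norm q) * real n ^ 3)"
    proof -
      have "real n ^ 3 / 3 - (real n)\<^sup>2 / 2 \<le> (\<Sum>i<n. (real i)\<^sup>2)"
        unfolding sum_real_squares_lessThan by (simp add: field_simps power2_eq_square power3_eq_cube)
      then have "2 * (decay_rate * ln (norm q)) * (real n ^ 3 / 3 - (real n)\<^sup>2 / 2) \<le>
          2 * (decay_rate * ln (norm q)) * (\<Sum>i<n. (real i)\<^sup>2)"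
        using L by (intro mult_left_mono) auto
      then show ?thesis unfolding exp_le_cancel_iff c_def
        by (simp add: algebra_simps power2_eq_square)
    qed
    finally show ?thesis unfolding det .
  qed
  then show ?thesis by blast
qed

end

text \<open>Here the value of the series enters: \<open>v n\<close> is the product of the first n factors times the tail of the series after the
  n-th term. Eventually the terms at least halve in each step, so the tail is at most its predecessor
  \<open>|\<alpha>| ^ n / |\<Prod>j=1..n. q ^ j - l|\<close>.\<close>

lemma (in complex_q_sequence) bounded_of_q_series:
  assumes l: "l \<notin> pos_powers q" and v0: "v 0 = qF q \<alpha> l - 1"
  shows "\<exists>C0. \<forall>n. norm (v n) \<le> C0 * norm \<alpha> ^ n"
proof -
  define P where "P n = (\<Prod>j=1..n. q ^ j - l)" for n
  define t where "t n = \<alpha> ^ n / P n" for n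
  have nz: "q ^ j - l \<noteq> 0" if "j > 0" for j
    using l that by (auto simp: pos_powers_def)
  have P_Suc: "P (Suc n) = P n * (q ^ Suc n - l)" for n by (simp add: P_def)
  have P_nz: "P n \<noteq> 0" for n unfolding P_def using nz by auto
  have t_Suc: "t (Suc n) = t n * (\<alpha> / (q ^ Suc n - l))" for n
    by (simp add: t_def P_Suc)
  obtain N where N: "2 * norm \<alpha> + norm l < norm q ^ N"
    using real_arch_pow[OF q_gt_1] by blast
  have large: "norm (\<alpha> / (q ^ Suc n - l)) \<le> 1 / 2" if "n \<ge> N" for n
  proof -
    have "norm q ^ N \<le> norm q ^ Suc n" using q_gt_1 that by (intro power_increasing) auto
    also have "\<dots> \<le> norm (q ^ Suc n - l) + norm l"
      using norm_triangle_ineq[of "q ^ Suc n - l" l] by (simp add: norm_power norm_mult)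
    finally have "2 * norm \<alpha> \<le> norm (q ^ Suc n - l)" using N by linarith
    then show ?thesis using nz[of "Suc n"] by (simp add: norm_divide divide_le_eq)
  qed
  have halve: "norm (t (Suc n)) \<le> 1 / 2 * norm (t n)" if "n \<ge> N" for n
    using mult_left_mono[OF large[OF that], of "norm (t n)"] by (simp only: t_Suc norm_mult) simp
  have summable: "summable t"
    by (rule summable_ratio_test[of "1 / 2" N]) (use halve in auto)
  have closed: "v n = P n * (suminf t - (\<Sum>k<Suc n. t k))" for n
  proof (induction n)
    case 0
    show ?case using v0 by (simp add: qF_def t_def[abs_def] P_def)
  next
    case (Suc n)
    have "P (Suc n) * t (Suc n) = \<alpha> ^ Suc n" using P_nz[of "Suc n"] by (simp add: t_def)
    then show ?case unfolding step[of n] Suc.IH by (simp add: P_Suc algebra_simps)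
  qed
  have tail: "norm (v n) \<le> norm \<alpha> ^ n" if n: "n \<ge> N" for n
  proof -
    have geo: "norm (t (k + Suc n)) \<le> norm (t n) * (1 / 2) ^ Suc k" for k
    proof (induction k)
      case 0
      show ?case using halve[OF n] by simp
    next
      case (Suc k)
      have "norm (t (Suc (k + Suc n))) \<le> 1 / 2 * norm (t (k + Suc n))" by (rule halve) (use n in simp)
      with Suc show ?case by simp
    qed
    have half: "(\<lambda>k. norm (t n) * (1 / 2) ^ Suc k) sums norm (t n)"
      using sums_mult[OF geometric_sums[of "1 / 2 :: real"], of "norm (t n) / 2"] by simp
    have "suminf t - (\<Sum>k<Suc n. t k) = (\<Sum>k. t (k + Suc n))"
      using suminf_minus_initial_segment[OF summable, of "Suc n"] by simp
    also have "norm \<dots> \<le> (\<Sum>k. norm (t n) * (1 / 2) ^ Suc k)"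
      by (rule norm_suminf_le[OF geo sums_summable[OF half]])
    also have "\<dots> = norm (t n)" using half by (rule sums_unique[symmetric])
    finally have "norm (v n) \<le> norm (P n) * norm (t n)"
      unfolding closed norm_mult by (intro mult_left_mono) auto
    also have "\<dots> = norm \<alpha> ^ n" using P_nz[of n] by (simp add: t_def norm_divide norm_power)
    finally show ?thesis .
  qed
  define C0 where "C0 = 1 + (\<Sum>n<N. norm (v n) / norm \<alpha> ^ n)"
  have "norm (v n) \<le> C0 * norm \<alpha> ^ n" for n
  proof (cases "n < N")
    case True
    then have "norm (v n) / norm \<alpha> ^ n \<le> (\<Sum>n<N. norm (v n) / norm \<alpha> ^ n)"
      by (intro member_le_sum) auto
    then have "norm (v n) / norm \<alpha> ^ n \<le> C0" by (simp add: C0_def)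
    then show ?thesis using \<alpha>_nonzero by (simp add: divide_le_eq)
  next
    case False
    have "1 \<le> C0" unfolding C0_def by (simp add: sum_nonneg)
    then have "1 * norm \<alpha> ^ n \<le> C0 * norm \<alpha> ^ n" by (intro mult_right_mono) auto
    with tail[of n] False show ?thesis by simp
  qed
  then show ?thesis by blast
qed

section \<open>The dilogarithm value\<close>

text \<open>The non-principal character modulo 3.\<close>

definition chi3 :: "nat \<Rightarrow> real" where
  "chi3 n = (if n mod 3 = 1 then 1 else if n mod 3 = 2 then - 1 else 0)"

lemma Im_cube_root_power:
  "Im (exp (2 * of_real pi * \<i> / 3) ^ n) = sqrt 3 / 2 * chi3 n"
proof -
  define \<omega> where "\<omega> = exp (2 * of_real pi * \<i> / 3)"
  have "\<omega> = cis (2 * pi / 3)" by (simp add: \<omega>_def cis_conv_exp mult_ac)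
  then have \<omega>: "\<omega> = Complex (- 1 / 2) (sqrt 3 / 2)"
    by (simp add: complex_eq_iff cos_120 sin_120)
  have \<omega>2: "\<omega> ^ 2 = Complex (- 1 / 2) (- sqrt 3 / 2)"
    unfolding \<omega> by (simp add: complex_eq_iff power2_eq_square field_simps)
  have "\<omega> ^ 3 = \<omega> ^ 2 * \<omega>" by (simp add: power3_eq_cube power2_eq_square)
  also have "\<dots> = 1" unfolding \<omega>2 unfolding \<omega> by (simp add: complex_eq_iff field_simps)
  finally have \<omega>3: "\<omega> ^ 3 = 1" .
  have "\<omega> ^ n = \<omega> ^ (3 * (n div 3) + n mod 3)" by simp
  also have "\<dots> = \<omega> ^ (n mod 3)" by (simp only: power_add power_mult \<omega>3 power_one mult_1_left)
  finally have n: "\<omega> ^ n = \<omega> ^ (n mod 3)" .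
  have "n mod 3 < 3" by simp
  then consider "n mod 3 = 0" | "n mod 3 = 1" | "n mod 3 = 2" by linarith
  then have "Im (\<omega> ^ n) = sqrt 3 / 2 * chi3 n"
  proof cases
    case 1
    then show ?thesis unfolding n by (simp add: chi3_def)
  next
    case 2
    have "Im \<omega> = sqrt 3 / 2" unfolding \<omega> by simp
    with 2 show ?thesis unfolding n by (simp add: chi3_def)
  next
    case 3
    have "Im (\<omega> ^ 2) = - sqrt 3 / 2" unfolding \<omega>2 by simp
    with 3 show ?thesis unfolding n by (simp add: chi3_def)
  qed
  then show ?thesis by (simp only: \<omega>_def)
qed

lemma inverse_squares_sums_Suc: "(\<lambda>n. 1 / (real (Suc n))\<^sup>2) sums (pi\<^sup>2 / 6)"
  using inverse_squares_sums by (simp add: add.commute)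

lemma chi3_sums:
  "(\<lambda>n. chi3 (Suc n) / (real (Suc n))\<^sup>2) sums (2 / sqrt 3 * Im (Li2 (exp (2 * of_real pi * \<i> / 3))))"
proof -
  define \<omega> where "\<omega> = exp (2 * of_real pi * \<i> / 3)"
  have norm: "norm \<omega> = 1" by (simp add: \<omega>_def norm_exp_eq_Re)
  have "summable (\<lambda>n. \<omega> ^ Suc n / of_nat (Suc n) ^ 2)"
  proof (rule summable_comparison_test[OF _ sums_summable[OF inverse_squares_sums_Suc]])
    show "\<exists>N. \<forall>n\<ge>N. norm (\<omega> ^ Suc n / of_nat (Suc n) ^ 2) \<le> 1 / (real (Suc n))\<^sup>2"
      by (auto simp: norm_divide norm_mult norm_power norm simp del: of_nat_Suc)
  qed
  then have "(\<lambda>n. \<omega> ^ Suc n / of_nat (Suc n) ^ 2) sums Li2 \<omega>"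
    unfolding Li2_def by (rule summable_sums)
  then have "(\<lambda>n. Im (\<omega> ^ Suc n / of_nat (Suc n) ^ 2)) sums Im (Li2 \<omega>)"
    by (simp add: sums_complex_iff)
  moreover have "Im (\<omega> ^ Suc n / of_nat (Suc n) ^ 2) = sqrt 3 / 2 * (chi3 (Suc n) / (real (Suc n))\<^sup>2)" for n
  proof -
    have "Im (\<omega> ^ Suc n / of_nat (Suc n) ^ 2) = Im (\<omega> ^ Suc n / of_real ((real (Suc n))\<^sup>2))"
      by simp
    also have "\<dots> = Im (\<omega> ^ Suc n) / (real (Suc n))\<^sup>2" by (rule Im_divide_of_real)
    finally show ?thesis using Im_cube_root_power[of "Suc n"] by (simp only: \<omega>_def times_divide_eq_right)
  qed
  ultimately have "(\<lambda>n. sqrt 3 / 2 * (chi3 (Suc n) / (real (Suc n))\<^sup>2)) sums Im (Li2 \<omega>)"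
    by simp
  from sums_mult[OF this, of "2 / sqrt 3"] show ?thesis by (simp add: \<omega>_def)
qed

lemma multiples_of_3_sums:
  "(\<lambda>n. (if Suc n mod 3 = 0 then 1 else 0) / (real (Suc n))\<^sup>2) sums (pi\<^sup>2 / 54)"
proof -
  have "strict_mono (\<lambda>n::nat. 3 * n + 2)" by (auto intro: strict_monoI)
  moreover have "(if Suc n mod 3 = 0 then 1 else 0) / (real (Suc n))\<^sup>2 = 0"
    if "n \<notin> range (\<lambda>n::nat. 3 * n + 2)" for n
  proof -
    have "Suc n mod 3 \<noteq> 0"
    proof
      assume "Suc n mod 3 = 0"
      then have "n = 3 * (n div 3) + 2" by presburger
      with that show False by blast
    qed
    then show ?thesis by simp
  qed
  ultimately have "(\<lambda>n. (if Suc (3 * n + 2) mod 3 = 0 then 1 else 0) / (real (Suc (3 * n + 2)))\<^sup>2) sums (pi\<^sup>2 / 54) \<longleftrightarrow> ?thesis"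
    by (rule sums_mono_reindex)
  moreover have "(if Suc (3 * n + 2) mod 3 = 0 then 1 else 0) / (real (Suc (3 * n + 2)))\<^sup>2 = 1 / 9 * (1 / (real (Suc n))\<^sup>2)" for n
  proof -
    have "Suc (3 * n + 2) = 3 * (n + 1)" by simp
    then show ?thesis by (simp only: mod_mult_self1_is_0 of_nat_mult power_mult_distrib) simp
  qed
  moreover have "(\<lambda>n. 1 / 9 * (1 / (real (Suc n))\<^sup>2)) sums (pi\<^sup>2 / 54)"
    using sums_mult[OF inverse_squares_sums_Suc, of "1 / 9"] by simp
  ultimately show ?thesis by simp
qed

text \<open>The sum of \<open>1 / \<theta>\<^sup>2\<close> over the positive integers \<theta> that are not congruent to 1 modulo 3.\<close>

definition gain_constant :: real where
  "gain_constant = 5 / 54 * pi\<^sup>2 - Im (Li2 (exp (2 * of_real pi * \<i> / 3))) / sqrt 3"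

text \<open>The indicator function of \<open>\<theta> mod 3 \<noteq> 1\<close> is a combination of the constant function, the indicator
  function of the multiples of 3 and the character \<open>chi3\<close>.\<close>

lemma gain_constant_LIMSEQ:
  "(\<lambda>M. \<Sum>\<theta>\<in>{\<theta>\<in>{1..M}. \<theta> mod 3 \<noteq> 1}. 1 / (real \<theta>)\<^sup>2) \<longlonglongrightarrow> gain_constant"
proof -
  have summand: "(if Suc n mod 3 \<noteq> 1 then 1 else 0) / (real (Suc n))\<^sup>2 = 1 / 2 * (1 / (real (Suc n))\<^sup>2) +
      1 / 2 * ((if Suc n mod 3 = 0 then 1 else 0) / (real (Suc n))\<^sup>2) - 1 / 2 * (chi3 (Suc n) / (real (Suc n))\<^sup>2)" for n
  proof -
    have "Suc n mod 3 < 3" by simp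
    then consider "Suc n mod 3 = 0" | "Suc n mod 3 = 1" | "Suc n mod 3 = 2" by linarith
    then show ?thesis by cases (simp_all add: chi3_def)
  qed
  have "(\<lambda>n. (if Suc n mod 3 \<noteq> 1 then 1 else 0) / (real (Suc n))\<^sup>2) sums
      (1 / 2 * (pi\<^sup>2 / 6) + 1 / 2 * (pi\<^sup>2 / 54) - 1 / 2 * (2 / sqrt 3 * Im (Li2 (exp (2 * of_real pi * \<i> / 3)))))"
    unfolding summand
    by (intro sums_diff sums_add sums_mult inverse_squares_sums_Suc multiples_of_3_sums chi3_sums)
  then have "(\<lambda>M. \<Sum>n<M. (if Suc n mod 3 \<noteq> 1 then 1 else 0) / (real (Suc n))\<^sup>2) \<longlonglongrightarrow> gain_constant"
    by (simp add: sums_def gain_constant_def)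
  moreover have "(\<Sum>n<M. (if Suc n mod 3 \<noteq> 1 then 1 else 0) / (real (Suc n))\<^sup>2) =
      (\<Sum>\<theta>\<in>{\<theta>\<in>{1..M}. \<theta> mod 3 \<noteq> 1}. 1 / (real \<theta>)\<^sup>2)" for M
  proof -
    have "(\<Sum>n<M. (if Suc n mod 3 \<noteq> 1 then 1 else 0) / (real (Suc n))\<^sup>2) =
        (\<Sum>\<theta>=1..M. (if \<theta> mod 3 \<noteq> 1 then 1 else 0) / (real \<theta>)\<^sup>2)"
      by (simp only: sum.atLeast1_atMost_eq One_nat_def)
    also have "\<dots> = (\<Sum>\<theta>\<in>{\<theta>\<in>{1..M}. \<theta> mod 3 \<noteq> 1}. 1 / (real \<theta>)\<^sup>2)"
      by (rule sum.mono_neutral_cong_right) auto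
    finally show ?thesis .
  qed
  ultimately show ?thesis by simp
qed

lemma gain_constant_nonneg: "gain_constant \<ge> 0"
  by (rule LIMSEQ_le_const[OF gain_constant_LIMSEQ]) (auto intro!: sum_nonneg)

section \<open>The arithmetic comparison\<close>

text \<open>The sequence as a polynomial in q. The initial value b stands for \<open>\<mu> - 1\<close>.\<close>

primrec q_poly_sequence :: "complex \<Rightarrow> complex \<Rightarrow> complex \<Rightarrow> nat \<Rightarrow> complex poly" where
  "q_poly_sequence a c b 0 = [:b:]"
| "q_poly_sequence a c b (Suc n) = ([:0, 1:] ^ Suc n - [:c:]) * q_poly_sequence a c b n - [:a:] ^ Suc n"

lemma poly_det_hankel:
  fixes V :: "nat \<Rightarrow> complex poly"
  shows "poly (det (hankel V n)) q = det (hankel (\<lambda>k. poly (V k) q) n)"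
proof -
  have s: "poly (signof \<pi>) q = signof \<pi>" for \<pi> :: "nat \<Rightarrow> nat"
    by (simp add: sign_def)
  have "poly (det (hankel V n)) q =
      (\<Sum>\<pi> | \<pi> permutes {0..<n}. signof \<pi> * (\<Prod>i = 0..<n. poly (hankel V n $$ (i, \<pi> i)) q))"
    unfolding det_def'[OF hankel_carrier] by (simp add: poly_sum poly_prod s)
  also have "\<dots> = det (hankel (\<lambda>k. poly (V k) q) n)"
    unfolding det_def'[OF hankel_carrier]
    by (intro sum.cong refl arg_cong2[where f = "(*)"] prod.cong)
      (auto simp: hankel_def dest: permutes_in_image)
  finally show ?thesis .
qed

lemma half_square_sum_bound:
  "real n ^ 3 / 6 - 2 * (real n)\<^sup>2 \<le> real (\<Sum>i<n. 2 * ((i div 2) * (i div 2 - 1)))"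
proof -
  have "(real i)\<^sup>2 / 4 - real i \<le> real ((i div 2) * (i div 2 - 1))" for i
  proof -
    define x where "x = i div 2"
    have "i = 2 * x \<or> i = 2 * x + 1" unfolding x_def by presburger
    moreover have "real (x * (x - 1)) = real x * real x - real x"
      by (cases x) (auto simp: algebra_simps)
    ultimately show ?thesis unfolding x_def[symmetric]
      by (auto simp: power2_eq_square field_simps)
  qed
  then have "(\<Sum>i<n. 2 * ((real i)\<^sup>2 / 4 - real i)) \<le> (\<Sum>i<n. 2 * real ((i div 2) * (i div 2 - 1)))"
    by (intro sum_mono mult_left_mono) auto
  also have "(\<Sum>i<n. 2 * ((real i)\<^sup>2 / 4 - real i)) = (\<Sum>i<n. (real i)\<^sup>2) / 2 - 2 * (\<Sum>i<n. real i)"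
    by (simp add: sum_subtractf sum_distrib_left sum_divide_distrib right_diff_distrib)
  also have "(\<Sum>i<n. 2 * real ((i div 2) * (i div 2 - 1))) = real (\<Sum>i<n. 2 * ((i div 2) * (i div 2 - 1)))"
    by simp
  finally have "(\<Sum>i<n. (real i)\<^sup>2) / 2 - 2 * (\<Sum>i<n. real i) \<le> real (\<Sum>i<n. 2 * ((i div 2) * (i div 2 - 1)))" .
  moreover have "real n ^ 3 / 6 - 2 * (real n)\<^sup>2 \<le> (\<Sum>i<n. (real i)\<^sup>2) / 2 - 2 * (\<Sum>i<n. real i)"
    unfolding sum_real_squares_lessThan sum_real_lessThan
    by (simp add: field_simps power2_eq_square power3_eq_cube)
  ultimately show ?thesis by linarith
qed

lemma frequently_cubic_bound:
  assumes "\<And>N. \<exists>n\<ge>N. x * real n ^ 3 \<le> y * (real n)\<^sup>2"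
  shows "x \<le> 0"
proof (rule ccontr)
  assume "\<not> x \<le> 0"
  then have x: "x > 0" by simp
  obtain N where N: "y / x < real N" using reals_Archimedean2 by blast
  obtain n where n: "n \<ge> Suc N" "x * real n ^ 3 \<le> y * (real n)\<^sup>2" using assms by blast
  have "(x * real n) * (real n)\<^sup>2 \<le> y * (real n)\<^sup>2"
    using n(2) by (simp add: power2_eq_square power3_eq_cube mult_ac)
  then have "x * real n \<le> y" using n(1) by (simp add: mult_le_cancel_right)
  then have "real n \<le> y / x" using x by (simp add: field_simps)
  with N n(1) show False by simp
qed

text \<open>The assumptions contrary to the theorem, with a common denominator D. The fraction \<open>\<rho> / \<sigma>\<close> need not be in lowest
  terms.\<close>

locale rational_values = rational_base +
  fixes \<alpha> l :: complex and D :: int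
  assumes \<alpha>_nz: "\<alpha> \<noteq> 0" and l_not_power: "l \<notin> pos_powers q"
    and \<alpha>_not_power: "\<alpha> \<notin> {- l * p | p. p \<in> pos_powers q}"
    and D_pos: "D > 0" and D_\<alpha>: "of_int D * \<alpha> \<in> \<int>" and D_l: "of_int D * l \<in> \<int>"
    and D_\<mu>: "of_int D * qF q \<alpha> l \<in> \<int>"
begin

definition V :: "nat \<Rightarrow> complex poly" where
  "V = q_poly_sequence \<alpha> l (qF q \<alpha> l - 1)"

definition v :: "nat \<Rightarrow> complex" where
  "v k = poly (V k) q"

sublocale V: poly_q_sequence \<alpha> l V
  by unfold_locales (simp add: V_def)

sublocale v: complex_q_sequence q \<alpha> l v
  by unfold_locales (simp_all add: v_def V_def q_gt_1 \<alpha>_nz poly_power left_diff_distrib)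

lemma norm_q: "norm q = \<bar>real_of_int \<rho>\<bar> / \<bar>real_of_int \<sigma>\<bar>"
  by (simp add: q_eq norm_divide)

lemma logs: "ln \<bar>real_of_int \<rho>\<bar> > 0" "ln \<bar>real_of_int \<sigma>\<bar> \<ge> 0" "ln (norm q) = ln \<bar>real_of_int \<rho>\<bar> - ln \<bar>real_of_int \<sigma>\<bar>"
proof -
  have \<sigma>: "1 \<le> \<bar>real_of_int \<sigma>\<bar>" using \<sigma>_nonzero by linarith
  have \<rho>: "0 < \<bar>real_of_int \<rho>\<bar>" using \<rho>_nonzero by simp
  show eq: "ln (norm q) = ln \<bar>real_of_int \<rho>\<bar> - ln \<bar>real_of_int \<sigma>\<bar>"
    unfolding norm_q using \<sigma> \<rho> by (simp add: ln_div)
  show "ln \<bar>real_of_int \<sigma>\<bar> \<ge> 0" using \<sigma> by simp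
  then show "ln \<bar>real_of_int \<rho>\<bar> > 0" using eq ln_gt_zero[OF q_gt_1] by linarith
qed

text \<open>The divisor sums are \<open>ln |\<rho> ^ m - \<sigma> ^ m|\<close>, and \<open>|1 - 1 / q ^ m|\<close> stays away from 0 and
  infinity.\<close>

lemma divisor_weights_log_cyclotomic: "\<exists>C. divisor_weights log_cyclotomic (ln \<bar>real_of_int \<rho>\<bar>) C"
proof -
  let ?Q = "norm q"
  define C where "C = max (ln 2) (- ln (1 - 1 / ?Q))"
  have "\<bar>(\<Sum>d | d dvd m. log_cyclotomic d) - real m * ln \<bar>real_of_int \<rho>\<bar>\<bar> \<le> C" if m: "m > 0" for m
  proof -
    have Q: "?Q > 0" using q_gt_1 by linarith
    define z where "z = norm (1 - 1 / q ^ m)"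
    have "?Q ^ 1 \<le> ?Q ^ m" using q_gt_1 m by (intro power_increasing) auto
    then have small: "norm (1 / q ^ m) \<le> 1 / ?Q" using Q by (simp add: norm_divide norm_power frac_le)
    have "1 / ?Q < 1" using q_gt_1 Q by (simp add: divide_less_eq)
    have z1: "1 - 1 / ?Q \<le> z"
      using norm_triangle_ineq2[of 1 "1 / q ^ m"] small by (simp add: z_def)
    have z2: "z \<le> 2"
      using norm_triangle_ineq4[of 1 "1 / q ^ m"] small \<open>1 / ?Q < 1\<close> by (simp add: z_def)
    have z0: "z > 0" "1 - 1 / ?Q > 0" using z1 \<open>1 / ?Q < 1\<close> by linarith+
    have "q ^ m - 1 = q ^ m * (1 - 1 / q ^ m)" using Q by (simp add: right_diff_distrib)
    then have "norm (q ^ m - 1) = ?Q ^ m * z" unfolding z_def by (simp only: norm_mult norm_power)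
    then have "ln (norm (q ^ m - 1)) = m * ln ?Q + ln z"
      using Q z0 by (simp add: ln_mult ln_realpow)
    then have "(\<Sum>d | d dvd m. log_cyclotomic d) - real m * ln \<bar>real_of_int \<rho>\<bar> = ln z"
      unfolding sum_log_cyclotomic[OF m] logs(3) by (simp add: algebra_simps)
    moreover have "ln (1 - 1 / ?Q) \<le> ln z" "ln z \<le> ln 2" using z0 z1 z2 by simp_all
    ultimately show ?thesis unfolding C_def by linarith
  qed
  then show ?thesis
    using log_cyclotomic_nonneg logs(1) by (intro exI[of _ C]) (unfold_locales, auto)
qed

definition order_at_0 :: real where
  "order_at_0 = (if l = 0 then 5 / 24 else 1 / 6)"

lemma power_X_dvd_det:
  "\<exists>W. [:0, 1:] ^ W dvd det (hankel V n) \<and> real W \<ge> order_at_0 * real n ^ 3 - 2 * (real n)\<^sup>2"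
proof (cases "l = 0")
  case True
  interpret q_sequence_0 "[:0, 1:]" "[:\<alpha>:]" V
    using V.q_sequence_axioms True by (simp add: q_sequence_0_def)
  show ?thesis
    unfolding order_at_0_def if_P[OF True] by (rule power_dvd_det_hankel_at_0_improved)
next
  case False
  show ?thesis
    using V.power_dvd_det_hankel_at_0[of n] half_square_sum_bound[of n] False
    by (intro exI[of _ "\<Sum>i<n. 2 * ((i div 2) * (i div 2 - 1))"]) (simp add: order_at_0_def)
qed

lemma degree_sum_bound: "real (\<Sum>i<n. 2 * (i * i + i)) \<le> 2 / 3 * real n ^ 3 + (real n)\<^sup>2"
proof -
  have "real (\<Sum>i<n. 2 * (i * i + i)) = 2 * (\<Sum>i<n. (real i)\<^sup>2) + 2 * (\<Sum>i<n. real i)"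
    by (simp add: sum_distrib_left sum.distrib power2_eq_square distrib_left)
  also have "\<dots> \<le> 2 / 3 * real n ^ 3 + (real n)\<^sup>2"
    unfolding sum_real_squares_lessThan sum_real_lessThan
    by (simp add: field_simps power2_eq_square power3_eq_cube)
  finally show ?thesis .
qed

text \<open>For the infinitely many n with non-zero determinant, the lower bound from integrality is compared with the analytic upper
  bound. All error terms are \<open>O(n\<^sup>2)\<close> except the one in the weight of the cyclotomic factor, which is handled by an
  arbitrary \<open>e > 0\<close> and a truncation of the sum over \<theta>.\<close>

lemma fundamental_inequality:
  "(order_at_0 + gain_constant / pi\<^sup>2 + 2 / 3 * (if l = 0 then 3 / 4 else 1 / 2)) * ln \<bar>real_of_int \<rho>\<bar> \<le>
     (2 / 3 + 2 / 3 * (if l = 0 then 3 / 4 else 1 / 2)) * ln \<bar>real_of_int \<sigma>\<bar>"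
proof -
  obtain C0 where C0: "\<And>n. norm (v n) \<le> C0 * norm \<alpha> ^ n"
    using v.bounded_of_q_series[OF l_not_power] by (auto simp: v_def V_def)
  interpret d: decaying_q_sequence q \<alpha> l v C0
    by unfold_locales (rule C0)
  obtain c where c: "\<And>n. norm (det (hankel v n)) \<le>
      exp (c * (real n)\<^sup>2 - 2 / 3 * d.decay_rate * ln (norm q) * real n ^ 3)"
    using d.norm_det_hankel_bound by blast
  obtain C where "divisor_weights log_cyclotomic (ln \<bar>real_of_int \<rho>\<bar>) C"
    using divisor_weights_log_cyclotomic by blast
  then interpret w: divisor_weights log_cyclotomic "ln \<bar>real_of_int \<rho>\<bar>" C .
  let ?R = "ln \<bar>real_of_int \<rho>\<bar>" and ?S = "ln \<bar>real_of_int \<sigma>\<bar>"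
  define D' :: real where "D' = ln D"
  have D': "D' \<ge> 0" using D_pos by (simp add: D'_def)
  have upper: "W * ?R + (\<Sum>d=1..n. real (\<Sum>i<n. gain (i div d)) * log_cyclotomic d) \<le>
      (2 / 3 * real n ^ 3 + (real n)\<^sup>2) * ?S + (real n)\<^sup>2 * D' +
      (c * (real n)\<^sup>2 - 2 / 3 * d.decay_rate * ln (norm q) * real n ^ 3)"
    if nz: "det (hankel v n) \<noteq> 0" and W: "[:0, 1:] ^ W dvd det (hankel V n)" for n W
  proof -
    let ?V = "smult (of_int D ^ (n * n)) (det (hankel V n))" and ?F = "V.known_factor W n"
    let ?N = "\<Sum>i<n. 2 * (i * i + i)"
    have ev: "poly ?V q = of_int D ^ (n * n) * det (hankel v n)"
      by (simp add: poly_det_hankel v_def[abs_def])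
    have b: "of_int D * (qF q \<alpha> l - 1) \<in> \<int>" using D_\<mu> by (simp add: right_diff_distrib)
    have V0: "V 0 = [:qF q \<alpha> l - 1:]" by (simp add: V_def)
    have le: "norm (hom_value ?F) \<le> \<bar>real_of_int \<sigma>\<bar> ^ ?N * norm (poly ?V q)"
    proof (rule integral_poly_lower_bound)
      show "integral_poly ?V" by (rule V.det_hankel_integral[OF _ D_\<alpha> D_l V0 b]) simp
      show "degree ?V \<le> ?N"
        using V.degree_det_hankel[OF V0, of n] degree_smult_le order_trans by blast
      show "poly ?V q \<noteq> 0" unfolding ev using nz D_pos by simp
      show "?F dvd ?V" using V.known_factor_dvd[OF W] by (rule dvd_smult)
    qed (rule V.known_factor_integral V.known_factor_monic)+
    have F: "norm (hom_value ?F) = \<bar>real_of_int \<rho>\<bar> ^ W * (\<Prod>d=1..n. norm (hom_value (cyclotomic d)) ^ (\<Sum>i<n. gain (i div d)))"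
      by (simp add: V.known_factor_def hom_value_mult hom_value_X_power hom_value_prod hom_value_power
          norm_mult norm_power prod_norm[symmetric])
    have pos: "norm (hom_value (cyclotomic d)) > 0" for d using hom_value_cyclotomic_nonzero by simp
    have "ln (norm (hom_value ?F)) = W * ?R + (\<Sum>d=1..n. real (\<Sum>i<n. gain (i div d)) * log_cyclotomic d)"
    proof -
      have "ln (\<Prod>d=1..n. norm (hom_value (cyclotomic d)) ^ (\<Sum>i<n. gain (i div d))) =
          (\<Sum>d=1..n. ln (norm (hom_value (cyclotomic d)) ^ (\<Sum>i<n. gain (i div d))))"
        by (rule ln_prod) (use pos in auto)
      also have "\<dots> = (\<Sum>d=1..n. real (\<Sum>i<n. gain (i div d)) * log_cyclotomic d)"
        by (rule sum.cong) (use pos in \<open>auto simp: log_cyclotomic_def ln_realpow\<close>)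
      finally show ?thesis
        unfolding F using \<rho>_nonzero pos by (subst ln_mult) (auto simp: ln_realpow intro!: prod_pos)
    qed
    moreover have "ln (norm (hom_value ?F)) \<le> ln (\<bar>real_of_int \<sigma>\<bar> ^ ?N * norm (poly ?V q))"
    proof -
      have "norm (hom_value ?F) > 0" unfolding F using \<rho>_nonzero pos by (auto intro!: mult_pos_pos prod_pos)
      with le less_le_trans[OF this le] show ?thesis by (subst ln_le_cancel_iff)
    qed
    moreover have "ln (\<bar>real_of_int \<sigma>\<bar> ^ ?N * norm (poly ?V q)) = ?N * ?S + (n * n) * D' + ln (norm (det (hankel v n)))"
      unfolding ev using \<sigma>_nonzero nz D_pos
      by (simp add: norm_mult norm_power ln_mult ln_realpow D'_def del: of_nat_sum)
    moreover have "real ?N * ?S \<le> (2 / 3 * real n ^ 3 + (real n)\<^sup>2) * ?S"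
      by (intro mult_right_mono degree_sum_bound logs)
    moreover have "ln (norm (det (hankel v n))) \<le> c * (real n)\<^sup>2 - 2 / 3 * d.decay_rate * ln (norm q) * real n ^ 3"
      using c[of n] nz ln_le_cancel_iff[of "norm (det (hankel v n))" "exp (c * (real n)\<^sup>2 - 2 / 3 * d.decay_rate * ln (norm q) * real n ^ 3)"]
      by simp
    ultimately show ?thesis by (simp add: power2_eq_square)
  qed
  define X where "X T e = (order_at_0 + 1 / pi\<^sup>2 * T + 2 / 3 * d.decay_rate) * ?R -
      (2 / 3 + 2 / 3 * d.decay_rate) * ?S - e" for T e
  have X: "X (\<Sum>\<theta>\<in>{\<theta>\<in>{1..m}. \<theta> mod 3 \<noteq> 1}. 1 / (real \<theta>)\<^sup>2) e \<le> 0" if e: "e > 0" for m e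
  proof (rule frequently_cubic_bound[where y = "2 * ?R + ?S + D' + c"])
    let ?T = "\<Sum>\<theta>\<in>{\<theta>\<in>{1..m}. \<theta> mod 3 \<noteq> 1}. 1 / (real \<theta>)\<^sup>2"
    fix N
    obtain N' where N': "\<And>n. n \<ge> N' \<Longrightarrow> (\<Sum>d=1..n. real (\<Sum>i<n. gain (i div d)) * log_cyclotomic d) \<ge>
        (?R / pi\<^sup>2 * ?T - e) * real n ^ 3"
      using w.gain_weighted_sum_lower_bound[OF e, of m] unfolding eventually_sequentially by blast
    have "\<exists>n\<ge>max N N'. det (hankel v n) \<noteq> 0"
    proof (rule v.det_hankel_nonzero_infinitely_often)
      fix k :: nat assume "k > 0"
      then show "\<alpha> \<noteq> - l * q ^ k" using \<alpha>_not_power by (auto simp: pos_powers_def)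
    qed
    then obtain n where n: "n \<ge> max N N'" "det (hankel v n) \<noteq> 0" by blast
    obtain W where W: "[:0, 1:] ^ W dvd det (hankel V n)"
      "real W \<ge> order_at_0 * real n ^ 3 - 2 * (real n)\<^sup>2"
      using power_X_dvd_det by blast
    have "(order_at_0 * real n ^ 3 - 2 * (real n)\<^sup>2) * ?R \<le> W * ?R"
      using W(2) logs(1) by (intro mult_right_mono) auto
    with upper[OF n(2) W(1)] N'[of n] n(1)
    have "(order_at_0 * real n ^ 3 - 2 * (real n)\<^sup>2) * ?R + (?R / pi\<^sup>2 * ?T - e) * real n ^ 3 \<le>
      (2 / 3 * real n ^ 3 + (real n)\<^sup>2) * ?S + (real n)\<^sup>2 * D' +
      (c * (real n)\<^sup>2 - 2 / 3 * d.decay_rate * (?R - ?S) * real n ^ 3)"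
      unfolding logs(3) by linarith
    then have "X ?T e * real n ^ 3 \<le> (2 * ?R + ?S + D' + c) * (real n)\<^sup>2"
      unfolding X_def by (simp add: algebra_simps diff_divide_distrib add_divide_distrib)
    then show "\<exists>n\<ge>N. X ?T e * real n ^ 3 \<le> (2 * ?R + ?S + D' + c) * (real n)\<^sup>2"
      using n(1) by auto
  qed
  have X_limit: "X gain_constant e \<le> 0" if e: "e > 0" for e
  proof (rule LIMSEQ_le_const2)
    show "(\<lambda>m. X (\<Sum>\<theta>\<in>{\<theta>\<in>{1..m}. \<theta> mod 3 \<noteq> 1}. 1 / (real \<theta>)\<^sup>2) e) \<longlonglongrightarrow> X gain_constant e"
      unfolding X_def by (intro tendsto_intros gain_constant_LIMSEQ)
  qed (use X[OF e] in blast)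
  have "(order_at_0 + 1 / pi\<^sup>2 * gain_constant + 2 / 3 * d.decay_rate) * ?R -
      (2 / 3 + 2 / 3 * d.decay_rate) * ?S \<le> e" if "e > 0" for e
    using X_limit[OF that] unfolding X_def by linarith
  then have "(order_at_0 + 1 / pi\<^sup>2 * gain_constant + 2 / 3 * d.decay_rate) * ?R -
      (2 / 3 + 2 / 3 * d.decay_rate) * ?S \<le> 0"
    by (rule field_le_epsilon) (simp only: add_0)
  then show ?thesis unfolding d.decay_rate_def by simp
qed

lemma log_ratio_le_threshold:
  "ln \<bar>real_of_int \<sigma>\<bar> > 0" "ln \<bar>real_of_int \<rho>\<bar> / ln \<bar>real_of_int \<sigma>\<bar> \<le> threshold l"
proof -
  let ?R = "ln \<bar>real_of_int \<rho>\<bar>" and ?S = "ln \<bar>real_of_int \<sigma>\<bar>"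
  let ?c = "Im (Li2 (exp (2 * of_real pi * \<i> / 3)))"
  define x where "x = order_at_0 + gain_constant / pi\<^sup>2 + 2 / 3 * (if l = 0 then 3 / 4 else 1 / 2)"
  define y :: real where "y = 2 / 3 + 2 / 3 * (if l = 0 then 3 / 4 else 1 / 2)"
  have le: "x * ?R \<le> y * ?S" using fundamental_inequality by (simp add: x_def y_def)
  have "gain_constant / pi\<^sup>2 \<ge> 0" using gain_constant_nonneg by simp
  then have x: "x > 0" by (auto simp: x_def order_at_0_def add_nonneg_pos)
  have y: "y > 0" by (auto simp: y_def)
  have "0 < x * ?R" using x logs(1) by simp
  with le have "0 < y * ?S" by linarith
  then show S: "?S > 0" using y by (simp add: zero_less_mult_iff)
  have "?R / ?S \<le> y / x" using le x S by (simp add: field_simps)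
  also have "y / x = threshold l"
  proof -
    have sqrt: "?c / sqrt 3 = sqrt 3 * ?c / 3" by (simp add: field_simps)
    have "x * pi\<^sup>2 = (if l = 0 then (173 * pi\<^sup>2 - 72 * sqrt 3 * ?c) / 216 else (16 * pi\<^sup>2 - 9 * sqrt 3 * ?c) / 27)"
      unfolding x_def order_at_0_def gain_constant_def sqrt by (simp add: field_simps)
    moreover have "y / x = y * pi\<^sup>2 / (x * pi\<^sup>2)" by simp
    ultimately have "y / x = y * pi\<^sup>2 / (if l = 0 then (173 * pi\<^sup>2 - 72 * sqrt 3 * ?c) / 216 else (16 * pi\<^sup>2 - 9 * sqrt 3 * ?c) / 27)"
      by (simp only:)
    then show ?thesis by (simp add: threshold_def Let_def y_def)
  qed
  finally show "?R / ?S \<le> threshold l" .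
qed

end

lemma Rats_common_denominator:
  fixes x y z :: complex
  assumes "x \<in> \<rat>" "y \<in> \<rat>" "z \<in> \<rat>"
  shows "\<exists>D::int. D > 0 \<and> of_int D * x \<in> \<int> \<and> of_int D * y \<in> \<int> \<and> of_int D * z \<in> \<int>"
proof -
  have denominator: "\<exists>d::int. d > 0 \<and> of_int d * x \<in> \<int>" if x: "x \<in> \<rat>" for x :: complex
  proof -
    from x obtain a b :: int where "b > 0" "x = of_int a / of_int b"
      by (rule Rats_cases')
    then show ?thesis by (intro exI[of _ b]) auto
  qed
  obtain d1 d2 d3 :: int where d: "d1 > 0" "of_int d1 * x \<in> \<int>" "d2 > 0" "of_int d2 * y \<in> \<int>"
    "d3 > 0" "of_int d3 * z \<in> \<int>"
    using denominator[OF assms(1)] denominator[OF assms(2)] denominator[OF assms(3)] by blast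
  have "of_int (d1 * d2 * d3) * x = of_int (d2 * d3) * (of_int d1 * x)"
    "of_int (d1 * d2 * d3) * y = of_int (d1 * d3) * (of_int d2 * y)"
    "of_int (d1 * d2 * d3) * z = of_int (d1 * d2) * (of_int d3 * z)" by simp_all
  then show ?thesis
    using d by (intro exI[of _ "d1 * d2 * d3"]) (simp only: Ints_mult Ints_of_int, simp)
qed

text \<open>If q is an integer, it is written as \<open>q / 1\<close>. Then the logarithm of the denominator is zero and the
  fundamental inequality fails outright.\<close>

theorem theorem2:
  fixes \<rho> \<sigma> :: int and q \<alpha> l \<mu> :: complex
  assumes "\<rho> \<noteq> 0" and "\<sigma> \<noteq> 0"
    and "q = of_int \<rho> / of_int \<sigma>"
    and "norm q > 1"
    and "\<alpha> \<noteq> 0"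
    and "l \<notin> pos_powers q"
    and "\<alpha> \<notin> {- l * p | p. p \<in> pos_powers q}"
    and "log_ratio \<rho> \<sigma> > ereal (threshold l)"
    and "\<mu> = qF q \<alpha> l"
  shows "\<not> (\<alpha> \<in> \<rat> \<and> l \<in> \<rat> \<and> \<mu> \<in> \<rat>)"
proof
  assume "\<alpha> \<in> \<rat> \<and> l \<in> \<rat> \<and> \<mu> \<in> \<rat>"
  then obtain D :: int where D: "D > 0" "of_int D * \<alpha> \<in> \<int>" "of_int D * l \<in> \<int>" "of_int D * \<mu> \<in> \<int>"
    using Rats_common_denominator by blast
  show False
  proof (cases "real_of_int \<rho> / real_of_int \<sigma> \<in> \<int>")
    case True
    then obtain r where r: "real_of_int \<rho> / real_of_int \<sigma> = real_of_int r" by (auto elim: Ints_cases)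
    have "q = of_real (real_of_int \<rho> / real_of_int \<sigma>)" using assms(3) by simp
    then have q: "q = of_int r / of_int 1" unfolding r by simp
    have "r \<noteq> 0" using q assms(4) by auto
    interpret rational_values r 1 q \<alpha> l D
      by unfold_locales (use assms D q \<open>r \<noteq> 0\<close> in auto)
    show False using log_ratio_le_threshold(1) by simp
  next
    case False
    interpret rational_values \<rho> \<sigma> q \<alpha> l D
      by unfold_locales (use assms D in auto)
    show False using log_ratio_le_threshold(2) assms(8) False by (simp add: log_ratio_def)
  qed
qed

end
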